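(* Let $n\ge 2$, $l\ge 1$, let $\mathcal{A}_1,\dots,\mathcal{A}_l\subset\{0,1,\dots,n-1\}$ be non-empty, let $K_1,\dots,K_l\subset[0,1]$ be the self-similar sets $K_i=\bigcup_{a\in\mathcal{A}_i}\frac{K_i+a}{n}$, and let $\mathbf{m}=(m_1,\dots,m_l)\in\mathbb{Z}^l$ with $\prod_i m_i\ne 0$. Let $U_1$, the set $\Xi$, the directed graph $G_\Xi$ with transition matrix $M$, its strongly connected components $\{\Xi_i\}_i$, the numbers $\rho(\Xi_i)$, the order $\prec$, and the covering condition be as defined in the context. Let $s=\frac{\log\rho(M)}{\log n}$ (with $s$ read as $0$ if $\rho(M)=0$). Then: (1) $\dim_H U_1\ge s$ and $\mathcal{H}^s(U_1)>0$. (2) If the covering condition holds for $\prod_{i=1}^l K_i$ with respect to $\mathbf{m}$, then $\dim_H U_1=s$. (3) Suppose the covering condition holds for $\prod_{i=1}^l K_i$ with respect to $\mathbf{m}$, every $K_i$ satisfies the strong separation condition (i.e. $1\notin\mathcal{A}_i-\mathcal{A}_i$ for all $i$), and $s>0$. Then $\mathcal{H}^s(U_1)=\infty$ if and only if there are two different strongly connected components $\Xi_i$ and $\Xi_j$ of $G_\Xi$ such that $\rho(\Xi_i)=\rho(\Xi_j)=\rho(M)$ and $\Xi_i\prec\Xi_j$. In particular, if $M$ is irreducible, then $0<\mathcal{H}^s(U_1)<\infty$.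
   Context: $K_i$ is the unique non-empty compact set with $K_i=\bigcup_{a\in\mathcal{A}_i}n^{-1}(K_i+a)$. $(\cdot,\cdot)$ is the standard inner product on $\mathbb{R}^l$; for $B\subset\mathbb{R}^l$, $(\mathbf{m},B)=\{(\mathbf{m},b):b\in B\}$. $\dim_H$ and $\mathcal{H}^s$ denote Hausdorff dimension and $s$-dimensional Hausdorff measure. For $x\in\mathbb{R}$, $S_x=\{\mathbf{y}\in\prod_{i=1}^lK_i:(\mathbf{m},\mathbf{y})=x\}$, and for $r\in\mathbb{N}^+$, $U_r=\{x:\mathrm{Card}(S_x)=r\}$. Let $m_*=\sum_{m_i<0}m_i$ and $m^*=\sum_{m_i>0}m_i$ (empty sums are $0$), so $(\mathbf{m},[0,1]^l)=[m_*,m^*]$. For $\mathbf{i}\in\prod_{i=1}^l\mathcal{A}_i$ let $\mathbf{c}_{\mathbf{i}}=\frac{\mathbf{i}+[0,1]^l}{n}$, so $(\mathbf{m},\mathbf{c}_{\mathbf{i}})=n^{-1}((\mathbf{m},\mathbf{i})+[m_*,m^*])$. The covering condition holds for $\prod_{i=1}^l K_i$ with respect to $\mathbf{m}$ if $\bigcup_{\mathbf{i}\in\prod_{i=1}^l\mathcal{A}_i}(\mathbf{m},\mathbf{c}_{\mathbf{i}})=[m_*,m^*]$. An integer interval is an interval $I=n^{-1}[u,u+1]\subset[m_*,m^*]$ with $u\in\mathbb{Z}$. The working intervals are $J_t=[t,t+1]$, $t\in[m_*,m^*-1]\cap\mathbb{Z}$. An integer interval $I=n^{-1}[u,u+1]$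 is of type $t\in[m_*,m^*-1]\cap\mathbb{Z}$ if $u-(\mathbf{m},\mathbf{i})=t$ for some $\mathbf{i}\in\prod_{i=1}^l\mathcal{A}_i$. For integer intervals $I_1,I_2$ write $I_1\to I_2$ if there is an integer $t\in[m_*,m^*-1]$ such that $I_1$ is of type $t$ and $I_2\subset J_t$. $\Xi$ is the collection of integer intervals $I$ for which there is a unique $\mathbf{i}\in\prod_{i=1}^l\mathcal{A}_i$ with $I\subset(\mathbf{m},\mathbf{c}_{\mathbf{i}})$. $G_\Xi$ is the directed graph with vertex set $\Xi$ and an edge from $I_1$ to $I_2$ iff $I_1\to I_2$. $M$ is its $0$-$1$ transition (adjacency) matrix and $\rho(M)$ its spectral radius. $\{\Xi_i\}_i$ are the strongly connected components of $G_\Xi$, and $\rho(\Xi_i)$ is the spectral radius of the adjacency matrix of the subgraph restricted to $\Xi_i$ (a single vertex without a loop is a component of spectral radius $0$). For strongly connected components $H,H'$ of a directed graph, $H\prec H'$ means $H=H'$ or there is a directed path from a vertex of $H$ to a vertex of $H'$. *)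

theory Defs
  imports
    "HOL-Analysis.Analysis"
    "Jordan_Normal_Form.Spectral_Radius"
    "Graph_Theory.Digraph_Component"
begin

no_notation Matrix.vec_index (infixl "$" 100)

section \<open>Hausdorff measure and dimension\<close>

text \<open>
  The gauge is \<open>diam(U)\<^sup>s\<close> with the conventions \<open>diam({})\<^sup>s = 0\<close> and \<open>0\<^sup>0 = 1\<close>, so that
  \<open>s = 0\<close> gives counting measure. The case distinction is needed because \<open>0 powr 0 = 0\<close>.
\<close>

definition hausdorff_gauge :: "real \<Rightarrow> 'a::metric_space set \<Rightarrow> ennreal" where
  "hausdorff_gauge s U =
     (if U = {} then 0 else if s = 0 then 1 else ennreal (diameter U powr s))"

text \<open>
  Finite covers are included, by padding with empty sets. Boundedness is required because
  \<^const>\<open>diameter\<close> is only meaningful for bounded sets.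
\<close>

definition hausdorff_covers :: "real \<Rightarrow> 'a::metric_space set \<Rightarrow> (nat \<Rightarrow> 'a set) set" where
  "hausdorff_covers \<delta> E =
     {U. E \<subseteq> (\<Union>j. U j) \<and> (\<forall>j. bounded (U j) \<and> diameter (U j) \<le> \<delta>)}"

definition hausdorff_premeasure :: "real \<Rightarrow> real \<Rightarrow> 'a::metric_space set \<Rightarrow> ennreal" where
  "hausdorff_premeasure s \<delta> E = (INF U\<in>hausdorff_covers \<delta> E. \<Sum>j. hausdorff_gauge s (U j))"

definition hausdorff_measure :: "real \<Rightarrow> 'a::metric_space set \<Rightarrow> ennreal" where
  "hausdorff_measure s E = (SUP \<delta>\<in>{0<..}. hausdorff_premeasure s \<delta> E)"

definition hausdorff_dim :: "'a::metric_space set \<Rightarrow> ereal" where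
  "hausdorff_dim E = Inf {ereal s | s. 0 \<le> s \<and> hausdorff_measure s E = 0}"


section \<open>Directed graphs and their adjacency matrices\<close>

text \<open>
  For finite graphs. Rows and columns are indexed by natural numbers, so the vertices are
  enumerated; the spectral radius and irreducibility do not depend on the enumeration chosen.
\<close>

definition adjacency_matrix :: "('v, 'e) pre_digraph \<Rightarrow> real mat" where
  "adjacency_matrix G =
     Matrix.mat (card (verts G)) (card (verts G))
       (\<lambda>(i, j). if from_nat_into (verts G) i \<rightarrow>\<^bsub>G\<^esub> from_nat_into (verts G) j then 1 else 0)"

definition real_spectral_radius :: "real mat \<Rightarrow> real" where
  "real_spectral_radius M = spectral_radius (map_mat complex_of_real M)"

text \<open>Irreducibility of a (square) matrix with non-negative entries.\<close>

definition irreducible_nonneg_mat :: "real mat \<Rightarrow> bool" where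
  "irreducible_nonneg_mat M \<longleftrightarrow>
     (\<forall>i<dim_row M. \<forall>j<dim_row M. \<exists>k>0. (M ^\<^sub>m k) $$ (i, j) > 0)"

definition scc_prec ::
  "('v, 'e) pre_digraph \<Rightarrow> ('v, 'e) pre_digraph \<Rightarrow> ('v, 'e) pre_digraph \<Rightarrow> bool" where
  "scc_prec G H H' \<longleftrightarrow> H = H' \<or> (\<exists>u\<in>verts H. \<exists>v\<in>verts H'. u \<rightarrow>\<^sup>*\<^bsub>G\<^esub> v)"


section \<open>Self-similar sets and projections of their products\<close>

text \<open>
  This determines \<open>K\<close> uniquely when \<open>D\<close> is finite and non-empty and \<open>n \<ge> 2\<close>.
\<close>

definition is_self_similar_set :: "nat \<Rightarrow> int set \<Rightarrow> real set \<Rightarrow> bool" where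
  "is_self_similar_set n D K \<longleftrightarrow>
     K \<noteq> {} \<and> compact K \<and> K = (\<Union>a\<in>D. (\<lambda>x. (x + real_of_int a) / real n) ` K)"

definition strong_separation :: "int set \<Rightarrow> bool" where
  "strong_separation D \<longleftrightarrow> 1 \<notin> {a - b | a b. a \<in> D \<and> b \<in> D}"

text \<open>
  Integer \<open>l\<close>-tuples are functions on a finite index type \<open>'l\<close> with \<open>l\<close> elements, embedded into
  Euclidean space here.
\<close>

definition rvec :: "('l::finite \<Rightarrow> int) \<Rightarrow> real^'l" where
  "rvec f = (\<chi> k. real_of_int (f k))"

definition fibre :: "('l::finite \<Rightarrow> int) \<Rightarrow> ('l \<Rightarrow> real set) \<Rightarrow> real \<Rightarrow> (real^'l) set" where
  "fibre m K x = {y. (\<forall>k. y $ k \<in> K k) \<and> rvec m \<bullet> y = x}"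

definition U_set :: "('l::finite \<Rightarrow> int) \<Rightarrow> ('l \<Rightarrow> real set) \<Rightarrow> nat \<Rightarrow> real set" where
  "U_set m K r = {x. finite (fibre m K x) \<and> card (fibre m K x) = r}"

definition m_lower :: "('l::finite \<Rightarrow> int) \<Rightarrow> int" where
  "m_lower m = (\<Sum>k | m k < 0. m k)"

definition m_upper :: "('l::finite \<Rightarrow> int) \<Rightarrow> int" where
  "m_upper m = (\<Sum>k | m k > 0. m k)"

definition cube :: "nat \<Rightarrow> ('l::finite \<Rightarrow> int) \<Rightarrow> (real^'l) set" where
  "cube n i = (\<lambda>y. (1 / real n) *\<^sub>R (rvec i + y)) ` cbox 0 1"

definition cube_proj :: "nat \<Rightarrow> ('l::finite \<Rightarrow> int) \<Rightarrow> ('l \<Rightarrow> int) \<Rightarrow> real set" where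
  "cube_proj n m i = (\<lambda>y. rvec m \<bullet> y) ` cube n i"

definition covering_condition :: "nat \<Rightarrow> ('l::finite \<Rightarrow> int set) \<Rightarrow> ('l \<Rightarrow> int) \<Rightarrow> bool" where
  "covering_condition n A m \<longleftrightarrow>
     (\<Union>i\<in>Pi UNIV A. cube_proj n m i) = {real_of_int (m_lower m) .. real_of_int (m_upper m)}"


section \<open>The graph of integer intervals\<close>

definition unit_interval_at :: "nat \<Rightarrow> int \<Rightarrow> real set" where
  "unit_interval_at n u = {real_of_int u / real n .. (real_of_int u + 1) / real n}"

definition integer_intervals :: "nat \<Rightarrow> ('l::finite \<Rightarrow> int) \<Rightarrow> real set set" where
  "integer_intervals n m =
     {unit_interval_at n u | u.
        unit_interval_at n u \<subseteq> {real_of_int (m_lower m) .. real_of_int (m_upper m)}}"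

definition working_interval :: "int \<Rightarrow> real set" where
  "working_interval t = {real_of_int t .. real_of_int t + 1}"

definition has_type ::
  "nat \<Rightarrow> ('l::finite \<Rightarrow> int set) \<Rightarrow> ('l \<Rightarrow> int) \<Rightarrow> real set \<Rightarrow> int \<Rightarrow> bool" where
  "has_type n A m I t \<longleftrightarrow>
     t \<in> {m_lower m .. m_upper m - 1} \<and>
     (\<exists>u. I = unit_interval_at n u \<and>
          (\<exists>i\<in>Pi UNIV A. real_of_int u - rvec m \<bullet> rvec i = real_of_int t))"

definition interval_step ::
  "nat \<Rightarrow> ('l::finite \<Rightarrow> int set) \<Rightarrow> ('l \<Rightarrow> int) \<Rightarrow> real set \<Rightarrow> real set \<Rightarrow> bool" where
  "interval_step n A m I\<^sub>1 I\<^sub>2 \<longleftrightarrow>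
     (\<exists>t\<in>{m_lower m .. m_upper m - 1}. has_type n A m I\<^sub>1 t \<and> I\<^sub>2 \<subseteq> working_interval t)"

definition Xi :: "nat \<Rightarrow> ('l::finite \<Rightarrow> int set) \<Rightarrow> ('l \<Rightarrow> int) \<Rightarrow> real set set" where
  "Xi n A m = {I \<in> integer_intervals n m. \<exists>!i. i \<in> Pi UNIV A \<and> I \<subseteq> cube_proj n m i}"

definition Xi_graph ::
  "nat \<Rightarrow> ('l::finite \<Rightarrow> int set) \<Rightarrow> ('l \<Rightarrow> int) \<Rightarrow> (real set, real set \<times> real set) pre_digraph" where
  "Xi_graph n A m =
     \<lparr> verts = Xi n A m,
       arcs = {(I\<^sub>1, I\<^sub>2). I\<^sub>1 \<in> Xi n A m \<and> I\<^sub>2 \<in> Xi n A m \<and> interval_step n A m I\<^sub>1 I\<^sub>2},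
       tail = fst, head = snd \<rparr>"

end

theory Submission
  imports Defs
begin

text \<open>
  Let \<open>V\<close> be the set of integers \<open>u\<close> with \<open>n\<inverse>[u, u + 1] \<in> \<Xi>\<close>. A vertex \<open>u\<close> has a unique type, so an infinite
  path in \<open>G\<^sub>\<Xi>\<close> is the itinerary of exactly one real number, and up to \<open>n\<close>-adic rationals the points
  coded by infinite paths have exactly one preimage in the product. Paths of length \<open>k\<close> correspond
  injectively to \<open>n\<close>-adic intervals of level \<open>k\<close>, so everything is governed by the number of paths.

  Lower bounds come from mass distributions on the tree of paths. These need only
  be superadditive, so a subsolution \<open>\<rho> h \<le> M h\<close> with \<open>h \<ge> 0\<close> suffices, and the moduli of a complex
  eigenvector give one. If two different components of spectral radius \<open>\<rho>\<close> are comparable, then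
  \<open>\<rho>\<^sup>-\<^sup>k M\<^sup>k h\<close> is unbounded for a suitable subsolution, and masses that are arbitrarily large in total
  but uniformly bounded on deep cylinders show that the measure is infinite. Otherwise \<open>M\<^sup>k\<close> is bounded
  by a multiple of \<open>\<rho>\<^sup>k\<close>, and the covering by intervals of level \<open>k\<close> gives a finite measure.

  Under the covering condition every point of \<open>U\<^sub>1\<close> that is not \<open>n\<close>-adic is coded if digit expansions are
  unique, as under strong separation. In general this holds after finitely many shifts: then every
  \<open>n\<close>-adic coordinate has become \<open>0\<close> or \<open>1\<close>.
\<close>

section \<open>Spectral radius of a finite relation\<close>

text \<open>The radius \<rho> of a 0-1 matrix is 0 or at least 1, which makes s nonnegative. For s =
  0 the gauge counts, and positivity is the mere non-emptiness of U_1; for s > 0 countable sets are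
  null, in particular the n-adic points, where neighbouring intervals meet. The spectral radius is
  used only through inequalities between functions on vertices: subsolutions bound it from below,
  supersolutions from above, and the maximum of a quotient compares the two. Positive supersolutions
  are available for every factor above \<rho>, but not in general for \<rho> itself, because Jordan
  blocks for eigenvalues of modulus \<rho> can make the powers of M grow faster than those of \<rho>
  by a polynomial factor. This growth separates infinite from finite measure. Shifting a point until
  its digits are unique places U_1, up to n-adic points, in countably many contracted copies of the
  coded set. Such a union keeps null sets null, which serves the dimension, but it does not preserve
  finiteness; the finite case of (3) therefore takes its unique digits from strong
  separation.\<close>

definition rel_matrix :: "('v \<Rightarrow> 'v \<Rightarrow> bool) \<Rightarrow> 'v set \<Rightarrow> real mat" where
  "rel_matrix E S = Matrix.mat (card S) (card S)
     (\<lambda>(i, j). if E (from_nat_into S i) (from_nat_into S j) then 1 else 0)"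

definition rel_radius :: "('v \<Rightarrow> 'v \<Rightarrow> bool) \<Rightarrow> 'v set \<Rightarrow> real" where
  "rel_radius E S = real_spectral_radius (rel_matrix E S)"

text \<open>The adjacency matrix acting on functions, so that vertices need no enumeration. Within
  \<open>S\<close>, its \<open>k\<close>-th iterate on the constant 1 counts the paths with
  \<open>k\<close> edges from a given vertex.\<close>

definition succ_sum :: "('v \<Rightarrow> 'v \<Rightarrow> bool) \<Rightarrow> 'v set \<Rightarrow> ('v \<Rightarrow> real) \<Rightarrow> 'v \<Rightarrow> real" where
  "succ_sum E S f u = (\<Sum>v | v \<in> S \<and> E u v. f v)"

lemma rel_matrix_carrier: "map_mat complex_of_real (rel_matrix E S) \<in> carrier_mat (card S) (card S)"
  by (simp add: rel_matrix_def)

lemma rel_matrix_mult_vec: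
  fixes f :: "'v \<Rightarrow> complex"
  assumes "finite S" "i < card S"
  shows "Matrix.vec_index (map_mat complex_of_real (rel_matrix E S) *\<^sub>v
           Matrix.vec (card S) (\<lambda>j. f (from_nat_into S j))) i
         = (\<Sum>v | v \<in> S \<and> E (from_nat_into S i) v. f v)"
proof -
  let ?b = "from_nat_into S"
  have b: "bij_betw ?b {..<card S} S"
    using assms(1) by (simp add: bij_betw_from_nat_into_finite)
  have "Matrix.vec_index (map_mat complex_of_real (rel_matrix E S) *\<^sub>v
           Matrix.vec (card S) (\<lambda>j. f (?b j))) i
      = (\<Sum>j<card S. (if E (?b i) (?b j) then f (?b j) else 0))"
    using assms(2) 
    by (auto simp: rel_matrix_def scalar_prod_def atLeast0LessThan intro!: sum.cong)
  also have "\<dots> = (\<Sum>v\<in>S. if E (?b i) v then f v else 0)"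
    using sum.reindex_bij_betw[OF b, of "\<lambda>v. if E (?b i) v then f v else 0"] by simp
  also have "\<dots> = (\<Sum>v | v \<in> S \<and> E (?b i) v. f v)"
    using assms(1) by (simp add: sum.inter_filter)
  finally show ?thesis .
qed

lemma succ_sum_mono:
  "(\<And>v. v \<in> S \<Longrightarrow> f v \<le> g v) \<Longrightarrow> succ_sum E S f u \<le> succ_sum E S g u"
  unfolding succ_sum_def by (rule sum_mono) auto

lemma succ_sum_cong:
  "(\<And>v. v \<in> S \<Longrightarrow> f v = g v) \<Longrightarrow> succ_sum E S f u = succ_sum E S g u"
  unfolding succ_sum_def by (rule sum.cong) auto

lemma succ_sum_nonneg:
  "(\<And>v. v \<in> S \<Longrightarrow> 0 \<le> f v) \<Longrightarrow> 0 \<le> succ_sum E S f u"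
  unfolding succ_sum_def by (rule sum_nonneg) auto

lemma succ_sum_add: "succ_sum E S (\<lambda>v. f v + g v) u = succ_sum E S f u + succ_sum E S g u"
  by (simp add: succ_sum_def sum.distrib)

lemma succ_sum_scale: "succ_sum E S (\<lambda>v. c * f v) u = c * succ_sum E S f u"
  by (simp add: succ_sum_def sum_distrib_left)

lemma succ_sum_sum: "succ_sum E S (\<lambda>v. \<Sum>k\<in>I. f k v) u = (\<Sum>k\<in>I. succ_sum E S (f k) u)"
  unfolding succ_sum_def by (rule sum.swap)

lemma succ_sum_ge_single:
  assumes "finite S" "\<And>v. v \<in> S \<Longrightarrow> 0 \<le> f v" "v \<in> S" "E u v"
  shows "f v \<le> succ_sum E S f u"
  unfolding succ_sum_def using assms by (intro member_le_sum) auto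

lemma succ_sum_mono_set:
  assumes "finite S'" "S \<subseteq> S'" "\<And>v. v \<in> S' \<Longrightarrow> 0 \<le> f v"
  shows "succ_sum E S f u \<le> succ_sum E S' f u"
  unfolding succ_sum_def using assms by (intro sum_mono2) auto

lemma rel_radius_nonneg:
  assumes "finite S" "S \<noteq> {}"
  shows "0 \<le> rel_radius E S"
proof -
  have "card S > 0" using assms by (simp add: card_gt_0_iff)
  from spectral_radius_mem_max(1)[OF rel_matrix_carrier[of E S] this]
  show ?thesis by (auto simp: rel_radius_def real_spectral_radius_def)
qed

text \<open>The moduli of an eigenvector for an eigenvalue of maximal modulus form a subsolution; this
  replaces the Perron-Frobenius theorem.\<close>

lemma rel_radius_subsolution:
  assumes S: "finite S" "S \<noteq> {}"
  obtains h where "\<And>u. 0 \<le> h u" "\<exists>u\<in>S. 0 < h u"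
    "\<And>u. u \<in> S \<Longrightarrow> rel_radius E S * h u \<le> succ_sum E S h u"
proof -
  let ?n = "card S" and ?b = "from_nat_into S"
  let ?A = "map_mat complex_of_real (rel_matrix E S)"
  have n: "?n > 0" using S by (simp add: card_gt_0_iff)
  from spectral_radius_mem_max(1)[OF rel_matrix_carrier[of E S] n]
  obtain l where l: "eigenvalue ?A l" "rel_radius E S = norm l"
    by (auto simp: rel_radius_def real_spectral_radius_def spectrum_def)
  then obtain w where w: "w \<in> carrier_vec ?n" "w \<noteq> 0\<^sub>v ?n" "?A *\<^sub>v w = l \<cdot>\<^sub>v w"
    unfolding eigenvalue_def eigenvector_def by (auto simp: rel_matrix_def)
  have b: "bij_betw ?b {..<?n} S" using S by (simp add: bij_betw_from_nat_into_finite)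
  define f where "f v = Matrix.vec_index w (the_inv_into {..<?n} ?b v)" for v
  have fb: "f (?b i) = Matrix.vec_index w i" if "i < ?n" for i
    unfolding f_def using b that
    by (simp add: the_inv_into_f_f bij_betw_def)
  have wv: "w = Matrix.vec ?n (\<lambda>j. f (?b j))"
    using w(1) by (intro eq_vecI) (auto simp: fb)
  have eq: "l * f u = (\<Sum>v | v \<in> S \<and> E u v. f v)" if u: "u \<in> S" for u
  proof -
    obtain i where i: "i < ?n" "u = ?b i"
      using b u by (metis bij_betw_iff_bijections lessThan_iff)
    have "(\<Sum>v | v \<in> S \<and> E u v. f v) = Matrix.vec_index (?A *\<^sub>v w) i"
      using rel_matrix_mult_vec[OF S(1) i(1), of E f] wv i by simp
    also have "\<dots> = l * f u" using w i by (simp add: fb)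
    finally show ?thesis by simp
  qed
  show ?thesis
  proof (rule that[of "\<lambda>v. norm (f v)"])
    show "\<exists>u\<in>S. 0 < norm (f u)"
    proof (rule ccontr)
      assume "\<not> ?thesis"
      then have "f u = 0" if "u \<in> S" for u using that by auto
      then have "Matrix.vec_index w i = 0" if "i < ?n" for i
        using that fb[OF that] b by (metis bij_betwE lessThan_iff)
      then have "w = 0\<^sub>v ?n" using w(1) by (intro eq_vecI) auto
      with w(2) show False by simp
    qed
    fix u assume "u \<in> S"
    have "rel_radius E S * norm (f u) = norm (\<Sum>v | v \<in> S \<and> E u v. f v)"
      using eq[OF \<open>u \<in> S\<close>] l(2) by (metis norm_mult)
    also have "\<dots> \<le> succ_sum E S (\<lambda>v. norm (f v)) u"
      unfolding succ_sum_def by (rule norm_sum)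
    finally show "rel_radius E S * norm (f u) \<le> succ_sum E S (\<lambda>v. norm (f v)) u" .
  qed auto
qed

text \<open>Dividing the matrix by \<open>r\<close> moves its spectral radius below 1, where the
  Jordan normal form bounds all powers by one constant. At the radius itself Jordan blocks could add
  a polynomial factor.\<close>

lemma rel_matrix_pow_bound:
  assumes S: "finite S" "S \<noteq> {}" and r: "rel_radius E S < r"
  obtains c where "\<And>k u. u \<in> S \<Longrightarrow> ((succ_sum E S) ^^ k) (\<lambda>_. 1) u \<le> c * r ^ k"
proof -
  let ?n = "card S" and ?b = "from_nat_into S"
  let ?A = "map_mat complex_of_real (rel_matrix E S)"
  define B where "B = complex_of_real (1 / r) \<cdot>\<^sub>m ?A"
  have n: "?n > 0" using S by (simp add: card_gt_0_iff)
  have r0: "r > 0" using rel_radius_nonneg[OF S, of E] r by simp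
  have A: "?A \<in> carrier_mat ?n ?n" by (rule rel_matrix_carrier)
  then have B: "B \<in> carrier_mat ?n ?n" by (simp add: B_def)
  have "spectral_radius B < 1"
  proof -
    from spectral_radius_mem_max(1)[OF B n]
    obtain l where l: "eigenvalue B l" "spectral_radius B = norm l"
      by (auto simp: spectrum_def)
    then obtain w where w: "w \<in> carrier_vec ?n" "w \<noteq> 0\<^sub>v ?n" "B *\<^sub>v w = l \<cdot>\<^sub>v w"
      unfolding eigenvalue_def eigenvector_def using B by auto
    have "?A *\<^sub>v w = complex_of_real r \<cdot>\<^sub>v (B *\<^sub>v w)"
      using r0 A w(1) by (intro eq_vecI) (auto simp: B_def scalar_prod_def sum_distrib_left)
    also have "\<dots> = (complex_of_real r * l) \<cdot>\<^sub>v w" using w by (simp add: smult_smult_assoc)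
    finally have "eigenvalue ?A (complex_of_real r * l)"
      unfolding eigenvalue_def eigenvector_def using w A by auto
    then have "norm (complex_of_real r * l) \<le> rel_radius E S"
      unfolding rel_radius_def real_spectral_radius_def
      by (intro spectral_radius_mem_max(2)[OF A n]) (auto simp: spectrum_def)
    then have "r * norm l \<le> rel_radius E S" using r0 by (simp add: norm_mult)
    with r have "r * norm l < r * 1" by simp
    then show ?thesis using l(2) r0 by (simp del: mult_1_right)
  qed
  from spectral_radius_jnf_norm_bound_less_1_upper_triangular[OF B this]
  obtain c where c: "\<And>k. norm_bound (B ^\<^sub>m k) c" by auto
  let ?v = "\<lambda>f. Matrix.vec ?n (\<lambda>j. complex_of_real (f (?b j)))"
  have step: "B *\<^sub>v ?v f = ?v (\<lambda>u. succ_sum E S f u / r)" for f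
  proof (rule eq_vecI)
    fix i assume "i < dim_vec (?v (\<lambda>u. succ_sum E S f u / r))"
    then have i: "i < ?n" by simp
    have "Matrix.vec_index (B *\<^sub>v ?v f) i
        = complex_of_real (1 / r) * Matrix.vec_index (?A *\<^sub>v ?v f) i"
      using i A by (simp add: B_def scalar_prod_def sum_distrib_left mult.assoc)
    also have "\<dots> = complex_of_real (succ_sum E S f (?b i) / r)"
      using rel_matrix_mult_vec[OF S(1) i, of E "\<lambda>u. complex_of_real (f u)"]
      by (simp add: succ_sum_def)
    finally show "Matrix.vec_index (B *\<^sub>v ?v f) i
                  = Matrix.vec_index (?v (\<lambda>u. succ_sum E S f u / r)) i" using i by simp
  qed (use B in auto)
  have pow: "(B ^\<^sub>m k) *\<^sub>v ?v f = ?v (\<lambda>u. ((succ_sum E S) ^^ k) f u / r ^ k)" for k f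
  proof (induction k arbitrary: f)
    case 0
    show ?case using B by (intro eq_vecI) auto
  next
    case (Suc k)
    have Bk: "B ^\<^sub>m k \<in> carrier_mat ?n ?n" using B by simp
    have "(B ^\<^sub>m Suc k) *\<^sub>v ?v f = (B ^\<^sub>m k) *\<^sub>v (B *\<^sub>v ?v f)"
      unfolding pow_mat.simps using assoc_mult_mat_vec[OF Bk B, of "?v f"] by simp
    also have "\<dots> = ?v (\<lambda>u. ((succ_sum E S) ^^ k) (\<lambda>u. succ_sum E S f u / r) u / r ^ k)"
      unfolding step by (rule Suc)
    also have "((succ_sum E S) ^^ k) (\<lambda>u. succ_sum E S f u / r)
             = (\<lambda>u. ((succ_sum E S) ^^ k) (succ_sum E S f) u / r)"
    proof -
      have "((succ_sum E S) ^^ k) (\<lambda>u. g u / r) = (\<lambda>u. ((succ_sum E S) ^^ k) g u / r)" for g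
        by (induction k) (auto simp: succ_sum_def sum_divide_distrib)
      then show ?thesis .
    qed
    finally show ?case by (simp add: funpow_swap1)
  qed
  show ?thesis
  proof (rule that[of "real ?n * c"])
    fix k u assume "u \<in> S"
    have b: "bij_betw ?b {..<?n} S" using S by (simp add: bij_betw_from_nat_into_finite)
    obtain i where i: "i < ?n" "u = ?b i"
      using b \<open>u \<in> S\<close> by (metis bij_betw_iff_bijections lessThan_iff)
    have Bk: "B ^\<^sub>m k \<in> carrier_mat ?n ?n" using B by simp
    have "complex_of_real (((succ_sum E S) ^^ k) (\<lambda>_. 1) u / r ^ k)
        = Matrix.vec_index ((B ^\<^sub>m k) *\<^sub>v ?v (\<lambda>_. 1)) i"
      using arg_cong[OF pow[of k "\<lambda>_. 1"], of "\<lambda>x. Matrix.vec_index x i"] i by simp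
    also have "\<dots> = (\<Sum>j<?n. (B ^\<^sub>m k) $$ (i, j))"
      using i(1) carrier_matD[OF Bk] by (auto simp: scalar_prod_def atLeast0LessThan simp del: pow_mat_dim)
    finally have eq: "complex_of_real (((succ_sum E S) ^^ k) (\<lambda>_. 1) u / r ^ k)
        = (\<Sum>j<?n. (B ^\<^sub>m k) $$ (i, j))" .
    have "((succ_sum E S) ^^ k) (\<lambda>_. 1) u / r ^ k
        \<le> norm (complex_of_real (((succ_sum E S) ^^ k) (\<lambda>_. 1) u / r ^ k))"
      unfolding norm_of_real by (rule abs_ge_self)
    also have "\<dots> = norm (\<Sum>j<?n. (B ^\<^sub>m k) $$ (i, j))" unfolding eq ..
    also have "\<dots> \<le> (\<Sum>j<?n. c)"
      using c[of k] i(1) carrier_matD[OF Bk] unfolding norm_bound_def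
      by (intro sum_norm_le) auto
    finally have "((succ_sum E S) ^^ k) (\<lambda>_. 1) u / r ^ k \<le> real ?n * c" by simp
    then show "((succ_sum E S) ^^ k) (\<lambda>_. 1) u \<le> real ?n * c * r ^ k"
      using r0 by (simp add: pos_divide_le_eq)
  qed
qed

text \<open>\<open>g\<close> is a truncated Neumann series. Applying the operator divided by
  \<open>r\<close> shifts the series: it loses the term 1 and gains the \<open>N\<close>-th term,
  which is less than 1 for large \<open>N\<close>.\<close>

lemma rel_radius_supersolution:
  assumes S: "finite S" "S \<noteq> {}" and r: "rel_radius E S < r"
  obtains g where "\<And>u. u \<in> S \<Longrightarrow> 1 \<le> g u"
    "\<And>u. u \<in> S \<Longrightarrow> succ_sum E S g u \<le> r * g u"
proof -
  let ?T = "succ_sum E S"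
  have r0: "r > 0" using rel_radius_nonneg[OF S, of E] r by simp
  \<comment> \<open>An intermediate rate makes the remainder \<open>c * (r' / r) ^ N\<close> tend to
    0.\<close>
  obtain r' where r': "rel_radius E S < r'" "r' < r" using dense r by blast
  have r'0: "r' > 0" using rel_radius_nonneg[OF S, of E] r' by simp
  obtain c where c: "\<And>k u. u \<in> S \<Longrightarrow> (?T ^^ k) (\<lambda>_. 1) u \<le> c * r' ^ k"
    using rel_matrix_pow_bound[OF S r'(1)] by blast
  have "(\<lambda>k. c * (r' / r) ^ k) \<longlonglongrightarrow> c * 0"
    using r' r'0 by (intro tendsto_mult_left LIMSEQ_power_zero) auto
  then have "eventually (\<lambda>k. c * (r' / r) ^ k < 1) sequentially"
    by (rule order_tendstoD) simp
  then have "eventually (\<lambda>k. c * (r' / r) ^ k < 1 \<and> k > 0) sequentially"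
    using eventually_gt_at_top[of 0] by (rule eventually_conj)
  then obtain N where N: "c * (r' / r) ^ N < 1" "N > 0"
    using eventually_happens by force
  define g where "g u = (\<Sum>k<N. (?T ^^ k) (\<lambda>_. 1) u / r ^ k)" for u
  have nn: "0 \<le> (?T ^^ k) (\<lambda>_. 1) u" for k u
    by (induction k arbitrary: u) (auto intro!: succ_sum_nonneg)
  show ?thesis
  proof (rule that[of g])
    fix u assume u: "u \<in> S"
    have "(\<Sum>k\<in>{0}. (?T ^^ k) (\<lambda>_. 1) u / r ^ k) \<le> g u"
      unfolding g_def using N(2) nn r0 by (intro sum_mono2) auto
    then show "1 \<le> g u" by simp
    have "?T g u = (\<Sum>k<N. ?T (\<lambda>u. (1 / r ^ k) * (?T ^^ k) (\<lambda>_. 1) u) u)"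
      unfolding g_def succ_sum_sum by simp
    also have "\<dots> = r * (\<Sum>k<N. (?T ^^ Suc k) (\<lambda>_. 1) u / r ^ Suc k)"
      unfolding succ_sum_scale using r0 by (simp add: sum_distrib_left)
    also have "(\<Sum>k<N. (?T ^^ Suc k) (\<lambda>_. 1) u / r ^ Suc k)
             = g u - 1 + (?T ^^ N) (\<lambda>_. 1) u / r ^ N"
      unfolding g_def
      using sum.lessThan_Suc_shift[of "\<lambda>k. (?T ^^ k) (\<lambda>_. 1) u / r ^ k" N] by simp
    also have "(?T ^^ N) (\<lambda>_. 1) u / r ^ N \<le> c * r' ^ N / r ^ N"
      using c[OF u] r0 by (intro divide_right_mono) auto
    also have "\<dots> = c * (r' / r) ^ N" by (simp add: power_divide)
    finally have "?T g u \<le> r * (g u - 1 + c * (r' / r) ^ N)" using r0 by simp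
    also have "\<dots> \<le> r * g u" using N(1) r0 by (intro mult_left_mono) auto
    finally show "?T g u \<le> r * g u" .
  qed
qed

text \<open>Scale \<open>g\<close> until it touches \<open>h\<close> from above, at a vertex
  maximising \<open>h / g\<close>. There both inequalities refer to the same value and compare
  \<open>t\<close> with \<open>r\<close>.\<close>

lemma subsolution_le_supersolution:
  assumes S: "finite S" and h: "\<And>u. u \<in> S \<Longrightarrow> 0 \<le> h u" "u0 \<in> S" "0 < h u0"
    and sub: "\<And>u. u \<in> S \<Longrightarrow> t * h u \<le> succ_sum E S h u"
    and g: "\<And>u. u \<in> S \<Longrightarrow> 0 < g u" "\<And>u. u \<in> S \<Longrightarrow> succ_sum E S g u \<le> r * g u"
  shows "t \<le> r"
proof -
  define c where "c = Max ((\<lambda>u. h u / g u) ` S)"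
  have "c \<in> (\<lambda>u. h u / g u) ` S" unfolding c_def using S h(2) by (intro Max_in) auto
  then obtain u where u: "u \<in> S" "c = h u / g u" by auto
  have le: "h v \<le> c * g v" if "v \<in> S" for v
  proof -
    have "h v / g v \<le> c" unfolding c_def using S that by (intro Max_ge) auto
    then show ?thesis using g(1)[OF that] by (simp add: field_simps)
  qed
  have "0 < c"
  proof (rule ccontr)
    assume "\<not> 0 < c"
    then have "c * g u0 \<le> 0" using g(1)[OF h(2)] by (simp add: mult_nonpos_nonneg)
    with le[OF h(2)] h(3) show False by simp
  qed
  have hu: "h u = c * g u" using u g(1)[OF u(1)] by simp
  have "t * h u \<le> succ_sum E S (\<lambda>v. c * g v) u"
    using sub[OF u(1)] succ_sum_mono[of S h "\<lambda>v. c * g v" E u] le by simp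
  also have "\<dots> \<le> c * (r * g u)"
    unfolding succ_sum_scale using \<open>0 < c\<close> g(2)[OF u(1)] by simp
  also have "\<dots> = r * h u" using hu by simp
  finally show ?thesis using hu \<open>0 < c\<close> g(1)[OF u(1)] by simp
qed

text \<open>Supersolutions exist for every \<open>r\<close> above the radius. Together with
  \<open>rel_radius_subsolution\<close> this is a Collatz-Wielandt formula: the radius is the
  largest factor of a subsolution.\<close>

lemma subsolution_le_rel_radius:
  assumes S: "finite S" and h: "\<And>u. u \<in> S \<Longrightarrow> 0 \<le> h u" "u0 \<in> S" "0 < h u0"
    and sub: "\<And>u. u \<in> S \<Longrightarrow> t * h u \<le> succ_sum E S h u"
  shows "t \<le> rel_radius E S"
proof (rule dense_ge)
  fix r assume r: "rel_radius E S < r"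
  have "S \<noteq> {}" using h by auto
  obtain g where g: "\<And>u. u \<in> S \<Longrightarrow> 1 \<le> g u"
    "\<And>u. u \<in> S \<Longrightarrow> succ_sum E S g u \<le> r * g u"
    using rel_radius_supersolution[OF S \<open>S \<noteq> {}\<close> r] by blast
  show "t \<le> r"
  proof (rule subsolution_le_supersolution[OF S h sub])
    show "0 < g u" if "u \<in> S" for u using g(1)[OF that] by simp
  qed (use g in auto)
qed

text \<open>A subsolution on the smaller set, extended by zero, remains one on the larger
  set.\<close>

lemma rel_radius_mono:
  assumes "finite V" "S \<subseteq> V" "S \<noteq> {}"
  shows "rel_radius E S \<le> rel_radius E V"
proof -
  have "finite S" using assms finite_subset by blast
  obtain h where h: "\<And>u. 0 \<le> h u" "\<exists>u\<in>S. 0 < h u"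
    "\<And>u. u \<in> S \<Longrightarrow> rel_radius E S * h u \<le> succ_sum E S h u"
    using rel_radius_subsolution[OF \<open>finite S\<close> assms(3), of E] by blast
  define h' where "h' u = (if u \<in> S then h u else 0)" for u
  obtain u0 where u0: "u0 \<in> S" "0 < h u0" using h by blast
  have h'0: "0 \<le> h' u" for u by (simp add: h'_def h(1))
  show ?thesis
  proof (rule subsolution_le_rel_radius[OF assms(1)])
    fix u assume "u \<in> V"
    show "rel_radius E S * h' u \<le> succ_sum E V h' u"
    proof (cases "u \<in> S")
      case True
      have "rel_radius E S * h' u \<le> succ_sum E S h u" using h(3)[OF True] True by (simp add: h'_def)
      also have "\<dots> = succ_sum E S h' u" by (rule succ_sum_cong) (simp add: h'_def)
      also have "\<dots> \<le> succ_sum E V h' u"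
        using assms h'0 by (intro succ_sum_mono_set) auto
      finally show ?thesis .
    next
      case False
      then show ?thesis using h'0 by (simp add: h'_def succ_sum_nonneg)
    qed
  next
    show "u0 \<in> V" using u0 assms by auto
    show "0 < h' u0" using u0 by (simp add: h'_def)
  qed (rule h'0)
qed

text \<open>Every vertex in the support of a subsolution with positive factor has a successor in the
  support, so the indicator of the support is a subsolution with factor 1.\<close>

lemma rel_radius_ge_1:
  assumes S: "finite S" "S \<noteq> {}" and pos: "0 < rel_radius E S"
  shows "1 \<le> rel_radius E S"
proof -
  obtain h where h: "\<And>u. 0 \<le> h u" "\<exists>u\<in>S. 0 < h u"
    "\<And>u. u \<in> S \<Longrightarrow> rel_radius E S * h u \<le> succ_sum E S h u"
    using rel_radius_subsolution[OF S, of E] by blast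
  then obtain u0 where u0: "u0 \<in> S" "0 < h u0" by blast
  define f :: "'a \<Rightarrow> real" where "f u = (if 0 < h u then 1 else 0)" for u
  show ?thesis
  proof (rule subsolution_le_rel_radius[OF S(1) _ u0(1)])
    show "0 < f u0" using u0 by (simp add: f_def)
    fix u assume u: "u \<in> S"
    show "1 * f u \<le> succ_sum E S f u"
    proof (cases "0 < h u")
      case True
      then have "0 < succ_sum E S h u" using h(3)[OF u] pos by (smt (verit) mult_pos_pos)
      then obtain v where v: "v \<in> S" "E u v" "0 < h v"
        unfolding succ_sum_def using sum_nonpos[of "{v \<in> S. E u v}" h] by force
      have "f v \<le> succ_sum E S f u"
        using S v by (intro succ_sum_ge_single) (auto simp: f_def)
      then show ?thesis using v True by (simp add: f_def)
    next
      case False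
      then show ?thesis by (auto simp: f_def intro!: succ_sum_nonneg)
    qed
  qed (simp add: f_def)
qed

text \<open>Used to pass between the integer model of the graph, where the dynamics is arithmetic,
  and the graph of intervals.\<close>

lemma succ_sum_pow_reindex:
  assumes b: "bij_betw \<phi> V V'" and E: "\<And>u v. u \<in> V \<Longrightarrow> v \<in> V \<Longrightarrow> E u v \<longleftrightarrow> E' (\<phi> u) (\<phi> v)"
    and "u \<in> V"
  shows "((succ_sum E V) ^^ k) (\<lambda>u. h (\<phi> u)) u = ((succ_sum E' V') ^^ k) h (\<phi> u)"
  using \<open>u \<in> V\<close>
proof (induction k arbitrary: u)
  case (Suc k)
  have "bij_betw \<phi> {v \<in> V. E u v} {v \<in> V'. E' (\<phi> u) v}"
    using b E Suc.prems unfolding bij_betw_def by (auto intro: inj_on_subset)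
  note reindex = sum.reindex_bij_betw[OF this, of "((succ_sum E' V') ^^ k) h"]
  have "((succ_sum E V) ^^ Suc k) (\<lambda>u. h (\<phi> u)) u
      = (\<Sum>v | v \<in> V \<and> E u v. ((succ_sum E V) ^^ k) (\<lambda>u. h (\<phi> u)) v)"
    unfolding funpow.simps comp_def by (rule succ_sum_def)
  also have "\<dots> = (\<Sum>v | v \<in> V \<and> E u v. ((succ_sum E' V') ^^ k) h (\<phi> v))"
    using Suc.IH by (intro sum.cong) auto
  also have "\<dots> = succ_sum E' V' (((succ_sum E' V') ^^ k) h) (\<phi> u)"
    unfolding succ_sum_def[of E' V' "((succ_sum E' V') ^^ k) h"] by (rule reindex)
  finally show ?case by simp
qed simp

section \<open>Critical classes and the growth of the number of paths\<close>

locale finite_relation =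
  fixes E :: "'v \<Rightarrow> 'v \<Rightarrow> bool" and V :: "'v set"
  assumes finite_V: "finite V"
    and E_in_V: "E u v \<Longrightarrow> u \<in> V \<and> v \<in> V"
begin

text \<open>Reflexivity makes a vertex on no cycle a class of its own; its 1 x 1 matrix is zero, so
  its radius is 0.\<close>

definition scc :: "'v \<Rightarrow> 'v set" where
  "scc u = {v. E\<^sup>*\<^sup>* u v \<and> E\<^sup>*\<^sup>* v u}"

definition critical :: "'v set" where
  "critical = {u \<in> V. rel_radius E (scc u) = rel_radius E V}"

lemma scc_self: "u \<in> scc u"
  by (simp add: scc_def)

lemma scc_subset: "u \<in> V \<Longrightarrow> scc u \<subseteq> V"
proof
  fix v assume "u \<in> V" "v \<in> scc u"
  then have "E\<^sup>*\<^sup>* u v" by (simp add: scc_def)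
  then show "v \<in> V" using \<open>u \<in> V\<close> by (induction) (auto dest: E_in_V)
qed

lemma finite_scc: "u \<in> V \<Longrightarrow> finite (scc u)"
  using scc_subset finite_V finite_subset by blast

lemma scc_eq: "v \<in> scc u \<Longrightarrow> scc v = scc u"
  by (auto simp: scc_def intro: rtranclp_trans)

lemma critical_scc: "u \<in> critical \<Longrightarrow> v \<in> scc u \<Longrightarrow> v \<in> critical"
  using scc_eq[of v u] scc_subset[of u] unfolding critical_def by auto

lemma rtranclp_in_scc:
  assumes "w \<in> scc u" "E w w'" "E\<^sup>*\<^sup>* w' v" "v \<in> scc u"
  shows "w' \<in> scc u"
  using assms unfolding scc_def by (auto intro: rtranclp_trans rtranclp.rtrancl_into_rtrancl)

text \<open>Restrict the subsolution to a terminal class of its support: no edge within the support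
  leaves this class, so the restriction is still a subsolution.\<close>

lemma ex_scc_rel_radius_ge:
  assumes S: "S \<subseteq> V" and h: "\<And>u. u \<in> S \<Longrightarrow> 0 \<le> h u" "u0 \<in> S" "0 < h u0"
    and sub: "\<And>u. u \<in> S \<Longrightarrow> t * h u \<le> succ_sum E S h u"
  shows "\<exists>u\<in>S. t \<le> rel_radius E (scc u)"
proof -
  define P where "P = {u \<in> S. 0 < h u}"
  define F where "F = (\<lambda>u v. E u v \<and> u \<in> P \<and> v \<in> P)"
  define R where "R u = {v. F\<^sup>*\<^sup>* u v}" for u
  have FE: "E\<^sup>*\<^sup>* u v" if "F\<^sup>*\<^sup>* u v" for u v
    using that by (rule rtranclp_mono[THEN predicate2D, rotated]) (auto simp: F_def)
  have RP: "R u \<subseteq> P" if "u \<in> P" for u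
  proof
    fix v assume "v \<in> R u"
    then have "F\<^sup>*\<^sup>* u v" by (simp add: R_def)
    then show "v \<in> P" using that by induction (auto simp: F_def)
  qed
  have finP: "finite P" using S finite_V unfolding P_def by (auto intro: finite_subset)
  have "u0 \<in> P" using h by (simp add: P_def)
  \<comment> \<open>A smallest reachable set is a terminal class: whatever \<open>u\<close> reaches
    has a reachable set contained in that of \<open>u\<close>, hence equal to it, and so leads back
    to \<open>u\<close>.\<close>
  then obtain u where u: "u \<in> P" "\<And>v. v \<in> P \<Longrightarrow> card (R u) \<le> card (R v)"
    using ex_has_least_nat[of "\<lambda>u. u \<in> P" u0 "\<lambda>u. card (R u)"] by auto
  have returns: "F\<^sup>*\<^sup>* v u" if "v \<in> R u" for v
  proof -
    have "R v \<subseteq> R u" using that by (auto simp: R_def)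
    moreover have "card (R u) \<le> card (R v)" using u(2) RP[OF u(1)] that by auto
    ultimately have "R v = R u"
      using finP RP[OF u(1)] finite_subset card_seteq by metis
    then show ?thesis by (auto simp: R_def)
  qed
  have Rscc: "R u \<subseteq> scc u" using returns FE by (auto simp: R_def scc_def)
  have uV: "u \<in> V" using u(1) S by (auto simp: P_def)
  define h' where "h' v = (if v \<in> R u then h v else 0)" for v
  have h'0: "0 \<le> h' v" for v using RP[OF u(1)] h(1) by (auto simp: h'_def P_def)
  have "t \<le> rel_radius E (scc u)"
  proof (rule subsolution_le_rel_radius[OF finite_scc[OF uV]])
    show "u \<in> scc u" by (rule scc_self)
    show "0 < h' u" using u(1) by (simp add: h'_def R_def P_def)
    fix w assume w: "w \<in> scc u"
    show "t * h' w \<le> succ_sum E (scc u) h' w"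
    proof (cases "w \<in> R u")
      case True
      have wP: "w \<in> P" using True RP[OF u(1)] by auto
      have "t * h' w \<le> succ_sum E S h w"
        using True sub wP by (simp add: h'_def P_def)
      also have "\<dots> = (\<Sum>v | v \<in> P \<and> E w v. h v)"
        unfolding succ_sum_def
      proof (rule sum.mono_neutral_right)
        show "finite {v \<in> S. E w v}" using S finite_V by (auto intro: finite_subset)
        show "\<forall>i\<in>{v \<in> S. E w v} - {v \<in> P. E w v}. h i = 0"
          using h(1) by (force simp: P_def)
      qed (auto simp: P_def)
      also have "{v. v \<in> P \<and> E w v} = {v. v \<in> R u \<and> E w v}"
        using True wP RP[OF u(1)] by (auto simp: R_def F_def intro: rtranclp.rtrancl_into_rtrancl)
      also have "(\<Sum>v | v \<in> R u \<and> E w v. h v) = (\<Sum>v | v \<in> R u \<and> E w v. h' v)"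
        by (rule sum.cong) (auto simp: h'_def)
      also have "\<dots> \<le> succ_sum E (scc u) h' w"
        unfolding succ_sum_def using Rscc finite_scc[OF uV] h'0 by (intro sum_mono2) auto
      finally show ?thesis .
    next
      case False
      then show ?thesis using h'0 by (simp add: h'_def succ_sum_nonneg)
    qed
  qed (rule h'0)
  then show ?thesis using u(1) by (auto simp: P_def)
qed

text \<open>If \<open>S\<close> had the radius of \<open>V\<close>, a subsolution on
  \<open>S\<close> would yield a vertex of \<open>S\<close> whose class attains this radius, that
  is, a critical vertex. The strict inequality leaves room for \<open>r\<close>.\<close>

lemma noncritical_supersolution:
  assumes S: "S \<subseteq> V" "S \<inter> critical = {}" and pos: "0 < rel_radius E V"
  obtains r g where "0 \<le> r" "r < rel_radius E V" "\<And>u. u \<in> S \<Longrightarrow> 1 \<le> g u"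
    "\<And>u. u \<in> S \<Longrightarrow> succ_sum E S g u \<le> r * g u"
proof (cases "S = {}")
  case True
  \<comment> \<open>A 0 x 0 matrix has no eigenvalue, so \<open>rel_radius\<close> of the empty set
    carries no information; any factor below the radius serves.\<close>
  then show ?thesis using that[of 0 "\<lambda>_. 1"] pos by simp
next
  case False
  have finS: "finite S" using S finite_V finite_subset by blast
  have "rel_radius E S < rel_radius E V"
  proof (rule ccontr)
    assume "\<not> ?thesis"
    then have ge: "rel_radius E V \<le> rel_radius E S" by simp
    obtain h where h: "\<And>u. 0 \<le> h u" "\<exists>u\<in>S. 0 < h u"
      "\<And>u. u \<in> S \<Longrightarrow> rel_radius E S * h u \<le> succ_sum E S h u"
      using rel_radius_subsolution[OF finS False, of E] by blast
    then obtain u0 where "u0 \<in> S" "0 < h u0" by blast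
    then obtain u where u: "u \<in> S" "rel_radius E S \<le> rel_radius E (scc u)"
      using ex_scc_rel_radius_ge[OF S(1), of h u0 "rel_radius E S"] h by blast
    have uV: "u \<in> V" using u S by auto
    have "rel_radius E (scc u) \<le> rel_radius E V"
      using scc_subset[OF uV] scc_self finite_V by (intro rel_radius_mono) auto
    with u ge have "u \<in> critical" using uV by (simp add: critical_def)
    with u(1) S(2) show False by auto
  qed
  then obtain r where r: "rel_radius E S < r" "r < rel_radius E V" using dense by blast
  obtain g where "\<And>u. u \<in> S \<Longrightarrow> 1 \<le> g u" "\<And>u. u \<in> S \<Longrightarrow> succ_sum E S g u \<le> r * g u"
    using rel_radius_supersolution[OF finS False r(1)] by blast
  then show ?thesis using that[of r g] r rel_radius_nonneg[OF finS False, of E] by auto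
qed

text \<open>If the subsolution \<open>h\<close> were strict somewhere, then, the class being strongly connected,
  iterating \<open>f \<mapsto> f + T f\<close> would make it strict everywhere, and \<open>\<rho>\<close> could be increased.\<close>

lemma critical_eigenvector:
  assumes u: "u \<in> critical" and pos: "0 < rel_radius E V"
  obtains h where "\<And>v. v \<in> scc u \<Longrightarrow> 0 < h v"
    "\<And>v. v \<in> scc u \<Longrightarrow> succ_sum E (scc u) h v = rel_radius E V * h v"
proof -
  let ?C = "scc u" and ?r = "rel_radius E V" and ?T = "succ_sum E (scc u)"
  have uV: "u \<in> V" and rC: "rel_radius E ?C = ?r" using u by (auto simp: critical_def)
  have finC: "finite ?C" by (rule finite_scc[OF uV])
  have neC: "?C \<noteq> {}" using scc_self by auto
  obtain h where h: "\<And>v. 0 \<le> h v" "\<exists>v\<in>?C. 0 < h v" "\<And>v. v \<in> ?C \<Longrightarrow> ?r * h v \<le> ?T h v"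
    using rel_radius_subsolution[OF finC neC, of E] rC by metis
  define L where "L f = (\<lambda>v. f v + ?T f v)" for f
  have LS: "(L ^^ Suc k) f v = (L ^^ k) f v + ?T ((L ^^ k) f) v" for k f v
    by (simp add: L_def)
  have Lnn: "0 \<le> (L ^^ k) f v" if "\<And>v. v \<in> ?C \<Longrightarrow> 0 \<le> f v" "v \<in> ?C" for k f v
    using that(2) by (induction k arbitrary: v) (auto simp: L_def that(1) intro!: add_nonneg_nonneg succ_sum_nonneg)
  have Lmono: "(L ^^ k) f v \<le> (L ^^ l) f v" if "k \<le> l" "\<And>v. v \<in> ?C \<Longrightarrow> 0 \<le> f v" "v \<in> ?C" for k l f v
    using that(1)
  proof (rule lift_Suc_mono_le[where f = "\<lambda>k. (L ^^ k) f v", rotated])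
    show "(L ^^ k) f v \<le> (L ^^ Suc k) f v" for k
      using Lnn[OF that(2)] by (auto simp: L_def intro!: succ_sum_nonneg)
  qed
  have Lpos: "\<exists>N. \<forall>w\<in>?C. 0 < (L ^^ N) f w"
    if f: "\<And>v. v \<in> ?C \<Longrightarrow> 0 \<le> f v" and v: "v \<in> ?C" "0 < f v" for f v
  proof -
    have ex: "\<exists>k. 0 < (L ^^ k) f w" if "E\<^sup>*\<^sup>* w v" "w \<in> ?C" for w
      using that
    proof (induction rule: converse_rtranclp_induct)
      case base
      then show ?case using v by (intro exI[of _ 0]) simp
    next
      case (step w w')
      then have w': "w' \<in> ?C" using rtranclp_in_scc v(1) by blast
      then obtain k where k: "0 < (L ^^ k) f w'" using step by blast
      also have "(L ^^ k) f w' \<le> ?T ((L ^^ k) f) w"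
        using Lnn[OF f] w' step(1) finC by (intro succ_sum_ge_single) auto
      also have "\<dots> \<le> (L ^^ Suc k) f w"
        using Lnn[OF f step.prems] by (simp add: L_def)
      finally show ?case by blast
    qed
    have "\<forall>w\<in>?C. \<exists>k. 0 < (L ^^ k) f w"
      using ex v(1) unfolding scc_def by (blast intro: rtranclp_trans)
    then obtain k where k: "\<And>w. w \<in> ?C \<Longrightarrow> 0 < (L ^^ k w) f w" by metis
    have "0 < (L ^^ Max (k ` ?C)) f w" if "w \<in> ?C" for w
      using k[OF that] Lmono[OF _ f that, of "k w" "Max (k ` ?C)"] finC that by fastforce
    then show ?thesis by blast
  qed
  define f where "f v = ?T h v - ?r * h v" for v
  have fnn: "0 \<le> f v" if "v \<in> ?C" for v using h(3)[OF that] by (simp add: f_def)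
  \<comment> \<open>\<open>L\<close> is the identity plus the operator and commutes with it, so the
    defect of \<open>(L ^^ N) h\<close> is the image under \<open>L ^^ N\<close> of the defect
    \<open>f\<close> of \<open>h\<close>.\<close>
  have comm: "?T ((L ^^ N) h) w - ?r * (L ^^ N) h w = (L ^^ N) f w" for N w
  proof (induction N arbitrary: w)
    case 0
    show ?case by (simp add: f_def)
  next
    case (Suc N)
    let ?a = "(L ^^ N) h"
    have "(L ^^ Suc N) f w = (?T ?a w - ?r * ?a w) + ?T (\<lambda>v. ?T ?a v - ?r * ?a v) w"
      unfolding LS Suc ..
    also have "?T (\<lambda>v. ?T ?a v - ?r * ?a v) w = ?T (?T ?a) w - ?r * ?T ?a w"
      by (simp add: succ_sum_def sum_subtractf sum_distrib_left)
    finally have "(L ^^ Suc N) f w = (?T ?a w - ?r * ?a w) + (?T (?T ?a) w - ?r * ?T ?a w)" .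
    moreover have "?T ((L ^^ Suc N) h) w = ?T ?a w + ?T (?T ?a) w"
      using succ_sum_add[of E ?C ?a "?T ?a" w] by (simp add: L_def)
    ultimately show ?case unfolding LS[of N h] by (simp add: algebra_simps)
  qed
  have f0: "f v = 0" if v: "v \<in> ?C" for v
  proof (rule ccontr)
    assume "f v \<noteq> 0"
    then have "0 < f v" using fnn[OF v] by simp
    from Lpos[of f v, OF fnn v this] obtain N where N: "\<And>w. w \<in> ?C \<Longrightarrow> 0 < (L ^^ N) f w" by blast
    obtain v0 where v0: "v0 \<in> ?C" "0 < h v0" using h(2) by blast
    define g where "g = (L ^^ N) h"
    have gh: "h w \<le> g w" if "w \<in> ?C" for w
      using Lmono[of 0 N h w] h(1) that by (simp add: g_def)
    define d where "d = Min ((L ^^ N) f ` ?C)"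
    define B where "B = Max (g ` ?C)"
    have d: "0 < d" "\<And>w. w \<in> ?C \<Longrightarrow> d \<le> (L ^^ N) f w"
      unfolding d_def using N finC neC by (auto simp: Min_gr_iff)
    have gB: "g w \<le> B" if "w \<in> ?C" for w unfolding B_def using finC that by auto
    have B: "0 < B" using gB[OF v0(1)] gh[OF v0(1)] v0(2) by simp
    \<comment> \<open>Every defect of \<open>g\<close> is at least \<open>d\<close> and
      \<open>g\<close> is at most \<open>B\<close>, so the factor can be raised by
      \<open>d / B\<close>, beyond the radius of the class.\<close>
    have "?r + d / B \<le> rel_radius E ?C"
    proof (rule subsolution_le_rel_radius[OF finC])
      show "v0 \<in> ?C" by fact
      show "0 < g v0" using gh[OF v0(1)] v0(2) by simp
      show "0 \<le> g w" if "w \<in> ?C" for w using gh[OF that] h(1)[of w] by simp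
      fix w assume w: "w \<in> ?C"
      have "d / B * g w \<le> d / B * B" using gB[OF w] d(1) B by (intro mult_left_mono) auto
      also have "\<dots> \<le> (L ^^ N) f w" using d(2)[OF w] B by simp
      also have "\<dots> = ?T g w - ?r * g w" unfolding g_def comm ..
      finally show "(?r + d / B) * g w \<le> ?T g w" by (simp add: algebra_simps)
    qed
    then show False using rC d(1) B by (simp add: field_simps)
  qed
  have eq: "?T h v = ?r * h v" if "v \<in> ?C" for v using f0[OF that] by (simp add: f_def)
  obtain v0 where v0: "v0 \<in> ?C" "0 < h v0" using h(2) by blast
  \<comment> \<open>By the eigenvalue equation a zero of \<open>h\<close> forces zeros at all
    successors, so positivity at \<open>v0\<close> travels backwards along paths.\<close>
  have "0 < h w" if "E\<^sup>*\<^sup>* w v0" "w \<in> ?C" for w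
    using that
  proof (induction rule: converse_rtranclp_induct)
    case base
    then show ?case using v0 by simp
  next
    case (step w w')
    then have w': "w' \<in> ?C" using rtranclp_in_scc v0(1) by blast
    with step have "0 < h w'" by blast
    also have "\<dots> \<le> ?T h w" using w' step(1) finC h(1) by (intro succ_sum_ge_single) auto
    also have "\<dots> = ?r * h w" using eq step by blast
    finally show ?case using pos by (simp add: zero_less_mult_iff)
  qed
  moreover have "E\<^sup>*\<^sup>* w v0" if "w \<in> ?C" for w
    using that v0(1) by (auto simp: scc_def intro: rtranclp_trans)
  ultimately show ?thesis using that[of h] eq by blast
qed

text \<open>Below the critical classes, and above them, there is a supersolution with a factor less than
  \<open>\<rho>\<close>. On a critical class the bound \<open>c (2 \<rho>\<^sup>k - r\<^sub>0\<^sup>k) h\<close> absorbs the paths that leave it.\<close>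

lemma path_count_bound:
  assumes pos: "0 < rel_radius E V"
    and chain: "\<And>u v. u \<in> critical \<Longrightarrow> v \<in> critical \<Longrightarrow> E\<^sup>*\<^sup>* u v \<Longrightarrow> E\<^sup>*\<^sup>* v u"
  obtains c where "\<And>k u. u \<in> V \<Longrightarrow> ((succ_sum E V) ^^ k) (\<lambda>_. 1) u \<le> c * rel_radius E V ^ k"
proof -
  let ?r = "rel_radius E V"
  define f where "f k = ((succ_sum E V) ^^ k) (\<lambda>_. 1)" for k
  have f0: "f 0 = (\<lambda>_. 1)" and fS: "f (Suc k) u = (\<Sum>v | E u v. f k v)" for k u
  proof -
    show "f 0 = (\<lambda>_. 1)" by (simp add: f_def)
    have "{v \<in> V. E u v} = {v. E u v}" using E_in_V by auto
    then show "f (Suc k) u = (\<Sum>v | E u v. f k v)" by (simp add: f_def succ_sum_def)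
  qed
  have fnn: "0 \<le> f k u" for k u
    by (induction k arbitrary: u) (auto simp: f0 fS intro!: sum_nonneg)
  have finE: "finite {v. E u v \<and> P v}" for u P
    by (rule finite_subset[OF _ finite_V]) (auto dest: E_in_V)
  \<comment> \<open>\<open>S0\<close> is closed under successors and its paths never meet a critical
    class; \<open>S2\<close> collects the noncritical vertices from which a critical class can be
    reached.\<close>
  define S0 where "S0 = {u \<in> V. \<forall>v. E\<^sup>*\<^sup>* u v \<longrightarrow> v \<notin> critical}"
  define S2 where "S2 = V - critical - S0"
  have "S0 \<subseteq> V" "S0 \<inter> critical = {}" by (auto simp: S0_def)
  from noncritical_supersolution[OF this pos] obtain r0 g0
    where r0: "0 \<le> r0" "r0 < ?r" and g0: "\<And>u. u \<in> S0 \<Longrightarrow> 1 \<le> g0 u"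
      "\<And>u. u \<in> S0 \<Longrightarrow> succ_sum E S0 g0 u \<le> r0 * g0 u" by blast
  have "S2 \<subseteq> V" "S2 \<inter> critical = {}" by (auto simp: S2_def)
  from noncritical_supersolution[OF this pos] obtain r2 g2
    where r2: "0 \<le> r2" "r2 < ?r" and g2: "\<And>u. u \<in> S2 \<Longrightarrow> 1 \<le> g2 u"
      "\<And>u. u \<in> S2 \<Longrightarrow> succ_sum E S2 g2 u \<le> r2 * g2 u" by blast
  have b0: "f k u \<le> r0 ^ k * g0 u" if "u \<in> S0" for k u
    using that
  proof (induction k arbitrary: u)
    case 0
    then show ?case using g0 by (simp add: f0)
  next
    case (Suc k)
    have cl: "{v. E u v} = {v. v \<in> S0 \<and> E u v}"
      using Suc.prems E_in_V by (auto simp: S0_def intro: converse_rtranclp_into_rtranclp)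
    have "f (Suc k) u \<le> succ_sum E S0 (\<lambda>v. r0 ^ k * g0 v) u"
      unfolding fS cl succ_sum_def using Suc.IH by (intro sum_mono) auto
    also have "\<dots> \<le> r0 ^ k * (r0 * g0 u)"
      unfolding succ_sum_scale using g0(2)[OF Suc.prems] r0 by (intro mult_left_mono) auto
    finally show ?case by (simp add: algebra_simps)
  qed
  have ex_eig: "\<exists>h. (\<forall>v\<in>scc u. 0 < h v) \<and> (\<forall>v\<in>scc u. succ_sum E (scc u) h v = ?r * h v)"
    if "u \<in> critical" for u
    using critical_eigenvector[OF that pos] by metis
  \<comment> \<open>The choice is made per class, not per vertex, so that \<open>h\<close>
    restricted to a class is one eigenvector.\<close>
  define eig where "eig D = (SOME h. (\<forall>v\<in>D. 0 < h v) \<and> (\<forall>v\<in>D. succ_sum E D h v = ?r * h v))" for D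
  have eig: "(\<forall>v\<in>scc u. 0 < eig (scc u) v) \<and>
      (\<forall>v\<in>scc u. succ_sum E (scc u) (eig (scc u)) v = ?r * eig (scc u) v)" if "u \<in> critical" for u
    unfolding eig_def
    by (rule someI_ex[OF ex_eig[OF that]])
  define h where "h u = eig (scc u) u" for u
  have hpos: "0 < h u" if "u \<in> critical" for u using eig[OF that] scc_self by (simp add: h_def)
  have heq: "succ_sum E (scc u) h u = ?r * h u" if "u \<in> critical" for u
  proof -
    have "succ_sum E (scc u) h u = succ_sum E (scc u) (eig (scc u)) u"
      by (rule succ_sum_cong) (simp add: h_def scc_eq)
    then show ?thesis using eig[OF that] scc_self by (simp add: h_def)
  qed
  have fincrit: "finite critical" using finite_V by (simp add: critical_def)
  define B where "B = (\<Sum>v\<in>S0. g0 v)"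
  have finS0: "finite S0" using finite_V by (simp add: S0_def)
  have B0: "0 \<le> B" unfolding B_def using g0(1) by (intro sum_nonneg) force
  \<comment> \<open>The first requirement starts the induction; the second lets the gap between the
    radius and \<open>r0\<close> absorb the total \<open>B\<close> that can leak into
    \<open>S0\<close> in one step.\<close>
  obtain c where c: "c > 0" "\<And>u. u \<in> critical \<Longrightarrow> 1 \<le> c * h u"
    "\<And>u. u \<in> critical \<Longrightarrow> B \<le> c * (?r - r0) * h u"
  proof -
    define e where "e = Min (insert 1 (h ` critical))"
    have e: "0 < e" "\<And>u. u \<in> critical \<Longrightarrow> e \<le> h u"
      unfolding e_def using fincrit hpos by (auto simp: Min_gr_iff)
    define c where "c = max (1 / e) (B / ((?r - r0) * e))"
    have ce: "1 \<le> c * e" "B \<le> c * (?r - r0) * e"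
    proof -
      have "1 / e \<le> c" "B / ((?r - r0) * e) \<le> c" by (auto simp: c_def)
      then show "1 \<le> c * e" "B \<le> c * (?r - r0) * e" using e(1) r0(2) by (simp_all add: field_simps)
    qed
    have c0: "c > 0" using e(1) by (simp add: c_def less_max_iff_disj)
    show ?thesis
    proof (rule that[OF c0])
      fix u assume u: "u \<in> critical"
      have "c * e \<le> c * h u" using e(2)[OF u] c0 by simp
      then show "1 \<le> c * h u" using ce by simp
      have "c * (?r - r0) * e \<le> c * (?r - r0) * h u"
        using e(2)[OF u] c0 r0 by (intro mult_left_mono) auto
      then show "B \<le> c * (?r - r0) * h u" using ce by simp
    qed
  qed
  have b1: "f k u \<le> c * (2 * ?r ^ k - r0 ^ k) * h u" if "u \<in> critical" for k u
    using that
  proof (induction k arbitrary: u)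
    case 0
    then show ?case using c by (simp add: f0)
  next
    case (Suc k)
    have uV: "u \<in> V" using Suc.prems by (simp add: critical_def)
    let ?q = "c * (2 * ?r ^ k - r0 ^ k)"
    \<comment> \<open>A successor that still reaches a critical vertex lies on a path between
      critical vertices, which \<open>chain\<close> closes to a cycle; so it stays in the
      class.\<close>
    have sub: "v \<in> scc u \<or> v \<in> S0" if uv: "E u v" for v
    proof (rule ccontr)
      assume nt: "\<not> ?thesis"
      then obtain z where z: "E\<^sup>*\<^sup>* v z" "z \<in> critical"
        using E_in_V[OF uv] by (auto simp: S0_def)
      have "E\<^sup>*\<^sup>* u z" using z uv by (simp add: converse_rtranclp_into_rtranclp)
      with chain Suc.prems z(2) have "E\<^sup>*\<^sup>* z u" by blast
      with z uv nt show False by (auto simp: scc_def intro: rtranclp_trans)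
    qed
    have "f (Suc k) u = (\<Sum>v | E u v. f k v)" by (rule fS)
    also have "\<dots> \<le> (\<Sum>v \<in> {v. v \<in> scc u \<and> E u v} \<union> S0. f k v)"
      using sub finS0 finite_scc[OF uV] fnn by (intro sum_mono2) auto
    also have "\<dots> \<le> (\<Sum>v | v \<in> scc u \<and> E u v. f k v) + (\<Sum>v\<in>S0. f k v)"
      using finS0 finite_scc[OF uV] fnn by (simp add: sum_Un sum_nonneg)
    also have "\<dots> \<le> succ_sum E (scc u) (\<lambda>v. ?q * h v) u + (\<Sum>v\<in>S0. r0 ^ k * g0 v)"
      unfolding succ_sum_def
      using Suc.IH critical_scc[OF Suc.prems] b0 by (intro add_mono sum_mono) auto
    also have "\<dots> = ?q * (?r * h u) + r0 ^ k * B"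
      unfolding succ_sum_scale heq[OF Suc.prems] B_def by (simp add: sum_distrib_left)
    also have "r0 ^ k * B \<le> r0 ^ k * (c * (?r - r0) * h u)"
      using c(3)[OF Suc.prems] r0 by (intro mult_left_mono) auto
    \<comment> \<open>The mixed terms cancel: \<open>?r * (2 * ?r ^ k - r0 ^ k) + r0 ^ k * (?r - r0)
      = 2 * ?r ^ Suc k - r0 ^ Suc k\<close>.\<close>
    finally show ?case by (simp add: algebra_simps)
  qed
  define M where "M = (\<Sum>u\<in>S0. g0 u) + (\<Sum>u\<in>critical. 2 * c * h u)"
  have M0: "0 \<le> M" unfolding M_def B_def[symmetric] using B0 c(1) hpos
    by (intro add_nonneg_nonneg sum_nonneg) (auto simp: less_imp_le)
  have bM: "f k u \<le> M * ?r ^ k" if "u \<in> S0 \<union> critical" for k u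
  proof (cases "u \<in> S0")
    case True
    have "f k u \<le> r0 ^ k * g0 u" using b0 True by blast
    also have "\<dots> \<le> ?r ^ k * g0 u"
      using r0 g0(1)[OF True] by (intro mult_right_mono power_mono) auto
    also have "g0 u \<le> (\<Sum>u\<in>S0. g0 u)"
      using True finS0 g0(1) by (intro member_le_sum) force+
    also have "\<dots> \<le> M" unfolding M_def using c(1) hpos by (auto intro!: sum_nonneg simp: less_imp_le)
    finally show ?thesis using pos by (simp add: mult.commute)
  next
    case False
    then have u: "u \<in> critical" using that by auto
    have "f k u \<le> c * (2 * ?r ^ k - r0 ^ k) * h u" using b1 u by blast
    also have "\<dots> \<le> c * (2 * ?r ^ k) * h u"
      using c(1) hpos[OF u] r0 by (intro mult_right_mono mult_left_mono) auto
    also have "\<dots> = ?r ^ k * (2 * c * h u)" by simp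
    also have "2 * c * h u \<le> (\<Sum>u\<in>critical. 2 * c * h u)"
      using u fincrit hpos c(1) by (intro member_le_sum) (auto simp: less_imp_le)
    also have "\<dots> \<le> M" unfolding M_def using B0 B_def by simp
    finally show ?thesis using pos by (simp add: mult.commute)
  qed
  \<comment> \<open>\<open>card V * M\<close> bounds, in units of \<open>?r ^ k\<close>, the paths
    that leave \<open>S2\<close> in one step; \<open>N\<close> is so large that the gap between
    \<open>?r\<close> and \<open>r2\<close> pays for them.\<close>
  define N where "N = max 1 (card V * M / (?r - r2))"
  have N1: "1 \<le> N" "card V * M \<le> N * (?r - r2)"
  proof -
    have "card V * M / (?r - r2) \<le> N" by (simp add: N_def)
    then show "card V * M \<le> N * (?r - r2)" using r2(2) by (simp add: pos_divide_le_eq)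
  qed (simp add: N_def)
  have b2: "f k u \<le> N * ?r ^ k * g2 u" if "u \<in> S2" for k u
    using that
  proof (induction k arbitrary: u)
    case 0
    have "1 * 1 \<le> N * g2 u" using N1(1) g2(1)[OF 0] by (intro mult_mono) auto
    then show ?case by (simp add: f0)
  next
    case (Suc k)
    let ?W = "S0 \<union> critical"
    have finW: "finite ?W" using finS0 fincrit by simp
    have cl: "{v. E u v} \<subseteq> {v. v \<in> S2 \<and> E u v} \<union> ?W" by (auto simp: S2_def dest: E_in_V)
    have finS2: "finite S2" using finite_V by (simp add: S2_def)
    have "f (Suc k) u = (\<Sum>v | E u v. f k v)" by (rule fS)
    also have "\<dots> \<le> (\<Sum>v \<in> {v. v \<in> S2 \<and> E u v} \<union> ?W. f k v)"
      using cl finW finS2 fnn by (intro sum_mono2) auto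
    also have "\<dots> \<le> (\<Sum>v | v \<in> S2 \<and> E u v. f k v) + (\<Sum>v\<in>?W. f k v)"
      using finW finS2 fnn by (simp add: sum_Un sum_nonneg)
    also have "\<dots> \<le> succ_sum E S2 (\<lambda>v. (N * ?r ^ k) * g2 v) u + (\<Sum>v\<in>?W. M * ?r ^ k)"
      unfolding succ_sum_def using Suc.IH bM by (intro add_mono sum_mono) auto
    also have "\<dots> \<le> (N * ?r ^ k) * (r2 * g2 u) + card V * (M * ?r ^ k)"
    proof (rule add_mono)
      show "succ_sum E S2 (\<lambda>v. (N * ?r ^ k) * g2 v) u \<le> (N * ?r ^ k) * (r2 * g2 u)"
        unfolding succ_sum_scale using g2(2)[OF Suc.prems] N1(1) pos by (intro mult_left_mono) auto
      have "card ?W \<le> card V" using finite_V by (intro card_mono) (auto simp: S0_def critical_def)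
      then have "real (card ?W) * (M * ?r ^ k) \<le> real (card V) * (M * ?r ^ k)"
        using M0 pos by (intro mult_right_mono) auto
      then show "(\<Sum>v\<in>?W. M * ?r ^ k) \<le> card V * (M * ?r ^ k)" by simp
    qed
    also have "\<dots> = ?r ^ k * (N * r2 * g2 u + card V * M)" by (simp add: algebra_simps)
    also have "card V * M \<le> N * (?r - r2) * 1" using N1(2) by simp
    also have "N * (?r - r2) * 1 \<le> N * (?r - r2) * g2 u"
      using g2(1)[OF Suc.prems] N1(1) r2(2) by (intro mult_left_mono) auto
    finally show ?case using pos by (simp add: algebra_simps)
  qed
  show ?thesis
  proof (rule that[of "M + (\<Sum>u\<in>S2. N * g2 u)"])
    fix k u assume "u \<in> V"
    have s0: "0 \<le> (\<Sum>u\<in>S2. N * g2 u)"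
      using N1(1) g2(1) by (intro sum_nonneg mult_nonneg_nonneg) force+
    show "((succ_sum E V) ^^ k) (\<lambda>_. 1) u \<le> (M + (\<Sum>u\<in>S2. N * g2 u)) * ?r ^ k"
    proof (cases "u \<in> S2")
      case True
      have finS2: "finite S2" using finite_V by (simp add: S2_def)
      have "N * g2 u \<le> (\<Sum>u\<in>S2. N * g2 u)"
        using True finS2 N1(1) g2(1) by (intro member_le_sum mult_nonneg_nonneg) force+
      then have "(N * g2 u) * ?r ^ k \<le> (M + (\<Sum>u\<in>S2. N * g2 u)) * ?r ^ k"
        using M0 pos by (intro mult_right_mono) auto
      then show ?thesis using b2[OF True, of k] by (simp add: f_def algebra_simps)
    next
      case False
      then have "u \<in> S0 \<union> critical" using \<open>u \<in> V\<close> by (auto simp: S2_def)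
      from bM[OF this, of k] have "f k u \<le> M * ?r ^ k" .
      also have "\<dots> \<le> (M + (\<Sum>u\<in>S2. N * g2 u)) * ?r ^ k"
        using s0 pos by (intro mult_right_mono) auto
      finally show ?thesis by (simp add: f_def)
    qed
  qed
qed

text \<open>With \<open>g\<close> and \<open>h\<close> supported on the lower and the upper class, \<open>T\<^sup>j g \<ge> g + \<epsilon> h\<close> for some \<open>j\<close> and
  \<open>T h \<ge> h\<close>, where \<open>T\<close> is the normalised operator; hence \<open>T\<^sup>n\<^sup>j g \<ge> g + n \<epsilon> h\<close>.\<close>

lemma subsolution_unbounded:
  assumes pos: "0 < rel_radius E V"
    and uv: "u \<in> critical" "v \<in> critical" "E\<^sup>*\<^sup>* u v" "\<not> E\<^sup>*\<^sup>* v u"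
  obtains g where "\<And>w. 0 \<le> g w"
    "\<And>w. w \<in> V \<Longrightarrow> rel_radius E V * g w \<le> succ_sum E V g w"
    "\<And>b. \<exists>k. \<exists>w\<in>V. b * rel_radius E V ^ k < ((succ_sum E V) ^^ k) g w"
proof -
  let ?r = "rel_radius E V"
  define T where "T f = (\<lambda>w. succ_sum E V f w / ?r)" for f
  have uV: "u \<in> V" "v \<in> V" using uv by (auto simp: critical_def)
  obtain h1 where h1: "\<And>w. w \<in> scc u \<Longrightarrow> 0 < h1 w"
    "\<And>w. w \<in> scc u \<Longrightarrow> succ_sum E (scc u) h1 w = ?r * h1 w"
    using critical_eigenvector[OF uv(1) pos] by blast
  obtain h2 where h2: "\<And>w. w \<in> scc v \<Longrightarrow> 0 < h2 w"
    "\<And>w. w \<in> scc v \<Longrightarrow> succ_sum E (scc v) h2 w = ?r * h2 w"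
    using critical_eigenvector[OF uv(2) pos] by blast
  define h where "h w = (if w \<in> scc u then h1 w else 0)" for w
  define g where "g w = (if w \<in> scc v then h2 w else 0)" for w
  have disj: "w \<notin> scc v" if "w \<in> scc u" for w
    using that uv(4) by (auto simp: scc_def dest: rtranclp_trans)
  have Tmono: "(T ^^ k) f w \<le> (T ^^ k) f' w"
    if "\<And>w. w \<in> V \<Longrightarrow> f w \<le> f' w" "w \<in> V" for k f f' w
    using that(2)
    by (induction k arbitrary: w)
       (use pos that(1) in \<open>auto simp: T_def intro!: divide_right_mono succ_sum_mono\<close>)
  have Tlin: "(T ^^ k) (\<lambda>w. f w + a * f' w) = (\<lambda>w. (T ^^ k) f w + a * (T ^^ k) f' w)" for k f f' a
    by (induction k) (auto simp: T_def succ_sum_add succ_sum_scale add_divide_distrib)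
  have ext: "k w \<le> T k w" if C: "C \<subseteq> V" and k: "\<And>w. w \<in> C \<Longrightarrow> 0 < k' w"
      "\<And>w. w \<in> C \<Longrightarrow> succ_sum E C k' w = ?r * k' w"
      "k = (\<lambda>w. if w \<in> C then k' w else 0)" for C k k' w
  proof -
    have nn: "0 \<le> k w" for w using k(1)[of w] by (simp add: k(3) less_imp_le)
    show ?thesis
    proof (cases "w \<in> C")
      case True
      have "?r * k w = succ_sum E C k w"
        using k(2)[OF True] True succ_sum_cong[of C k k' E w] by (simp add: k(3))
      also have "\<dots> \<le> succ_sum E V k w" using C finite_V nn by (intro succ_sum_mono_set) auto
      finally show ?thesis using pos by (simp add: T_def pos_le_divide_eq mult.commute)
    next
      case False
      then have "k w = 0" by (simp add: k(3))
      then show ?thesis using nn pos by (simp add: T_def succ_sum_nonneg)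
    qed
  qed
  have hT: "h w \<le> T h w" for w
    by (rule ext[OF scc_subset[OF uV(1)] h1]) (auto simp: h_def)
  have gT: "g w \<le> T g w" for w
    by (rule ext[OF scc_subset[OF uV(2)] h2]) (auto simp: g_def)
  have h0: "0 \<le> h w" for w using h1(1)[of w] by (simp add: h_def less_imp_le)
  have g0: "0 \<le> g w" for w using h2(1)[of w] by (simp add: g_def less_imp_le)
  have up: "f w \<le> (T ^^ k) f w" if f: "\<And>w. f w \<le> T f w" and "w \<in> V" for f w k
  proof (induction k)
    case (Suc k)
    have "(T ^^ k) f w \<le> (T ^^ k) (T f) w" using Tmono[of f "T f" w k] that by blast
    with Suc show ?case by (simp add: funpow_swap1)
  qed simp
  have Tinc: "(T ^^ k) g w \<le> (T ^^ l) g w" if "k \<le> l" "w \<in> V" for k l w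
  proof -
    have "(T ^^ k) g w \<le> (T ^^ k) ((T ^^ (l - k)) g) w"
      using Tmono[of g "(T ^^ (l - k)) g" w k] up[OF gT] that by blast
    also have "\<dots> = (T ^^ l) g w" using that(1) funpow_add[of k "l - k" T] by simp
    finally show ?thesis .
  qed
  have ex: "\<exists>k. 0 < (T ^^ k) g w" if "E\<^sup>*\<^sup>* w v" "w \<in> V" for w
    using that
  proof (induction rule: converse_rtranclp_induct)
    case base
    have "0 < g v" using h2(1) scc_self by (simp add: g_def)
    then show ?case by (intro exI[of _ 0]) simp
  next
    case (step w w')
    then obtain k where k: "0 < (T ^^ k) g w'" using E_in_V by blast
    have nn: "0 \<le> (T ^^ k) g z" if "z \<in> V" for z
      using up[OF gT that, of k] g0[of z] by simp
    have "(T ^^ k) g w' \<le> succ_sum E V ((T ^^ k) g) w"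
      using E_in_V step(1) finite_V nn by (intro succ_sum_ge_single) auto
    then have "0 < (T ^^ Suc k) g w" using k pos by (simp add: T_def)
    then show ?case by blast
  qed
  have "\<forall>w\<in>scc u. \<exists>k. 0 < (T ^^ k) g w"
    using ex uv(3) scc_subset[OF uV(1)] unfolding scc_def by (blast intro: rtranclp_trans)
  then obtain kk where kk: "\<And>w. w \<in> scc u \<Longrightarrow> 0 < (T ^^ kk w) g w" by metis
  define j where "j = Max (kk ` scc u)"
  have finC: "finite (scc u)" by (rule finite_scc[OF uV(1)])
  have jpos: "0 < (T ^^ j) g w" if "w \<in> scc u" for w
    using kk[OF that] Tinc[of "kk w" j w] that finC scc_subset[OF uV(1)] unfolding j_def by fastforce
  \<comment> \<open>\<open>g\<close> vanishes on \<open>scc u\<close> and \<open>h\<close> vanishes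
    off it, so \<open>e\<close> only has to compare \<open>(T ^^ j) g\<close>, which is positive on
    \<open>scc u\<close>, with \<open>h1\<close> there.\<close>
  define e where "e = Min ((\<lambda>w. (T ^^ j) g w / h1 w) ` scc u)"
  have e0: "0 < e" unfolding e_def using finC jpos h1(1) scc_self[of u] by (subst Min_gr_iff) auto
  have ge: "g w + e * h w \<le> (T ^^ j) g w" if "w \<in> V" for w
  proof (cases "w \<in> scc u")
    case True
    have "e \<le> (T ^^ j) g w / h1 w" unfolding e_def using True finC by (intro Min_le) auto
    then show ?thesis using True disj[OF True] h1(1)[OF True]
      by (simp add: g_def h_def pos_le_divide_eq)
  next
    case False
    then show ?thesis using up[OF gT that, of j] by (simp add: h_def)
  qed
  have grow: "g w + real n * e * h w \<le> (T ^^ (n * j)) g w" if "w \<in> V" for n w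
    using that
  proof (induction n arbitrary: w)
    case (Suc n)
    have "g w + real (Suc n) * e * h w = (g w + e * h w) + (real n * e) * h w"
      by (simp add: algebra_simps)
    also have "\<dots> \<le> (T ^^ j) g w + (real n * e) * (T ^^ j) h w"
      using ge[OF Suc.prems] up[OF hT Suc.prems, of j] e0 by (intro add_mono mult_left_mono) auto
    also have "\<dots> = (T ^^ j) (\<lambda>w. g w + (real n * e) * h w) w" unfolding Tlin ..
    also have "\<dots> \<le> (T ^^ j) ((T ^^ (n * j)) g) w"
      using Suc by (intro Tmono) auto
    also have "\<dots> = (T ^^ (Suc n * j)) g w" by (simp add: funpow_add)
    finally show ?case .
  qed simp
  have Tpow: "(T ^^ k) g w = ((succ_sum E V) ^^ k) g w / ?r ^ k" for k w
    using pos by (induction k arbitrary: w)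
      (simp_all add: T_def succ_sum_def sum_divide_distrib, simp add: field_simps)
  show ?thesis
  proof (rule that[of g])
    show "?r * g w \<le> succ_sum E V g w" for w
      using gT[of w] pos by (simp add: T_def pos_le_divide_eq mult.commute)
    show "\<exists>k. \<exists>w\<in>V. b * ?r ^ k < ((succ_sum E V) ^^ k) g w" for b
    proof -
      have hu: "0 < h u" using h1(1) scc_self by (simp add: h_def)
      obtain n where n: "b < real n * (e * h u)"
        using ex_less_of_nat_mult[of "e * h u" b] e0 hu by auto
      also have "\<dots> \<le> (T ^^ (n * j)) g u" using grow[OF uV(1), of n] g0[of u] by (simp add: mult.assoc)
      finally have "b * ?r ^ (n * j) < ((succ_sum E V) ^^ (n * j)) g u"
        unfolding Tpow using pos by (simp add: pos_less_divide_eq)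
      then show ?thesis using uV(1) by blast
    qed
  qed (rule g0)
qed

end

section \<open>Hausdorff measure and dimension\<close>

lemma hausdorff_gauge_empty [simp]: "hausdorff_gauge s {} = 0"
  by (simp add: hausdorff_gauge_def)

lemma hausdorff_premeasure_le:
  assumes "E \<subseteq> (\<Union>j. U j)" "\<And>j. bounded (U j)" "\<And>j. diameter (U j) \<le> \<delta>"
  shows "hausdorff_premeasure s \<delta> E \<le> (\<Sum>j. hausdorff_gauge s (U j))"
  unfolding hausdorff_premeasure_def
  by (rule INF_lower) (use assms in \<open>auto simp: hausdorff_covers_def\<close>)

lemma hausdorff_premeasure_mono:
  assumes "E \<subseteq> F" shows "hausdorff_premeasure s \<delta> E \<le> hausdorff_premeasure s \<delta> F"
  unfolding hausdorff_premeasure_def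
  by (rule INF_superset_mono) (use assms in \<open>auto simp: hausdorff_covers_def\<close>)

lemma hausdorff_premeasure_antimono:
  assumes "\<delta> \<le> \<delta>'" shows "hausdorff_premeasure s \<delta>' E \<le> hausdorff_premeasure s \<delta> E"
  unfolding hausdorff_premeasure_def
  by (rule INF_superset_mono) (use assms in \<open>auto simp: hausdorff_covers_def intro: order_trans\<close>)

lemma hausdorff_premeasure_le_measure:
  "0 < \<delta> \<Longrightarrow> hausdorff_premeasure s \<delta> E \<le> hausdorff_measure s E"
  unfolding hausdorff_measure_def by (rule SUP_upper) simp

lemma hausdorff_measure_le:
  "(\<And>\<delta>. 0 < \<delta> \<Longrightarrow> hausdorff_premeasure s \<delta> E \<le> c) \<Longrightarrow> hausdorff_measure s E \<le> c"
  unfolding hausdorff_measure_def by (rule SUP_least) simp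

lemma hausdorff_measure_mono:
  assumes "E \<subseteq> F" shows "hausdorff_measure s E \<le> hausdorff_measure s F"
  by (rule hausdorff_measure_le)
    (meson assms hausdorff_premeasure_mono hausdorff_premeasure_le_measure order_trans)

lemma hausdorff_premeasure_UN:
  fixes E :: "nat \<Rightarrow> 'a::metric_space set"
  shows "hausdorff_premeasure s \<delta> (\<Union>i. E i) \<le> (\<Sum>i. hausdorff_premeasure s \<delta> (E i))"
proof (rule ennreal_le_epsilon)
  fix e :: real assume e: "0 < e" and fin: "(\<Sum>i. hausdorff_premeasure s \<delta> (E i)) < Orderings.top"
  let ?p = "\<lambda>i. hausdorff_premeasure s \<delta> (E i)"
  have pfin: "?p i < Orderings.top" for i
    using fin sum_le_suminf[of ?p "{i}"] by (auto intro: le_less_trans)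
  have "\<exists>U\<in>hausdorff_covers \<delta> (E i). (\<Sum>j. hausdorff_gauge s (U j)) < ?p i + ennreal (e * (1/2) ^ Suc i)" for i
  proof -
    have "0 < ennreal (e * (1/2) ^ Suc i)" using e by simp
    then have "?p i < ?p i + ennreal (e * (1/2) ^ Suc i)"
      using pfin[of i] by (metis ennreal_add_left_cancel_less add.right_neutral infinity_ennreal_def less_irrefl)
    then show ?thesis
      by (subst (asm) (1) hausdorff_premeasure_def) (simp only: INF_less_iff)
  qed
  then obtain U where U: "\<And>i. U i \<in> hausdorff_covers \<delta> (E i)"
    "\<And>i. (\<Sum>j. hausdorff_gauge s (U i j)) < ?p i + ennreal (e * (1/2) ^ Suc i)" by metis
  define W where "W k = (case prod_decode k of (i, j) \<Rightarrow> U i j)" for k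
  have "hausdorff_premeasure s \<delta> (\<Union>i. E i) \<le> (\<Sum>k. hausdorff_gauge s (W k))"
  proof (rule hausdorff_premeasure_le)
    show "(\<Union>i. E i) \<subseteq> (\<Union>k. W k)"
    proof safe
      fix x i assume "x \<in> E i"
      then obtain j where "x \<in> U i j" using U(1)[of i] by (auto simp: hausdorff_covers_def)
      then have "x \<in> W (prod_encode (i, j))" by (simp add: W_def)
      then show "x \<in> (\<Union>k. W k)" by blast
    qed
  qed (use U(1) in \<open>auto simp: W_def hausdorff_covers_def split: prod.split\<close>)
  also have "\<dots> = (\<Sum>k. (\<lambda>(i, j). hausdorff_gauge s (U i j)) (prod_decode k))"
    by (simp add: W_def split_beta)
  also have "\<dots> = (\<Sum>i. \<Sum>j. hausdorff_gauge s (U i j))"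
    by (rule suminf_ennreal_2dimen) simp
  also have "\<dots> \<le> (\<Sum>i. ?p i + ennreal (e * (1/2) ^ Suc i))"
    using U(2) by (intro suminf_le) (auto simp: less_imp_le)
  also have "\<dots> = (\<Sum>i. ?p i) + (\<Sum>i. ennreal (e * (1/2) ^ Suc i))"
    by (rule suminf_add[symmetric]) auto
  also have "(\<Sum>i. ennreal (e * (1/2) ^ Suc i)) = ennreal e"
  proof (rule suminf_ennreal_eq)
    show "(\<lambda>i. e * (1/2) ^ Suc i) sums e"
      using sums_mult[OF power_half_series, of e] by simp
  qed (use e in auto)
  finally show "hausdorff_premeasure s \<delta> (\<Union>i. E i) \<le> (\<Sum>i. ?p i) + ennreal e" .
qed

lemma hausdorff_measure_UN:
  "hausdorff_measure s (\<Union>i::nat. E i) \<le> (\<Sum>i. hausdorff_measure s (E i))"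
proof (rule hausdorff_measure_le)
  fix \<delta> :: real assume "0 < \<delta>"
  have "hausdorff_premeasure s \<delta> (\<Union>i. E i) \<le> (\<Sum>i. hausdorff_premeasure s \<delta> (E i))"
    by (rule hausdorff_premeasure_UN)
  also have "\<dots> \<le> (\<Sum>i. hausdorff_measure s (E i))"
    using \<open>0 < \<delta>\<close> by (intro suminf_le hausdorff_premeasure_le_measure) auto
  finally show "hausdorff_premeasure s \<delta> (\<Union>i. E i) \<le> (\<Sum>i. hausdorff_measure s (E i))" .
qed

lemma hausdorff_measure_UN_null:
  "(\<And>i::nat. hausdorff_measure s (E i) = 0) \<Longrightarrow> hausdorff_measure s (\<Union>i. E i) = 0"
  using hausdorff_measure_UN[of s E] by simp

lemma hausdorff_measure_empty [simp]: "hausdorff_measure s ({} :: 'a::metric_space set) = 0"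
proof -
  have "hausdorff_premeasure s \<delta> ({} :: 'a set) \<le> 0" if "0 < \<delta>" for \<delta>
    using hausdorff_premeasure_le[of "{}" "\<lambda>_. {}" \<delta> s] that by simp
  then have "hausdorff_measure s ({} :: 'a set) \<le> 0" by (rule hausdorff_measure_le)
  then show ?thesis by simp
qed

lemma hausdorff_measure_Un:
  "hausdorff_measure s (A \<union> B) \<le> hausdorff_measure s A + hausdorff_measure s B"
proof -
  let ?E = "\<lambda>i::nat. if i = 0 then A else if i = 1 then B else {}"
  have "A \<union> B = (\<Union>i. ?E i)" 
  proof
    show "A \<union> B \<subseteq> (\<Union>i. ?E i)" using UN_upper[of 0 UNIV ?E] UN_upper[of 1 UNIV ?E] by auto
  qed (auto split: if_splits)
  then have "hausdorff_measure s (A \<union> B) \<le> (\<Sum>i. hausdorff_measure s (?E i))"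
    using hausdorff_measure_UN[of s ?E] by simp
  also have "\<dots> = (\<Sum>i\<in>{0, 1}. hausdorff_measure s (?E i))"
    by (rule suminf_finite) auto
  finally show ?thesis by simp
qed

lemma hausdorff_measure_countable:
  assumes "0 < s" "countable D" shows "hausdorff_measure s D = 0"
proof (cases "D = {}")
  case False
  have sing: "hausdorff_measure s {x} = 0" for x :: 'a
  proof -
    have "hausdorff_premeasure s \<delta> {x} \<le> 0" if "0 < \<delta>" for \<delta>
    proof -
      have "hausdorff_premeasure s \<delta> {x} \<le> (\<Sum>j::nat. hausdorff_gauge s {x})"
        using that by (intro hausdorff_premeasure_le) auto
      also have "\<dots> = 0" using assms(1) by (simp add: hausdorff_gauge_def)
      finally show ?thesis .
    qed
    then show ?thesis using hausdorff_measure_le[of s "{x}" 0] by simp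
  qed
  have "D = (\<Union>i. {from_nat_into D i})"
    using range_from_nat_into[OF False assms(2)] by (simp add: UNION_singleton_eq_range)
  then show ?thesis using hausdorff_measure_UN_null[of s "\<lambda>i. {from_nat_into D i}"] sing by simp
qed simp

lemma hausdorff_premeasure_finite_cover:
  assumes F: "finite F" "E \<subseteq> \<Union>F" "0 \<le> \<delta>"
    and U: "\<And>U. U \<in> F \<Longrightarrow> bounded U \<and> diameter U \<le> \<delta> \<and> hausdorff_gauge s U \<le> c"
  shows "hausdorff_premeasure s \<delta> E \<le> of_nat (card F) * c"
proof -
  have b: "bij_betw (from_nat_into F) {..<card F} F"
    using F(1) by (simp add: bij_betw_from_nat_into_finite)
  define W where "W j = (if j < card F then from_nat_into F j else {})" for j
  have WF: "W j \<in> F" if "j < card F" for j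
    using b that by (auto simp: W_def bij_betw_def)
  have "hausdorff_premeasure s \<delta> E \<le> (\<Sum>j. hausdorff_gauge s (W j))"
  proof (rule hausdorff_premeasure_le)
    show "E \<subseteq> (\<Union>j. W j)"
    proof
      fix x assume "x \<in> E"
      then obtain X where X: "X \<in> F" "x \<in> X" using F(2) by auto
      then obtain j where "j < card F" "from_nat_into F j = X"
        using b by (metis bij_betw_iff_bijections lessThan_iff)
      then show "x \<in> (\<Union>j. W j)" using X by (auto simp: W_def intro!: exI[of _ j])
    qed
    show "bounded (W j)" "diameter (W j) \<le> \<delta>" for j
      using U[OF WF, of j] F(3) by (cases "j < card F"; simp add: W_def)+
  qed
  also have "\<dots> = (\<Sum>j<card F. hausdorff_gauge s (W j))"
    by (rule suminf_finite) (auto simp: W_def)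
  also have "\<dots> \<le> (\<Sum>j<card F. c)" using U WF by (intro sum_mono) auto
  finally show ?thesis by simp
qed

text \<open>Covers are mapped to covers with no larger diameters. Applied to the maps that undo
  finitely many renormalisations.\<close>

lemma hausdorff_measure_contraction_null:
  fixes f :: "'a::metric_space \<Rightarrow> 'b::metric_space"
  assumes f: "\<And>x y. dist (f x) (f y) \<le> dist x y" and s: "0 \<le> s"
    and null: "hausdorff_measure s E = 0"
  shows "hausdorff_measure s (f ` E) = 0"
proof -
  have "hausdorff_premeasure s \<delta> (f ` E) \<le> 0" if "0 < \<delta>" for \<delta>
  proof -
    have "hausdorff_premeasure s \<delta> (f ` E) \<le> hausdorff_premeasure s \<delta> E"
      unfolding hausdorff_premeasure_def[of s \<delta> E]
    proof (rule INF_greatest)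
      fix U assume U: "U \<in> hausdorff_covers \<delta> E"
      have b: "bounded (f ` U j)" and d: "diameter (f ` U j) \<le> diameter (U j)" for j
      proof -
        have bU: "bounded (U j)" using U by (simp add: hausdorff_covers_def)
        then obtain e where "\<forall>x\<in>U j. \<forall>y\<in>U j. dist x y \<le> e" using bounded_two_points by blast
        then have "\<forall>x\<in>U j. \<forall>y\<in>U j. dist (f x) (f y) \<le> e" by (meson f order_trans)
        then show "bounded (f ` U j)" unfolding bounded_two_points by (intro exI[of _ e]) auto
        show "diameter (f ` U j) \<le> diameter (U j)"
        proof (cases "U j = {}")
          case False
          have "dist (f x) (f y) \<le> diameter (U j)" if "x \<in> U j" "y \<in> U j" for x y
            using diameter_bounded_bound[OF bU that] f[of x y] by simp
          then show ?thesis
            using False unfolding diameter_def[of "f ` U j"] by (auto intro!: cSUP_least)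
        qed simp
      qed
      have "hausdorff_premeasure s \<delta> (f ` E) \<le> (\<Sum>j. hausdorff_gauge s (f ` U j))"
      proof (rule hausdorff_premeasure_le)
        show "f ` E \<subseteq> (\<Union>j. f ` U j)" using U unfolding hausdorff_covers_def by blast
        show "diameter (f ` U j) \<le> \<delta>" for j
          using d[of j] U by (auto simp: hausdorff_covers_def intro: order_trans)
      qed (rule b)
      also have "\<dots> \<le> (\<Sum>j. hausdorff_gauge s (U j))"
      proof (rule suminf_le)
        show "hausdorff_gauge s (f ` U j) \<le> hausdorff_gauge s (U j)" for j
          using d[of j] s b diameter_ge_0[OF b]
          by (auto simp: hausdorff_gauge_def intro!: ennreal_leI powr_mono2)
      qed auto
      finally show "hausdorff_premeasure s \<delta> (f ` E) \<le> (\<Sum>j. hausdorff_gauge s (U j))" .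
    qed
    also have "\<dots> \<le> 0" using hausdorff_premeasure_le_measure[OF that, of s E] null by simp
    finally show ?thesis .
  qed
  then show ?thesis using hausdorff_measure_le[of s "f ` E" 0] by simp
qed

lemma hausdorff_measure_null_mono:
  assumes "0 \<le> t" "t \<le> s" "hausdorff_measure t E = 0"
  shows "hausdorff_measure s E = 0"
proof -
  have "hausdorff_premeasure s \<delta> E \<le> 0" if "0 < \<delta>" for \<delta>
  proof -
    \<comment> \<open>For diameters at most 1 the gauge decreases in the exponent.\<close>
    let ?d = "min \<delta> 1"
    have "hausdorff_premeasure s \<delta> E \<le> hausdorff_premeasure s ?d E"
      by (rule hausdorff_premeasure_antimono) simp
    also have "\<dots> \<le> hausdorff_premeasure t ?d E"
      unfolding hausdorff_premeasure_def
    proof (rule INF_mono)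
      fix U assume U: "U \<in> hausdorff_covers ?d E"
      show "\<exists>U'\<in>hausdorff_covers ?d E. (\<Sum>j. hausdorff_gauge s (U' j)) \<le> (\<Sum>j. hausdorff_gauge t (U j))"
      proof (intro bexI[of _ U] U, rule suminf_le)
        fix j
        have d: "0 \<le> diameter (U j)" "diameter (U j) \<le> 1"
          using U diameter_ge_0[of "U j"] by (auto simp: hausdorff_covers_def)
        show "hausdorff_gauge s (U j) \<le> hausdorff_gauge t (U j)"
          using d assms(1,2)
          by (auto simp: hausdorff_gauge_def powr_le1 intro!: ennreal_leI powr_mono')
      qed auto
    qed
    also have "\<dots> \<le> 0" using hausdorff_premeasure_le_measure[of ?d t E] assms(3) that by simp
    finally show ?thesis .
  qed
  then show ?thesis using hausdorff_measure_le[of s E 0] by simp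
qed

lemma hausdorff_dim_ge:
  assumes "0 < hausdorff_measure s E" shows "ereal s \<le> hausdorff_dim E"
  unfolding hausdorff_dim_def
proof (rule Inf_greatest, safe)
  fix t assume t: "0 \<le> t" "hausdorff_measure t E = 0"
  show "ereal s \<le> ereal t"
  proof (rule ccontr)
    assume "\<not> ?thesis"
    then have "t \<le> s" by simp
    with hausdorff_measure_null_mono[OF t(1) this t(2)] assms show False by simp
  qed
qed

lemma hausdorff_dim_le:
  assumes "0 \<le> s" "\<And>t. s < t \<Longrightarrow> hausdorff_measure t E = 0"
  shows "hausdorff_dim E \<le> ereal s"
proof (rule ereal_le_epsilon2)
  fix e :: real assume "0 < e"
  then have "hausdorff_dim E \<le> ereal (s + e)"
    unfolding hausdorff_dim_def using assms by (intro Inf_lower) auto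
  then show "hausdorff_dim E \<le> ereal s + ereal e" by simp
qed

text \<open>With exponent 0 each non-empty member of a cover has gauge 1.\<close>

lemma hausdorff_measure_0_pos:
  assumes "E \<noteq> {}" shows "1 \<le> hausdorff_measure 0 E"
proof -
  have "1 \<le> hausdorff_premeasure 0 1 E"
    unfolding hausdorff_premeasure_def
  proof (rule INF_greatest)
    fix U assume "U \<in> hausdorff_covers 1 E"
    then obtain j where "U j \<noteq> {}" using assms by (fastforce simp: hausdorff_covers_def)
    then have "1 = (\<Sum>j\<in>{j}. hausdorff_gauge 0 (U j))" by (simp add: hausdorff_gauge_def)
    also have "\<dots> \<le> (\<Sum>j. hausdorff_gauge 0 (U j))" by (rule sum_le_suminf) auto
    finally show "1 \<le> (\<Sum>j. hausdorff_gauge 0 (U j))" .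
  qed
  also have "\<dots> \<le> hausdorff_measure 0 E" by (rule hausdorff_premeasure_le_measure) simp
  finally show ?thesis .
qed

section \<open>Itineraries\<close>

text \<open>The largest element \<open>b\<close> has the form \<open>(x' + a) / n\<close> with
  \<open>x' \<le> b\<close> and \<open>a \<le> n - 1\<close>, so
  \<open>b * (n - 1) \<le> n - 1\<close>; the smallest element is treated likewise.\<close>

lemma self_similar_subset_unit:
  assumes K: "is_self_similar_set n D K" and D: "D \<subseteq> {0..int n - 1}" and n: "2 \<le> n"
  shows "K \<subseteq> {0..1}"
proof -
  have K': "K \<noteq> {}" "compact K" "K = (\<Union>a\<in>D. (\<lambda>x. (x + real_of_int a) / real n) ` K)"
    using K by (auto simp: is_self_similar_set_def)
  have dec: "\<exists>a\<in>D. \<exists>x'\<in>K. x = (x' + real_of_int a) / real n" if "x \<in> K" for x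
    using K'(3) that by blast
  obtain b where b: "b \<in> K" "\<And>x. x \<in> K \<Longrightarrow> x \<le> b"
    using compact_attains_sup[OF K'(2,1)] by blast
  obtain c where c: "c \<in> K" "\<And>x. x \<in> K \<Longrightarrow> c \<le> x"
    using compact_attains_inf[OF K'(2,1)] by blast
  have "b \<le> 1"
  proof -
    obtain a x' where a: "a \<in> D" "x' \<in> K" "b = (x' + real_of_int a) / real n" using dec[OF b(1)] by blast
    have "a \<le> int n - 1" using a(1) D by auto
    then have "real_of_int a \<le> real n - 1" by linarith
    moreover have "x' \<le> b" using b a by blast
    moreover have "b * real n = x' + real_of_int a" using a n by simp
    ultimately have "b * (real n - 1) \<le> 1 * (real n - 1)" by (simp add: algebra_simps)
    then show ?thesis using n by (subst (asm) mult_le_cancel_right_pos) auto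
  qed
  moreover have "0 \<le> c"
  proof -
    obtain a x' where a: "a \<in> D" "x' \<in> K" "c = (x' + real_of_int a) / real n" using dec[OF c(1)] by blast
    have "0 \<le> a" using a(1) D by auto
    moreover have "c \<le> x'" using c a by blast
    moreover have "c * real n = x' + real_of_int a" using a n by simp
    ultimately have "0 \<le> c * (real n - 1)" by (simp add: algebra_simps)
    then show ?thesis using n by (simp add: zero_le_mult_iff)
  qed
  ultimately show ?thesis using b(2) c(2) by force
qed

text \<open>Unfolding self-similarity along the digits puts every partial sum plus
  \<open>z / n ^ N\<close>, for \<open>z\<close> in \<open>K\<close>, into \<open>K\<close>.
  Closedness gives the limit.\<close>

lemma self_similar_digit_series:
  fixes a :: "nat \<Rightarrow> int"
  assumes K: "is_self_similar_set n D K" and D: "D \<subseteq> {0..int n - 1}" and n: "2 \<le> n"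
    and a: "\<And>j. a j \<in> D"
  shows "summable (\<lambda>j. real_of_int (a j) / real n ^ Suc j)"
    and "(\<Sum>j. real_of_int (a j) / real n ^ Suc j) \<in> K"
proof -
  let ?f = "\<lambda>j. real_of_int (a j) / real n ^ Suc j"
  have K': "K \<noteq> {}" "compact K" "K = (\<Union>a\<in>D. (\<lambda>x. (x + real_of_int a) / real n) ` K)"
    using K by (auto simp: is_self_similar_set_def)
  show sm: "summable ?f"
  proof (rule summable_comparison_test)
    show "\<exists>N. \<forall>j\<ge>N. norm (?f j) \<le> (1 / real n) ^ j"
    proof (intro exI allI impI)
      fix j
      have "0 \<le> a j" "a j \<le> int n - 1" using a[of j] D by auto
      then have "\<bar>real_of_int (a j)\<bar> \<le> real n" by linarith
      then have "\<bar>real_of_int (a j)\<bar> / real n ^ Suc j \<le> real n / real n ^ Suc j"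
        by (intro divide_right_mono) auto
      then show "norm (?f j) \<le> (1 / real n) ^ j" using n by (simp add: power_one_over)
    qed
    show "summable (\<lambda>j. (1 / real n) ^ j)" using n by (intro summable_geometric) auto
  qed
  obtain z0 where z0: "z0 \<in> K" using K'(1) by blast
  have part: "(\<Sum>j<N. ?f j) + z / real n ^ N \<in> K" if "z \<in> K" for N z
    using that
  proof (induction N arbitrary: z)
    case (Suc N)
    have "(z + real_of_int (a N)) / real n \<in> K" using K'(3) a[of N] Suc.prems by blast
    from Suc.IH[OF this] show ?case using n by (simp add: add_divide_distrib add.commute add.left_commute)
  qed simp
  have lim: "(\<lambda>N. (\<Sum>j<N. ?f j) + z0 * (1 / real n) ^ N) \<longlonglongrightarrow> (\<Sum>j. ?f j) + z0 * 0"
    using n by (intro tendsto_add summable_LIMSEQ[OF sm] tendsto_mult tendsto_const LIMSEQ_power_zero) auto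
  have mem: "(\<Sum>j<N. ?f j) + z0 * (1 / real n) ^ N \<in> K" for N
  proof -
    have "z0 * (1 / real n) ^ N = z0 / real n ^ N" by (simp add: power_one_over)
    then show ?thesis using part[OF z0, of N] by (simp only:)
  qed
  from closed_sequentially[OF compact_imp_closed[OF K'(2)] mem lim] show "(\<Sum>j. ?f j) \<in> K" by simp
qed

text \<open>The exceptional points: every endpoint of a coding interval of any level is of this
  kind, and there one point may lie in two intervals of the same level.\<close>

definition nadic :: "nat \<Rightarrow> real set" where
  "nadic n = {x. \<exists>j. \<exists>q::int. x * real n ^ j = real_of_int q}"

lemma countable_nadic:
  assumes "2 \<le> n" shows "countable (nadic n)"
proof -
  have "nadic n \<subseteq> (\<lambda>(j, q). real_of_int q / real n ^ j) ` (UNIV :: (nat \<times> int) set)"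
  proof
    fix x assume "x \<in> nadic n"
    then obtain j and q :: int where "x * real n ^ j = real_of_int q" by (auto simp: nadic_def)
    then have "x = real_of_int q / real n ^ j" using assms by (simp add: field_simps)
    then show "x \<in> (\<lambda>(j, q). real_of_int q / real n ^ j) ` (UNIV :: (nat \<times> int) set)"
      by (intro image_eqI[of _ _ "(j, q)"]) auto
  qed
  then show ?thesis by (rule countable_subset) auto
qed

text \<open>Used in contrapositive form: renormalising a point that is not n-adic never produces an
  n-adic one.\<close>

lemma nadic_shift:
  assumes "real n * x - real_of_int q \<in> nadic n" shows "x \<in> nadic n"
proof -
  obtain j r where "(real n * x - real_of_int q) * real n ^ j = real_of_int r"
    using assms by (auto simp: nadic_def)
  then have "x * real n ^ Suc j = real_of_int (r + q * int n ^ j)" by (simp add: algebra_simps)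
  then show ?thesis unfolding nadic_def by blast
qed

lemma int_nadic: "real_of_int q \<in> nadic n"
  unfolding nadic_def by (rule CollectI, rule exI[of _ 0], rule exI[of _ q]) simp

lemma not_nadic_mult_int: "x \<notin> nadic n \<Longrightarrow> real n * x \<noteq> real_of_int q"
  unfolding nadic_def by (auto dest!: spec[of _ "Suc 0"] simp: mult.commute)

section \<open>The product of the sets \<open>K k\<close>, its projection, and the integer model of
  the graph\<close>

locale digit_system =
  fixes n :: nat and A :: "'l::finite \<Rightarrow> int set" and K :: "'l \<Rightarrow> real set" and m :: "'l \<Rightarrow> int"
  assumes n2: "2 \<le> n"
    and A_sub: "A k \<subseteq> {0..int n - 1}"
    and A_ne: "A k \<noteq> {}"
    and K_self: "is_self_similar_set n (A k) (K k)"
    and m_ne: "m k \<noteq> 0"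
begin

definition dig :: "('l \<Rightarrow> int) set" where "dig = Pi UNIV A"

definition prj :: "('l \<Rightarrow> int) \<Rightarrow> int" where "prj i = (\<Sum>k\<in>UNIV. m k * i k)"

text \<open>\<open>Xi\<close> in integer form, by \<open>Xi_eq\<close>: the interval at
  \<open>u\<close> lies in the projection of cube \<open>i\<close> exactly if
  \<open>u - prj i\<close> is a type.\<close>

definition vert :: "int set" where
  "vert = {u. \<exists>!i. i \<in> dig \<and> u - prj i \<in> {m_lower m..m_upper m - 1}}"

definition code :: "int \<Rightarrow> 'l \<Rightarrow> int" where
  "code u = (THE i. i \<in> dig \<and> u - prj i \<in> {m_lower m..m_upper m - 1})"

text \<open>The condition on \<open>v div int n\<close> says that the interval at \<open>v\<close>
  lies in the working interval of the type of \<open>u\<close>, which is unique because the digit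
  vector is.\<close>

definition step :: "int \<Rightarrow> int \<Rightarrow> bool" where
  "step u v \<longleftrightarrow> u \<in> vert \<and> v \<in> vert \<and> v div int n = u - prj (code u)"

definition KK :: "(real^'l) set" where "KK = {y. \<forall>k. y $ k \<in> K k}"

definition lift :: "('l \<Rightarrow> int) \<Rightarrow> real^'l \<Rightarrow> real^'l" where
  "lift i y = (\<chi> k. (y $ k + real_of_int (i k)) / real n)"

lemma lift_nth: "lift i y $ k = (y $ k + real_of_int (i k)) / real n"
  by (simp add: lift_def)

lemma n_pos: "0 < real n" "0 < int n"
  using n2 by auto

lemma code_props: "u \<in> vert \<Longrightarrow> code u \<in> dig \<and> u - prj (code u) \<in> {m_lower m..m_upper m - 1}"
proof -
  assume "u \<in> vert"
  then have "\<exists>!i. i \<in> dig \<and> u - prj i \<in> {m_lower m..m_upper m - 1}"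
    by (simp only: vert_def mem_Collect_eq)
  from theI'[OF this] show ?thesis unfolding code_def .
qed

lemma code_eq:
  assumes "u \<in> vert" "i \<in> dig" "u - prj i \<in> {m_lower m..m_upper m - 1}"
  shows "code u = i"
proof -
  have "\<exists>!i. i \<in> dig \<and> u - prj i \<in> {m_lower m..m_upper m - 1}"
    using assms(1) by (simp only: vert_def mem_Collect_eq)
  then show ?thesis unfolding code_def by (rule the1_equality) (simp only: assms simp_thms)
qed

lemma finite_dig: "finite dig"
proof -
  have "finite (A k)" for k using A_sub finite_subset by blast
  then have "finite (PiE UNIV A)" by (intro finite_PiE) auto
  then show ?thesis by (simp add: dig_def PiE_def extensional_def)
qed

lemma finite_vert: "finite vert"
proof -
  have "vert \<subseteq> (\<lambda>(i, t). prj i + t) ` (dig \<times> {m_lower m..m_upper m - 1})"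
  proof
    fix u assume "u \<in> vert"
    from code_props[OF this]
    show "u \<in> (\<lambda>(i, t). prj i + t) ` (dig \<times> {m_lower m..m_upper m - 1})"
      by (intro image_eqI[of _ _ "(code u, u - prj (code u))"]) auto
  qed
  then show ?thesis by (rule finite_subset) (simp add: finite_dig)
qed

lemma inner_rvec: "rvec m \<bullet> y = (\<Sum>k\<in>UNIV. real_of_int (m k) * y $ k)"
  by (simp add: rvec_def inner_vec_def)

lemma inner_rvec_rvec: "rvec m \<bullet> rvec i = real_of_int (prj i)"
  by (simp add: inner_rvec prj_def) (simp add: rvec_def)

text \<open>Prefixing the digit vector \<open>i\<close> in the product undoes the renormalisation
  \<open>n * x - prj i\<close> on the line. This ties digits above to the dynamics below.\<close>

lemma inner_lift: "real n * (rvec m \<bullet> lift i y) = rvec m \<bullet> y + real_of_int (prj i)"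
proof -
  have "real n * (rvec m \<bullet> lift i y)
      = (\<Sum>k\<in>UNIV. real_of_int (m k) * y $ k + real_of_int (m k * i k))"
    unfolding inner_rvec sum_distrib_left lift_nth
    by (rule sum.cong) (use n_pos in \<open>simp_all add: field_simps\<close>)
  then show ?thesis by (simp add: inner_rvec prj_def sum.distrib)
qed

lemma lift_KK: "i \<in> dig \<Longrightarrow> y \<in> KK \<Longrightarrow> lift i y \<in> KK"
proof -
  assume i: "i \<in> dig" and y: "y \<in> KK"
  have "lift i y $ k \<in> K k" for k
  proof -
    have "K k = (\<Union>a\<in>A k. (\<lambda>x. (x + real_of_int a) / real n) ` K k)"
      using K_self[of k] by (simp add: is_self_similar_set_def)
    moreover have "i k \<in> A k" "y $ k \<in> K k" using i y by (auto simp: dig_def KK_def)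
    ultimately show ?thesis unfolding lift_nth by blast
  qed
  then show ?thesis by (simp add: KK_def)
qed

lemma KK_lift:
  assumes "y \<in> KK"
  obtains i y' where "i \<in> dig" "y' \<in> KK" "y = lift i y'"
proof -
  have "\<exists>a\<in>A k. \<exists>z\<in>K k. y $ k = (z + real_of_int a) / real n" for k
  proof -
    have "K k = (\<Union>a\<in>A k. (\<lambda>x. (x + real_of_int a) / real n) ` K k)"
      using K_self[of k] by (simp add: is_self_similar_set_def)
    moreover have "y $ k \<in> K k" using assms by (simp add: KK_def)
    ultimately show ?thesis by blast
  qed
  then obtain i z where iz: "\<And>k. i k \<in> A k" "\<And>k. z k \<in> K k" "\<And>k. y $ k = (z k + real_of_int (i k)) / real n"
    by metis
  show ?thesis
    by (rule that[of i "\<chi> k. z k"]) (use iz in \<open>auto simp: dig_def KK_def lift_nth Finite_Cartesian_Product.vec_eq_iff\<close>)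
qed

lemma lift_inj: "lift i y = lift i z \<Longrightarrow> y = z"
  using n_pos by (auto simp: Finite_Cartesian_Product.vec_eq_iff lift_nth)

lemma KK_unit: "y \<in> KK \<Longrightarrow> 0 \<le> y $ k \<and> y $ k \<le> 1"
  using self_similar_subset_unit[OF K_self A_sub n2] by (force simp: KK_def)

lemma inner_unit_bounds:
  assumes "\<And>k. 0 \<le> y $ k \<and> y $ k \<le> 1"
  shows "real_of_int (m_lower m) \<le> rvec m \<bullet> y" "rvec m \<bullet> y \<le> real_of_int (m_upper m)"
proof -
  have "real_of_int (m_lower m) = (\<Sum>k\<in>UNIV. if m k < 0 then real_of_int (m k) else 0)"
    by (simp add: m_lower_def sum.inter_filter[symmetric])
  also have "\<dots> \<le> rvec m \<bullet> y"
    unfolding inner_rvec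
  proof (rule sum_mono)
    fix k
    show "(if m k < 0 then real_of_int (m k) else 0) \<le> real_of_int (m k) * y $ k"
      using assms[of k] mult_left_mono_neg[of "y $ k" 1 "real_of_int (m k)"] by auto
  qed
  finally show "real_of_int (m_lower m) \<le> rvec m \<bullet> y" .
  have "rvec m \<bullet> y \<le> (\<Sum>k\<in>UNIV. if m k > 0 then real_of_int (m k) else 0)"
    unfolding inner_rvec
  proof (rule sum_mono)
    fix k
    show "real_of_int (m k) * y $ k \<le> (if m k > 0 then real_of_int (m k) else 0)"
      using assms[of k] mult_left_mono[of "y $ k" 1 "real_of_int (m k)"]
      by (auto simp: mult_nonpos_nonneg)
  qed
  also have "\<dots> = real_of_int (m_upper m)"
    by (simp add: m_upper_def sum.inter_filter[symmetric])
  finally show "rvec m \<bullet> y \<le> real_of_int (m_upper m)" .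
qed

lemma fibre_eq: "fibre m K x = {y \<in> KK. rvec m \<bullet> y = x}"
  by (auto simp: fibre_def KK_def)

lemma U_set_1_iff: "x \<in> U_set m K 1 \<longleftrightarrow> (\<exists>y. fibre m K x = {y})"
  unfolding U_set_def by (auto simp: card_1_singleton_iff)

text \<open>The recursion unrolls to a partial sum of the inner product plus
  \<open>X N / n ^ N\<close>; boundedness of \<open>X\<close> makes the remainder vanish.\<close>

lemma point_of_digits:
  assumes I: "\<And>j. I j \<in> dig" and X: "\<And>j. X (Suc j) = real n * X j - real_of_int (prj (I j))"
    and B: "\<And>j. \<bar>X j\<bar> \<le> B"
  obtains y where "y \<in> KK" "rvec m \<bullet> y = X 0"
proof -
  define y :: "real^'l" where "y = (\<chi> k. \<Sum>j. real_of_int (I j k) / real n ^ Suc j)"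
  have Ik: "I j k \<in> A k" for j k using I[of j] by (auto simp: dig_def)
  note ser = self_similar_digit_series[OF K_self A_sub n2, of "\<lambda>j. I j _", OF Ik]
  have yK: "y \<in> KK" using ser(2) by (simp add: KK_def y_def)
  have part: "X 0 = (\<Sum>k\<in>UNIV. real_of_int (m k) * (\<Sum>j<N. real_of_int (I j k) / real n ^ Suc j)) + X N / real n ^ N" for N
  proof (induction N)
    case (Suc N)
    have "X N / real n ^ N = (X (Suc N) + real_of_int (prj (I N))) / real n ^ Suc N"
      using n_pos X[of N] by simp
    then show ?case using Suc
      by (simp add: prj_def distrib_left sum.distrib add_divide_distrib sum_divide_distrib)
  qed simp
  have "(\<lambda>N. (\<Sum>k\<in>UNIV. real_of_int (m k) * (\<Sum>j<N. real_of_int (I j k) / real n ^ Suc j)))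
      \<longlonglongrightarrow> (\<Sum>k\<in>UNIV. real_of_int (m k) * y $ k)"
    unfolding y_def vec_lambda_beta
    by (intro tendsto_sum tendsto_mult tendsto_const summable_LIMSEQ ser(1))
  moreover have "(\<lambda>N. X N / real n ^ N) \<longlonglongrightarrow> 0"
  proof (rule Lim_null_comparison)
    show "\<forall>\<^sub>F N in sequentially. norm (X N / real n ^ N) \<le> B * (1 / real n) ^ N"
      using B n_pos by (auto simp: power_one_over divide_simps)
    have "(\<lambda>N. B * (1 / real n) ^ N) \<longlonglongrightarrow> B * 0"
      using n2 by (intro tendsto_mult tendsto_const LIMSEQ_power_zero) auto
    then show "(\<lambda>N. B * (1 / real n) ^ N) \<longlonglongrightarrow> 0" by simp
  qed
  ultimately have "(\<lambda>N. (\<Sum>k\<in>UNIV. real_of_int (m k) * (\<Sum>j<N. real_of_int (I j k) / real n ^ Suc j))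
      + X N / real n ^ N) \<longlonglongrightarrow> (\<Sum>k\<in>UNIV. real_of_int (m k) * y $ k) + 0"
    by (rule tendsto_add)
  then have "(\<lambda>N. X 0) \<longlonglongrightarrow> (\<Sum>k\<in>UNIV. real_of_int (m k) * y $ k) + 0"
    by (simp only: part[symmetric])
  then have "X 0 = rvec m \<bullet> y" by (simp add: inner_rvec LIMSEQ_const_iff)
  then show ?thesis using that yK by simp
qed

text \<open>\<open>X j\<close> is the point \<open>X 0\<close> after \<open>j\<close> renormalisations; it lies in the interval of the \<open>j\<close>-th vertex.\<close>

definition orbit :: "(nat \<Rightarrow> int) \<Rightarrow> (nat \<Rightarrow> real) \<Rightarrow> bool" where
  "orbit w X \<longleftrightarrow> (\<forall>j. step (w j) (w (Suc j)) \<and> X (Suc j) = real n * X j - real_of_int (prj (code (w j))) \<and>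
     real_of_int (w j) \<le> real n * X j \<and> real n * X j \<le> real_of_int (w j) + 1)"

definition coded_from :: "int \<Rightarrow> real set" where
  "coded_from u = {X 0 | w X. orbit w X \<and> w 0 = u}"

definition coded :: "real set" where "coded = (\<Union>u\<in>vert. coded_from u)"

lemma orbit_shift: "orbit w X \<Longrightarrow> orbit (\<lambda>j. w (Suc j)) (\<lambda>j. X (Suc j))"
  unfolding orbit_def by blast

lemma orbit_vert: "orbit w X \<Longrightarrow> w j \<in> vert"
  unfolding orbit_def step_def by blast

lemma orbit_coded: "orbit w X \<Longrightarrow> X 0 \<in> coded"
  using orbit_vert[of w X 0] unfolding coded_def coded_from_def by blast

lemma orbit_bounds:
  assumes "orbit w X"
  shows "real_of_int (m_lower m) \<le> X (Suc j)" "X (Suc j) \<le> real_of_int (m_upper m)"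
proof -
  have "w j - prj (code (w j)) \<in> {m_lower m..m_upper m - 1}"
    using code_props[OF orbit_vert[OF assms]] by blast
  then have "m_lower m \<le> w j - prj (code (w j))" "w j - prj (code (w j)) + 1 \<le> m_upper m" by auto
  then have lu: "real_of_int (m_lower m) \<le> real_of_int (w j - prj (code (w j)))"
    "real_of_int (w j - prj (code (w j)) + 1) \<le> real_of_int (m_upper m)" by linarith+
  show "real_of_int (m_lower m) \<le> X (Suc j)" "X (Suc j) \<le> real_of_int (m_upper m)"
  proof -
    have "X (Suc j) = real n * X j - real_of_int (prj (code (w j)))"
      "real_of_int (w j) \<le> real n * X j" "real n * X j \<le> real_of_int (w j) + 1"
      using assms unfolding orbit_def by blast+
    then show "real_of_int (m_lower m) \<le> X (Suc j)" "X (Suc j) \<le> real_of_int (m_upper m)"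
      using lu by simp_all
  qed
qed

text \<open>The first digit vector of any preimage is forced to be \<open>code (w 0)\<close>, and
  removing it leads to the same situation for the shifted orbit. So two preimages agree up to
  \<open>(1 / n) ^ N\<close> in each coordinate, for every \<open>N\<close>.\<close>

lemma orbit_in_U:
  assumes o: "orbit w X" and nn: "X 0 \<notin> nadic n"
  shows "X 0 \<in> U_set m K 1"
proof -
  have dist: "\<bar>y $ k - z $ k\<bar> \<le> (1 / real n) ^ N"
    if "orbit w X" "X 0 \<notin> nadic n" "y \<in> fibre m K (X 0)" "z \<in> fibre m K (X 0)" for w X y z k N
    using that
  proof (induction N arbitrary: w X y z)
    case 0
    have "0 \<le> y $ k \<and> y $ k \<le> 1" "0 \<le> z $ k \<and> z $ k \<le> 1"
      using 0 KK_unit by (auto simp: fibre_eq)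
    then show ?case by (simp add: abs_le_iff)
  next
    case (Suc N)
    note o = Suc.prems(1)
    have dec: "\<exists>y'\<in>fibre m K (X (Suc 0)). y = lift (code (w 0)) y'" if y: "y \<in> fibre m K (X 0)" for y
    proof -
      obtain i y' where iy: "i \<in> dig" "y' \<in> KK" "y = lift i y'"
        using KK_lift y by (auto simp: fibre_eq)
      have eq: "rvec m \<bullet> y' = real n * X 0 - real_of_int (prj i)"
        using inner_lift[of i y'] iy y by (simp add: fibre_eq)
      have b: "real_of_int (m_lower m) \<le> rvec m \<bullet> y'" "rvec m \<bullet> y' \<le> real_of_int (m_upper m)"
        using inner_unit_bounds KK_unit[OF iy(2)] by auto
      have w0: "real_of_int (w 0) \<le> real n * X 0" "real n * X 0 \<le> real_of_int (w 0) + 1"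
        using o by (auto simp: orbit_def)
      have ne: "real n * X 0 \<noteq> real_of_int q" for q
        using not_nadic_mult_int Suc.prems(2) by blast
      \<comment> \<open>Strictness at both ends, as \<open>X 0\<close> is not n-adic, turns the real
        bounds on the remainder into the integer range in which \<open>code\<close> is
        unique.\<close>
      have "real n * X 0 < real_of_int (w 0) + 1" using w0 ne[of "w 0 + 1"] by simp
      then have "real_of_int (m_lower m) < real_of_int (w 0 - prj i + 1)" using b eq by simp
      moreover have "real_of_int (w 0) < real n * X 0" using w0 ne[of "w 0"] by simp
      then have "real_of_int (w 0 - prj i) < real_of_int (m_upper m)" using b eq by simp
      ultimately have "w 0 - prj i \<in> {m_lower m..m_upper m - 1}"
        unfolding of_int_less_iff by auto
      with code_eq[OF orbit_vert[OF o] iy(1)] have "code (w 0) = i" by blast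
      then show ?thesis using iy eq o by (auto simp: fibre_eq orbit_def)
    qed
    obtain y' where y': "y' \<in> fibre m K (X (Suc 0))" "y = lift (code (w 0)) y'"
      using dec Suc.prems by blast
    obtain z' where z': "z' \<in> fibre m K (X (Suc 0))" "z = lift (code (w 0)) z'"
      using dec Suc.prems by blast
    have "X (Suc 0) \<notin> nadic n"
      using o Suc.prems(2) nadic_shift by (auto simp: orbit_def)
    from Suc.IH[OF orbit_shift[OF o] this y'(1) z'(1)]
    have "\<bar>y' $ k - z' $ k\<bar> / real n \<le> (1 / real n) ^ N / real n"
      using n_pos by (intro divide_right_mono) auto
    moreover have "y $ k - z $ k = (y' $ k - z' $ k) / real n"
      unfolding y' z' lift_nth by (simp add: diff_divide_distrib add_divide_distrib)
    then have "\<bar>y $ k - z $ k\<bar> = \<bar>y' $ k - z' $ k\<bar> / real n" by simp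
    ultimately show ?case by simp
  qed
  obtain y where y: "y \<in> KK" "rvec m \<bullet> y = X 0"
  proof (rule point_of_digits[of "\<lambda>j. code (w j)" X])
    show "code (w j) \<in> dig" for j using code_props orbit_vert[OF o] by blast
    show "X (Suc j) = real n * X j - real_of_int (prj (code (w j)))" for j
      using o by (simp add: orbit_def)
    show "\<bar>X j\<bar> \<le> \<bar>X 0\<bar> + \<bar>real_of_int (m_lower m)\<bar> + \<bar>real_of_int (m_upper m)\<bar>" for j
      using orbit_bounds[OF o, of "j - 1"] by (cases j) auto
  qed blast
  have "z = y" if "z \<in> fibre m K (X 0)" for z
  proof -
    have yf: "y \<in> fibre m K (X 0)" using y by (simp add: fibre_eq)
    have "z $ k = y $ k" for k
    proof (rule ccontr)
      assume "z $ k \<noteq> y $ k"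
      then obtain N where "(1 / real n) ^ N < \<bar>z $ k - y $ k\<bar>"
        using real_arch_pow_inv[of "\<bar>z $ k - y $ k\<bar>" "1 / real n"] n2 by auto
      with dist[OF o nn that yf, of k N] show False by simp
    qed
    then show ?thesis by (simp add: Finite_Cartesian_Product.vec_eq_iff)
  qed
  moreover have "y \<in> fibre m K (X 0)" using y by (simp add: fibre_eq)
  ultimately have "fibre m K (X 0) = {y}" by blast
  then show ?thesis unfolding U_set_1_iff by blast
qed

lemma coded_subset: "coded \<subseteq> U_set m K 1 \<union> nadic n"
  using orbit_in_U by (auto simp: coded_def coded_from_def)

text \<open>The remainders \<open>w j mod int n\<close> serve as n-ary digits and
  \<open>w j div int n\<close> as integer part. A step prescribes exactly the integer part of the
  next point, so these expansions obey the renormalisation.\<close>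

lemma path_orbit:
  assumes w: "\<And>j. step (w j) (w (Suc j))"
  obtains X where "orbit w X"
proof -
  define S where "S j = (\<Sum>i. real_of_int (w (j + i) mod int n) / real n ^ Suc i)" for j
  have md: "0 \<le> w j mod int n" "w j mod int n \<le> int n - 1" for j using n_pos by auto
  have mdr: "0 \<le> real_of_int (w j mod int n)" "real_of_int (w j mod int n) \<le> real n - 1" for j
    using md[of j] by linarith+
  have geo: "(\<lambda>i. (real n - 1) / real n ^ Suc i) sums 1"
  proof -
    have "(\<lambda>i. (real n - 1) / real n * (1 / real n) ^ i) sums ((real n - 1) / real n * (1 / (1 - 1 / real n)))"
      using n2 by (intro sums_mult geometric_sums) auto
    moreover have "(real n - 1) / real n * (1 / (1 - 1 / real n)) = 1"
      using n2 by (simp add: divide_simps)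
    moreover have "(\<lambda>i. (real n - 1) / real n ^ Suc i) = (\<lambda>i. (real n - 1) / real n * (1 / real n) ^ i)"
      by (auto simp: power_one_over)
    ultimately show ?thesis by (simp only:)
  qed
  have sm: "summable (\<lambda>i. real_of_int (w (j + i) mod int n) / real n ^ Suc i)" for j
    by (rule summable_comparison_test[OF _ sums_summable[OF geo]])
      (use mdr n_pos in \<open>auto intro!: exI[of _ 0] divide_right_mono\<close>)
  have S0: "0 \<le> S j" for j unfolding S_def using mdr n_pos by (intro suminf_nonneg sm) auto
  have S1: "S j \<le> 1" for j
  proof -
    have "S j \<le> (\<Sum>i. (real n - 1) / real n ^ Suc i)"
      unfolding S_def using mdr n_pos
      by (intro suminf_le sm sums_summable[OF geo] divide_right_mono) auto
    then show ?thesis using sums_unique[OF geo] by simp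
  qed
  have SS: "real n * S j = real_of_int (w j mod int n) + S (Suc j)" for j
  proof -
    have "S j = real_of_int (w j mod int n) / real n + (\<Sum>i. real_of_int (w (j + Suc i) mod int n) / real n ^ Suc (Suc i))"
      unfolding S_def using suminf_split_head[OF sm[of j]] by simp
    also have "(\<Sum>i. real_of_int (w (j + Suc i) mod int n) / real n ^ Suc (Suc i)) = S (Suc j) / real n"
      unfolding S_def using suminf_divide[OF sm[of "Suc j"], of "real n"]
      by (simp add: mult.commute)
    finally show ?thesis using n_pos by (simp add: field_simps)
  qed
  define X where "X j = real_of_int (w j div int n) + S j" for j
  have nX: "real n * X j = real_of_int (w j) + S (Suc j)" for j
  proof -
    have "real n * X j = real_of_int (int n * (w j div int n) + w j mod int n) + S (Suc j)"
      unfolding X_def distrib_left SS of_int_add of_int_mult of_int_of_nat_eq by (rule add.assoc[symmetric])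
    then show ?thesis by (simp only: mult_div_mod_eq)
  qed
  have "orbit w X"
    unfolding orbit_def
  proof (intro allI conjI)
    fix j
    show "X (Suc j) = real n * X j - real_of_int (prj (code (w j)))"
      unfolding nX using w[of j] by (simp add: X_def step_def)
  qed (use w nX S0 S1 in auto)
  then show ?thesis by (rule that)
qed

text \<open>\<open>locate w j\<close> is \<open>\<lfloor>n\<^sup>j\<^sup>+\<^sup>1 x\<rfloor>\<close> for the point \<open>x\<close> with itinerary \<open>w\<close>, unless \<open>x\<close> is \<open>n\<close>-adic.\<close>

primrec locate :: "(nat \<Rightarrow> int) \<Rightarrow> nat \<Rightarrow> int" where
  "locate w 0 = w 0"
| "locate w (Suc j) = int n * locate w j + w (Suc j) mod int n"

lemma orbit_locate:
  assumes "orbit w X"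
  shows "real n ^ Suc j * X 0 - real_of_int (locate w j) = real n * X j - real_of_int (w j)"
proof (induction j)
  case (Suc j)
  have o: "X (Suc j) = real n * X j - real_of_int (prj (code (w j)))"
    "w (Suc j) div int n = w j - prj (code (w j))"
    using assms by (auto simp: orbit_def step_def)
  have "w (Suc j) = int n * (w j - prj (code (w j))) + w (Suc j) mod int n"
    using o(2) by (metis mult_div_mod_eq)
  then have "real_of_int (w (Suc j)) = real n * (real_of_int (w j) - real_of_int (prj (code (w j)))) + real_of_int (w (Suc j) mod int n)"
    by (metis of_int_add of_int_diff of_int_mult of_int_of_nat_eq)
  moreover have "real n ^ Suc (Suc j) * X 0 - real_of_int (locate w (Suc j))
     = real n * (real n ^ Suc j * X 0 - real_of_int (locate w j)) - real_of_int (w (Suc j) mod int n)"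
    by (simp add: algebra_simps)
  ultimately show ?case unfolding Suc o(1) by (simp add: algebra_simps)
qed simp

lemma orbit_locate_bounds:
  assumes "orbit w X"
  shows "real_of_int (locate w j) \<le> real n ^ Suc j * X 0" "real n ^ Suc j * X 0 \<le> real_of_int (locate w j) + 1"
proof -
  have "real_of_int (w j) \<le> real n * X j" "real n * X j \<le> real_of_int (w j) + 1"
    using assms unfolding orbit_def by blast+
  then show "real_of_int (locate w j) \<le> real n ^ Suc j * X 0"
    "real n ^ Suc j * X 0 \<le> real_of_int (locate w j) + 1"
    using orbit_locate[OF assms, of j] by linarith+
qed

section \<open>Mass distributions and coverings\<close>

text \<open>A greedy argument in place of compactness: a cylinder with more mass than the bad cylinders
  inside it is not bad, and has a child with the same property.\<close>

lemma avoiding_path: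
  fixes \<nu> :: "nat \<Rightarrow> int \<Rightarrow> real" and a :: "nat \<Rightarrow> ennreal"
  assumes r: "0 < r" and u0: "u0 \<in> vert"
    and nu0: "\<And>k u. 0 \<le> \<nu> k u"
    and nu: "\<And>k u. u \<in> vert \<Longrightarrow> r * \<nu> k u \<le> succ_sum step vert (\<nu> (Suc k)) u"
    and bad: "\<And>i u. i \<in> G \<Longrightarrow> u \<in> vert \<Longrightarrow> ennreal (\<nu> (lev i) u / r ^ lev i) \<le> a i"
    and small: "(\<Sum>i. a i) < ennreal (\<nu> 0 u0)"
  obtains w where "w 0 = u0" "\<And>j. step (w j) (w (Suc j))"
    "\<And>i. i \<in> G \<Longrightarrow> locate w (lev i) \<noteq> pos i"
proof -
  \<comment> \<open>A weighted counting measure, so that the costs of disjoint families of bad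
    cylinders add up by \<open>sum_emeasure\<close>.\<close>
  define N where "N = density (count_space UNIV) a"
  \<comment> \<open>The bad cylinders of level at least \<open>k\<close> inside the
    level-\<open>k\<close> cylinder at position \<open>q\<close>; division by a power of
    \<open>n\<close> takes a position to that of its ancestor.\<close>
  define J where "J k q = {i \<in> G. k \<le> lev i \<and> pos i div int n ^ (lev i - k) = q}" for k q
  have NS: "sets N = UNIV" by (simp add: N_def)
  have eN: "emeasure N S = (\<Sum>i. a i * indicator S i)" for S
    unfolding N_def by (subst emeasure_density) (auto simp: nn_integral_count_space_nat)
  define P where "P k s \<longleftrightarrow> snd s \<in> vert \<and> emeasure N (J k (fst s)) < ennreal (\<nu> k (snd s) / r ^ k)
      \<and> (k = 0 \<longrightarrow> s = (u0, u0))" for k s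
  define Q where "Q s s' \<longleftrightarrow> step (snd s) (snd s') \<and> fst s' = int n * fst s + snd s' mod int n" for s s'
  have "\<exists>f. \<forall>k. P k (f k) \<and> Q (f k) (f (Suc k))"
  proof (rule dependent_nat_choice)
    have "emeasure N (J 0 u0) \<le> emeasure N UNIV" by (rule emeasure_mono) (auto simp: NS)
    also have "\<dots> = (\<Sum>i. a i)" unfolding eN by simp
    also note small
    finally show "\<exists>s. P 0 s" using u0 by (intro exI[of _ "(u0, u0)"]) (simp add: P_def)
  next
    fix s k assume "P k s"
    then obtain q u where s: "s = (q, u)" "u \<in> vert" "emeasure N (J k q) < ennreal (\<nu> k u / r ^ k)"
      by (cases s) (auto simp: P_def)
    define W where "W = {v. v \<in> vert \<and> step u v}"
    have finW: "finite W" unfolding W_def using finite_vert by simp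
    let ?q = "\<lambda>v. int n * q + v mod int n"
    have "\<exists>v\<in>W. emeasure N (J (Suc k) (?q v)) < ennreal (\<nu> (Suc k) v / r ^ Suc k)"
    proof (rule ccontr)
      assume "\<not> ?thesis"
      then have ge: "ennreal (\<nu> (Suc k) v / r ^ Suc k) \<le> emeasure N (J (Suc k) (?q v))" if "v \<in> W" for v
        using that by (auto simp: not_less)
      have "\<nu> k u / r ^ k = r * \<nu> k u / r ^ Suc k" using r by simp
      also have "\<dots> \<le> (\<Sum>v\<in>W. \<nu> (Suc k) v) / r ^ Suc k"
        using nu[OF s(2), of k] r unfolding W_def succ_sum_def by (intro divide_right_mono) auto
      finally have "\<nu> k u / r ^ k \<le> (\<Sum>v\<in>W. \<nu> (Suc k) v / r ^ Suc k)" by (simp add: sum_divide_distrib)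
      then have "ennreal (\<nu> k u / r ^ k) \<le> ennreal (\<Sum>v\<in>W. \<nu> (Suc k) v / r ^ Suc k)" by (rule ennreal_leI)
      also have "\<dots> = (\<Sum>v\<in>W. ennreal (\<nu> (Suc k) v / r ^ Suc k))"
        using nu0 r by (intro sum_ennreal[symmetric]) auto
      also have "\<dots> \<le> (\<Sum>v\<in>W. emeasure N (J (Suc k) (?q v)))" using ge by (rule sum_mono)
      also have "\<dots> = emeasure N (\<Union>v\<in>W. J (Suc k) (?q v))"
      proof (rule sum_emeasure)
        \<comment> \<open>Successors of one vertex have equal quotients by \<open>n\<close>, hence
          different remainders and different positions.\<close>
        show "disjoint_family_on (\<lambda>v. J (Suc k) (?q v)) W"
          unfolding disjoint_family_on_def
        proof (intro ballI impI)
          fix v v' assume v: "v \<in> W" "v' \<in> W" "v \<noteq> v'"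
          then have "v div int n = v' div int n" by (simp add: W_def step_def)
          with v(3) have "v mod int n \<noteq> v' mod int n" by (metis mult_div_mod_eq)
          then show "J (Suc k) (?q v) \<inter> J (Suc k) (?q v') = {}" by (auto simp: J_def)
        qed
      qed (use finW NS in auto)
      also have "\<dots> \<le> emeasure N (J k q)"
      proof (rule emeasure_mono)
        show "(\<Union>v\<in>W. J (Suc k) (?q v)) \<subseteq> J k q"
        proof safe
          fix v i assume "i \<in> J (Suc k) (?q v)"
          then have i: "i \<in> G" "Suc k \<le> lev i" "pos i div int n ^ (lev i - Suc k) = ?q v"
            by (auto simp: J_def)
          have "lev i - k = Suc (lev i - Suc k)" using i(2) by simp
          then have "pos i div int n ^ (lev i - k) = pos i div int n ^ (lev i - Suc k) div int n"
            using n_pos zdiv_zmult2_eq[of "int n" "pos i" "int n ^ (lev i - Suc k)"]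
            by (simp only: power_Suc2 less_imp_le)
          also have "\<dots> = q" unfolding i(3) using n_pos by simp
          finally show "i \<in> J k q" using i by (simp add: J_def)
        qed
      qed (simp add: NS)
      finally show False using s(3) by simp
    qed
    then obtain v where v: "v \<in> W" "emeasure N (J (Suc k) (?q v)) < ennreal (\<nu> (Suc k) v / r ^ Suc k)"
      by blast
    show "\<exists>s'. P (Suc k) s' \<and> Q s s'"
      by (rule exI[of _ "(?q v, v)"]) (use v s in \<open>auto simp: P_def Q_def W_def\<close>)
  qed
  then obtain f where f: "\<And>k. P k (f k)" "\<And>k. Q (f k) (f (Suc k))" by blast
  define w where "w j = snd (f j)" for j
  have loc: "locate w j = fst (f j)" for j
  proof (induction j)
    case 0
    show ?case using f(1)[of 0] by (simp add: P_def w_def)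
  next
    case (Suc j)
    then show ?case using f(2)[of j] by (simp add: Q_def w_def)
  qed
  show ?thesis
  proof (rule that[of w])
    show "w 0 = u0" using f(1)[of 0] by (simp add: P_def w_def)
    show "step (w j) (w (Suc j))" for j using f(2)[of j] by (simp add: Q_def w_def)
    show "locate w (lev i) \<noteq> pos i" if i: "i \<in> G" for i
    proof
      assume "locate w (lev i) = pos i"
      \<comment> \<open>A bad cylinder on the path would be counted at its own level, where its cost
        \<open>a i\<close> already reaches the full mass.\<close>
      then have "i \<in> J (lev i) (fst (f (lev i)))" using i by (simp add: J_def loc)
      then have "emeasure N {i} \<le> emeasure N (J (lev i) (fst (f (lev i))))"
        by (intro emeasure_mono) (auto simp: NS)
      also have "\<dots> < ennreal (\<nu> (lev i) (w (lev i)) / r ^ lev i)"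
        using f(1)[of "lev i"] by (simp add: P_def w_def)
      also have "\<dots> \<le> a i" using bad[OF i, of "w (lev i)"] f(1)[of "lev i"] by (simp add: P_def w_def)
      also have "a i = emeasure N {i}"
      proof -
        have "(\<Sum>j. a j * indicator {i} j) = (\<Sum>j\<in>{i}. a j * indicator {i} j)"
          by (rule suminf_finite) auto
        then show ?thesis unfolding eN by simp
      qed
      finally show False by simp
    qed
  qed
qed

section \<open>Lower bounds for the measure from mass distributions\<close>

lemma inverse_power_powr: "(1 / real n ^ k) powr t = 1 / (real n powr t) ^ k"
proof -
  have "(real n ^ k) powr t = (real n powr t) ^ k"
    using n_pos by (simp add: powr_realpow[symmetric] powr_powr mult.commute)
  then show ?thesis using n_pos by (simp add: powr_divide)
qed

text \<open>For positive \<open>d\<close>, \<open>l\<close> is least with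
  \<open>1 / n ^ (l + 2) < d\<close>; minimality gives \<open>d \<le> 1 / n ^ (l + 1)\<close>, and
  the shift by two levels produces the squared factor. The tolerance \<open>e\<close> serves
  diameter 0: the gauge vanishes there, but a deep level makes the mass small.\<close>

lemma level_for_diameter:
  assumes s: "0 < s" and B: "0 < B" and e: "0 < e" and d: "0 \<le> d" "d \<le> 1 / real n ^ Suc L"
  obtains l where "L \<le> l" "real n ^ Suc l * d \<le> 1"
    "B / (real n powr s) ^ l \<le> B * (real n powr s)\<^sup>2 * d powr s + e"
proof (cases "d = 0")
  case True
  let ?r = "real n powr s"
  have r: "1 < ?r" using n2 s by (simp add: gr_one_powr)
  then have "1 / ?r < 1" by (subst divide_less_eq_1_pos) linarith+
  from real_arch_pow_inv[OF divide_pos_pos[OF e B] this]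
  obtain N where N: "(1 / ?r) ^ N < e / B" by blast
  have "(1 / ?r) ^ max L N \<le> (1 / ?r) ^ N"
    using r less_imp_le[OF \<open>1 / ?r < 1\<close>] by (intro power_decreasing) auto
  also note N
  finally have "B / ?r ^ max L N \<le> e" using B by (simp add: power_one_over field_simps)
  then show ?thesis using that[of "max L N"] True by simp
next
  case False
  let ?r = "real n powr s"
  have r: "1 < ?r" using n2 s by (simp add: gr_one_powr)
  have d0: "0 < d" using d False by simp
  define Pd where "Pd l \<longleftrightarrow> 1 / real n ^ (l + 2) < d" for l
  obtain N where N: "(1 / real n) ^ N < d" using real_arch_pow_inv[OF d0, of "1 / real n"] n2 by auto
  have "(1 / real n) ^ (N + 2) \<le> (1 / real n) ^ N" using n2 by (intro power_decreasing) auto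
  with N have "Pd N" by (simp add: Pd_def power_one_over)
  define l where "l = (LEAST l. Pd l)"
  have Pl: "Pd l" unfolding l_def using \<open>Pd N\<close> by (rule LeastI)
  have least: "\<not> Pd l'" if "l' < l" for l' using that unfolding l_def by (rule not_less_Least)
  have Ll: "L \<le> l"
  proof (rule ccontr)
    assume "\<not> ?thesis"
    then have "l + 2 \<le> Suc L" by simp
    then have "real n ^ (l + 2) \<le> real n ^ Suc L" using n2 by (intro power_increasing) auto
    then have "1 / real n ^ Suc L \<le> 1 / real n ^ (l + 2)" using n_pos by (intro divide_left_mono) auto
    then show False using Pl d by (simp add: Pd_def)
  qed
  have "d \<le> 1 / real n ^ Suc l"
  proof (cases l)
    case 0
    then show ?thesis using Ll d by simp
  next
    case (Suc l')
    then show ?thesis using least[of l'] by (simp add: Pd_def)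
  qed
  then have "real n ^ Suc l * d \<le> 1" using n_pos by (simp add: field_simps)
  moreover have "B / ?r ^ l \<le> B * ?r\<^sup>2 * d powr s"
  proof -
    have r0: "0 < ?r" using r by linarith
    have "1 / ?r ^ (l + 2) \<le> d powr s"
      unfolding inverse_power_powr[symmetric] using Pl s n_pos
      by (intro powr_mono2) (auto simp: Pd_def)
    then have "B * ?r\<^sup>2 * (1 / ?r ^ (l + 2)) \<le> B * ?r\<^sup>2 * d powr s" using B by (intro mult_left_mono) auto
    moreover have "B * ?r\<^sup>2 * (1 / ?r ^ (l + 2)) = B / ?r ^ l"
      using r0 by (simp add: power2_eq_square)
    ultimately show ?thesis by simp
  qed
  ultimately show ?thesis using that[OF Ll] e by simp
qed

text \<open>Mass distribution: \<open>\<nu> k u / r ^ k\<close> is the mass of a cylinder of level \<open>k\<close> ending in \<open>u\<close>.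
  A set of diameter at most \<open>n\<^sup>-\<^sup>k\<^sup>-\<^sup>1\<close> meets at most four intervals of level \<open>k\<close>.\<close>

lemma coded_measure_ge:
  assumes s: "0 < s" and u0: "u0 \<in> vert"
    and nu0: "\<And>k u. 0 \<le> \<nu> k u"
    and nu: "\<And>k u. u \<in> vert \<Longrightarrow> real n powr s * \<nu> k u \<le> succ_sum step vert (\<nu> (Suc k)) u"
    and B: "0 < B" "\<And>k u. L \<le> k \<Longrightarrow> u \<in> vert \<Longrightarrow> \<nu> k u \<le> B"
  shows "ennreal (\<nu> 0 u0 / (4 * B * (real n powr s)\<^sup>2)) \<le> hausdorff_measure s coded"
proof -
  let ?r = "real n powr s"
  have r: "1 < ?r" using n2 s by (simp add: gr_one_powr)
  \<comment> \<open>Four cylinders for each set, each of mass at most \<open>B / ?r ^ l\<close>,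
    which \<open>level_for_diameter\<close> compares with the gauge.\<close>
  define c where "c = 4 * B * ?r\<^sup>2"
  have "0 < ?r" using r by linarith
  then have c: "0 < c" unfolding c_def using B(1) by (intro mult_pos_pos zero_less_power) auto
  define \<delta> where "\<delta> = 1 / real n ^ Suc L"
  have \<delta>: "0 < \<delta>" using n_pos by (simp add: \<delta>_def)
  have "ennreal (\<nu> 0 u0 / c) \<le> hausdorff_premeasure s \<delta> coded"
    unfolding hausdorff_premeasure_def
  proof (rule INF_greatest)
    fix U assume U: "U \<in> hausdorff_covers \<delta> coded"
    show "ennreal (\<nu> 0 u0 / c) \<le> (\<Sum>j. hausdorff_gauge s (U j))"
    proof (rule ccontr)
      assume "\<not> ?thesis"
      then have lt: "(\<Sum>j. hausdorff_gauge s (U j)) < ennreal (\<nu> 0 u0 / c)" by simp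
      then obtain g where g: "0 \<le> g" "(\<Sum>j. hausdorff_gauge s (U j)) = ennreal g"
        by (cases "\<Sum>j. hausdorff_gauge s (U j)") auto
      then have "g < \<nu> 0 u0 / c" using lt by (simp add: ennreal_less_iff)
      then have cg: "c * g < \<nu> 0 u0" using c by (simp add: field_simps)
      \<comment> \<open>Half of the spare mass, to be split over the sets of the cover and, for each
        set, over four cylinders.\<close>
      define e where "e = (\<nu> 0 u0 - c * g) / 2"
      have e: "0 < e" using cg by (simp add: e_def)
      define d where "d j = diameter (U j)" for j
      have bU: "bounded (U j)" for j using U by (simp add: hausdorff_covers_def)
      have d: "0 \<le> d j" "d j \<le> 1 / real n ^ Suc L" for j
        using U diameter_ge_0[OF bU] by (auto simp: d_def hausdorff_covers_def \<delta>_def)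
      have gauge: "hausdorff_gauge s (U j) = ennreal (d j powr s)" for j
        using s by (simp add: hausdorff_gauge_def d_def)
      have "\<exists>l. L \<le> l \<and> real n ^ Suc l * d j \<le> 1 \<and>
        B / ?r ^ l \<le> B * ?r\<^sup>2 * d j powr s + e / 4 * (1 / 2) ^ Suc j" for j
        using level_for_diameter[OF s B(1), of "e / 4 * (1 / 2) ^ Suc j" "d j" L] e d[of j] by auto
      then obtain l where l: "\<And>j. L \<le> l j" "\<And>j. real n ^ Suc (l j) * d j \<le> 1"
        "\<And>j. B / ?r ^ l j \<le> B * ?r\<^sup>2 * d j powr s + e / 4 * (1 / 2) ^ Suc j" by metis
      \<comment> \<open>For an empty \<open>U j\<close> the point is arbitrary; its four cylinders
        are merely avoided in addition.\<close>
      define x0 where "x0 j = (SOME x. x \<in> U j)" for j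
      define f where "f j = \<lfloor>real n ^ Suc (l j) * x0 j\<rfloor>" for j
      define a where "a i = (case prod_decode i of (j, c) \<Rightarrow> if c < 4 then ennreal (B / ?r ^ l j) else 0)" for i
      define lev where "lev i = l (fst (prod_decode i))" for i
      \<comment> \<open>The positions run from \<open>f j - 2\<close> to \<open>f j + 1\<close>,
        which are those of all closed intervals that can contain a point within one unit of
        \<open>x0 j\<close> at this scale.\<close>
      define pos where "pos i = f (fst (prod_decode i)) - 2 + int (snd (prod_decode i))" for i
      define G where "G = {i. snd (prod_decode i) < 4}"
      have "(\<Sum>i. a i) = (\<Sum>i. (\<lambda>(j, c). if c < 4 then ennreal (B / ?r ^ l j) else 0) (prod_decode i))"
        by (simp add: a_def)
      also have "\<dots> = (\<Sum>j. \<Sum>c. if c < (4::nat) then ennreal (B / ?r ^ l j) else 0)"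
        by (rule suminf_ennreal_2dimen) simp
      also have "\<dots> = (\<Sum>j. ennreal (4 * (B / ?r ^ l j)))"
      proof (rule suminf_cong)
        fix j
        have "(\<Sum>c. if c < (4::nat) then ennreal (B / ?r ^ l j) else 0)
            = (\<Sum>c<4. if c < (4::nat) then ennreal (B / ?r ^ l j) else 0)"
          by (rule suminf_finite) auto
        also have "\<dots> = 4 * ennreal (B / ?r ^ l j)" by simp
        finally show "(\<Sum>c. if c < (4::nat) then ennreal (B / ?r ^ l j) else 0) = ennreal (4 * (B / ?r ^ l j))"
          using B(1) r by (subst ennreal_mult) auto
      qed
      also have "\<dots> \<le> (\<Sum>j. ennreal c * ennreal (d j powr s) + ennreal (e * (1 / 2) ^ Suc j))"
      proof (rule suminf_le)
        fix j
        have "4 * (B / ?r ^ l j) \<le> c * d j powr s + e * (1 / 2) ^ Suc j"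
          using l(3)[of j] by (simp add: c_def)
        then have "ennreal (4 * (B / ?r ^ l j)) \<le> ennreal (c * d j powr s + e * (1 / 2) ^ Suc j)"
          by (rule ennreal_leI)
        also have "\<dots> = ennreal c * ennreal (d j powr s) + ennreal (e * (1 / 2) ^ Suc j)"
          using c e by (simp add: ennreal_plus ennreal_mult)
        finally show "ennreal (4 * (B / ?r ^ l j)) \<le> ennreal c * ennreal (d j powr s) + ennreal (e * (1 / 2) ^ Suc j)" .
      qed auto
      also have "\<dots> = (\<Sum>j. ennreal c * ennreal (d j powr s)) + (\<Sum>j. ennreal (e * (1 / 2) ^ Suc j))"
        by (rule suminf_add[symmetric]) auto
      also have "(\<Sum>j. ennreal (e * (1 / 2) ^ Suc j)) = ennreal e"
      proof (rule suminf_ennreal_eq)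
        show "(\<lambda>i. e * (1/2) ^ Suc i) sums e" using sums_mult[OF power_half_series, of e] by simp
      qed (use e in auto)
      also have "(\<Sum>j. ennreal c * ennreal (d j powr s)) = ennreal c * ennreal g"
        using g(2) unfolding gauge by simp
      also have "ennreal c * ennreal g + ennreal e = ennreal (c * g + e)"
        using c g(1) e by (simp add: ennreal_plus ennreal_mult)
      also have "\<dots> < ennreal (\<nu> 0 u0)"
      proof (subst ennreal_less_iff)
        have "0 \<le> c * g" using c g(1) by simp
        then show "0 \<le> c * g + e" using e by linarith
        show "c * g + e < \<nu> 0 u0" using cg by (simp add: e_def field_simps)
      qed
      finally have small: "(\<Sum>i. a i) < ennreal (\<nu> 0 u0)" .
      have rpos: "0 < ?r" using r by linarith
      have bad: "ennreal (\<nu> (lev i) u / ?r ^ lev i) \<le> a i" if "i \<in> G" "u \<in> vert" for i u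
      proof -
        have "\<nu> (lev i) u / ?r ^ lev i \<le> B / ?r ^ lev i"
          using B(2)[of "lev i" u] that(2) l(1) rpos by (intro divide_right_mono) (auto simp: lev_def)
        then show ?thesis
          using \<open>i \<in> G\<close> by (simp add: a_def lev_def G_def split_beta ennreal_leI)
      qed
      obtain w where w: "w 0 = u0" "\<And>j. step (w j) (w (Suc j))"
        "\<And>i. i \<in> G \<Longrightarrow> locate w (lev i) \<noteq> pos i"
        using avoiding_path[where G = G and lev = lev and pos = pos, OF rpos u0 nu0 nu bad small] by blast
      obtain X where X: "orbit w X" using path_orbit w(2) by blast
      have "X 0 \<in> coded" by (rule orbit_coded[OF X])
      then obtain j where j: "X 0 \<in> U j" using U by (auto simp: hausdorff_covers_def)
      then have "x0 j \<in> U j" unfolding x0_def by (rule someI)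
      then have "\<bar>X 0 - x0 j\<bar> \<le> d j"
        using diameter_bounded_bound[OF bU j, of "x0 j"] by (simp add: d_def dist_real_def)
      then have "real n ^ Suc (l j) * \<bar>X 0 - x0 j\<bar> \<le> real n ^ Suc (l j) * d j"
        using n_pos by (intro mult_left_mono) auto
      also note l(2)[of j]
      also have "real n ^ Suc (l j) * \<bar>X 0 - x0 j\<bar> = \<bar>real n ^ Suc (l j) * X 0 - real n ^ Suc (l j) * x0 j\<bar>"
        by (simp add: abs_mult right_diff_distrib[symmetric] del: power_Suc)
      finally have near: "\<bar>real n ^ Suc (l j) * X 0 - real n ^ Suc (l j) * x0 j\<bar> \<le> 1" .
      have fl: "real_of_int (f j) \<le> real n ^ Suc (l j) * x0 j" "real n ^ Suc (l j) * x0 j < real_of_int (f j) + 1"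
        unfolding f_def by linarith+
      have "real_of_int (locate w (l j)) < real_of_int (f j + 2)"
        using orbit_locate_bounds(1)[OF X, of "l j"] near fl by simp
      moreover have "real_of_int (f j - 2) \<le> real_of_int (locate w (l j))"
        using orbit_locate_bounds(2)[OF X, of "l j"] near fl by simp
      ultimately have "locate w (l j) < f j + 2" "f j - 2 \<le> locate w (l j)"
        unfolding of_int_less_iff of_int_le_iff by auto
      then have cc: "nat (locate w (l j) - (f j - 2)) < 4"
        "locate w (l j) = f j - 2 + int (nat (locate w (l j) - (f j - 2)))" by auto
      then show False
        using w(3)[of "prod_encode (j, nat (locate w (l j) - (f j - 2)))"]
        by (simp add: G_def lev_def pos_def)
    qed
  qed
  also have "\<dots> \<le> hausdorff_measure s coded" by (rule hausdorff_premeasure_le_measure[OF \<delta>])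
  finally show ?thesis by (simp add: c_def)
qed

lemma coded_measure_le_U:
  assumes "0 < s" shows "hausdorff_measure s coded \<le> hausdorff_measure s (U_set m K 1)"
proof -
  have "hausdorff_measure s coded \<le> hausdorff_measure s (U_set m K 1 \<union> nadic n)"
    by (rule hausdorff_measure_mono[OF coded_subset])
  also have "\<dots> \<le> hausdorff_measure s (U_set m K 1) + hausdorff_measure s (nadic n)"
    by (rule hausdorff_measure_Un)
  finally show ?thesis using hausdorff_measure_countable[OF assms countable_nadic[OF n2]] by simp
qed

text \<open>Renormalisation sends the points with first vertex \<open>u\<close> to points that start
  at successors of \<open>u\<close>; its inverse carries their covers back, shrunk by
  \<open>n\<close>. The level is \<open>Suc k\<close> because a path without edges already fixes an
  interval of length \<open>1 / n\<close>.\<close>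

lemma coded_from_cover:
  assumes "u \<in> vert"
  shows "\<exists>P. finite P \<and> real (card P) \<le> ((succ_sum step vert) ^^ k) (\<lambda>_. 1) u \<and>
    (\<forall>x\<in>coded_from u. \<exists>a\<in>P. a \<le> x \<and> x \<le> a + 1 / real n ^ Suc k)"
  using assms
proof (induction k arbitrary: u)
  case 0
  have "\<exists>a\<in>{real_of_int u / real n}. a \<le> x \<and> x \<le> a + 1 / real n ^ Suc 0" if x: "x \<in> coded_from u" for x
  proof -
    obtain w X where "orbit w X" "w 0 = u" "x = X 0" using x by (auto simp: coded_from_def)
    then have "real_of_int u \<le> real n * x" "real n * x \<le> real_of_int u + 1" by (auto simp: orbit_def)
    then show ?thesis using n_pos by (simp add: field_simps)
  qed
  then show ?case by (intro exI[of _ "{real_of_int u / real n}"]) simp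
next
  case (Suc k)
  define W where "W = {v. v \<in> vert \<and> step u v}"
  have finW: "finite W" unfolding W_def using finite_vert by simp
  have "\<forall>v\<in>W. \<exists>P. finite P \<and> real (card P) \<le> ((succ_sum step vert) ^^ k) (\<lambda>_. 1) v \<and>
    (\<forall>x\<in>coded_from v. \<exists>a\<in>P. a \<le> x \<and> x \<le> a + 1 / real n ^ Suc k)"
    using Suc.IH by (auto simp: W_def)
  from bchoice[OF this] obtain P where P: "\<And>v. v \<in> W \<Longrightarrow> finite (P v)"
    "\<And>v. v \<in> W \<Longrightarrow> real (card (P v)) \<le> ((succ_sum step vert) ^^ k) (\<lambda>_. 1) v"
    "\<And>v x. v \<in> W \<Longrightarrow> x \<in> coded_from v \<Longrightarrow> \<exists>a\<in>P v. a \<le> x \<and> x \<le> a + 1 / real n ^ Suc k"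
    by blast
  let ?g = "\<lambda>a. (a + real_of_int (prj (code u))) / real n"
  define R where "R = (\<Union>v\<in>W. ?g ` P v)"
  have "real (card R) \<le> (\<Sum>v\<in>W. real (card (P v)))"
  proof -
    have "card R \<le> (\<Sum>v\<in>W. card (?g ` P v))" unfolding R_def using finW by (rule card_UN_le)
    also have "\<dots> \<le> (\<Sum>v\<in>W. card (P v))" using P(1) by (intro sum_mono card_image_le) auto
    finally show ?thesis unfolding of_nat_sum[symmetric] of_nat_le_iff .
  qed
  also have "\<dots> \<le> (\<Sum>v\<in>W. ((succ_sum step vert) ^^ k) (\<lambda>_. 1) v)" using P(2) by (rule sum_mono)
  also have "\<dots> = ((succ_sum step vert) ^^ Suc k) (\<lambda>_. 1) u"
    by (simp add: succ_sum_def[of step vert "((succ_sum step vert) ^^ k) (\<lambda>_. 1)"] W_def)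
  finally have card: "real (card R) \<le> ((succ_sum step vert) ^^ Suc k) (\<lambda>_. 1) u" .
  have cov: "\<exists>b\<in>R. b \<le> x \<and> x \<le> b + 1 / real n ^ Suc (Suc k)" if x: "x \<in> coded_from u" for x
  proof -
    obtain w X where wX: "orbit w X" "w 0 = u" "x = X 0" using x by (auto simp: coded_from_def)
    have v: "w (Suc 0) \<in> W"
      using wX orbit_vert[OF wX(1)] unfolding W_def orbit_def by auto
    have "X (Suc 0) \<in> coded_from (w (Suc 0))"
      unfolding coded_from_def mem_Collect_eq
      by (rule exI[of _ "\<lambda>j. w (Suc j)"], rule exI[of _ "\<lambda>j. X (Suc j)"])
        (simp add: orbit_shift[OF wX(1)])
    from P(3)[OF v this] obtain a where a: "a \<in> P (w (Suc 0))" "a \<le> X (Suc 0)"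
      "X (Suc 0) \<le> a + 1 / real n ^ Suc k" by blast
    have "X (Suc 0) = real n * x - real_of_int (prj (code u))" using wX by (auto simp: orbit_def)
    then have xe: "x = ?g (X (Suc 0))" using n_pos by simp
    have "?g a \<le> x" unfolding xe using a n_pos by (intro divide_right_mono) auto
    moreover have "x \<le> (a + 1 / real n ^ Suc k + real_of_int (prj (code u))) / real n"
      unfolding xe using a n_pos by (intro divide_right_mono) auto
    moreover have "(a + 1 / real n ^ Suc k + real_of_int (prj (code u))) / real n
        = ?g a + 1 / real n ^ Suc (Suc k)"
      by (simp add: add_divide_distrib)
    ultimately show ?thesis using a(1) v unfolding R_def by (intro bexI[of _ "?g a"]) auto
  qed
  have "finite R" unfolding R_def using finW P(1) by auto
  with card cov show ?case by blast
qed

lemma coded_premeasure_le: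
  assumes t: "0 < t" and k: "1 / real n ^ Suc k \<le> \<delta>"
    and bd: "\<And>u. u \<in> vert \<Longrightarrow> ((succ_sum step vert) ^^ k) (\<lambda>_. 1) u \<le> c * r ^ k"
  shows "hausdorff_premeasure t \<delta> coded \<le> ennreal (real (card vert) * c * (r / real n powr t) ^ k)"
proof -
  let ?l = "1 / real n ^ Suc k"
  have "\<forall>u\<in>vert. \<exists>P. finite P \<and> real (card P) \<le> ((succ_sum step vert) ^^ k) (\<lambda>_. 1) u \<and>
    (\<forall>x\<in>coded_from u. \<exists>a\<in>P. a \<le> x \<and> x \<le> a + 1 / real n ^ Suc k)"
    using coded_from_cover by blast
  from bchoice[OF this] obtain P where P: "\<And>v. v \<in> vert \<Longrightarrow> finite (P v)"
    "\<And>v. v \<in> vert \<Longrightarrow> real (card (P v)) \<le> ((succ_sum step vert) ^^ k) (\<lambda>_. 1) v"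
    "\<And>v x. v \<in> vert \<Longrightarrow> x \<in> coded_from v \<Longrightarrow> \<exists>a\<in>P v. a \<le> x \<and> x \<le> a + ?l" by blast
  define F where "F = (\<Union>v\<in>vert. (\<lambda>a. {a..a + ?l}) ` P v)"
  have finF: "finite F" unfolding F_def using finite_vert P(1) by auto
  have l0: "0 < ?l" using n_pos by simp
  have "card F \<le> (\<Sum>v\<in>vert. card ((\<lambda>a. {a..a + ?l}) ` P v))"
    unfolding F_def using finite_vert by (rule card_UN_le)
  also have "\<dots> \<le> (\<Sum>v\<in>vert. card (P v))" using P(1) by (intro sum_mono card_image_le) auto
  finally have "real (card F) \<le> (\<Sum>v\<in>vert. real (card (P v)))"
    unfolding of_nat_sum[symmetric] of_nat_le_iff .
  also have "\<dots> \<le> (\<Sum>v\<in>vert. c * r ^ k)" using P(2) bd by (intro sum_mono) (blast intro: order_trans)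
  finally have cardF: "real (card F) \<le> real (card vert) * c * r ^ k" by simp
  have np: "1 \<le> real n powr t" using n2 t by (simp add: ge_one_powr_ge_zero)
  have gl: "?l powr t \<le> 1 / (real n powr t) ^ k"
  proof -
    have "(real n powr t) ^ k \<le> (real n powr t) ^ Suc k" using np by (intro power_increasing) auto
    moreover have "0 < real n powr t" using np by linarith
    ultimately show ?thesis unfolding inverse_power_powr by (intro divide_left_mono mult_pos_pos) auto
  qed
  have "hausdorff_premeasure t \<delta> coded \<le> of_nat (card F) * ennreal (?l powr t)"
  proof (rule hausdorff_premeasure_finite_cover[OF finF])
    show "coded \<subseteq> \<Union>F"
    proof
      fix x assume "x \<in> coded"
      then obtain u where u: "u \<in> vert" "x \<in> coded_from u" by (auto simp: coded_def)
      from P(3)[OF this] obtain a where "a \<in> P u" "a \<le> x" "x \<le> a + ?l" by blast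
      then show "x \<in> \<Union>F" using u(1) unfolding F_def by (intro UnionI[of "{a..a + ?l}"]) auto
    qed
    show "0 \<le> \<delta>" using l0 k by linarith
    fix U assume "U \<in> F"
    then obtain a where U: "U = {a..a + ?l}" by (auto simp: F_def)
    have dU: "diameter U = ?l" unfolding U using l0 by (subst diameter_closed_interval) auto
    have ne: "U \<noteq> {}" unfolding U using l0 by simp
    show "bounded U \<and> diameter U \<le> \<delta> \<and> hausdorff_gauge t U \<le> ennreal (?l powr t)"
    proof (intro conjI)
      show "bounded U" unfolding U by simp
      show "diameter U \<le> \<delta>" unfolding dU by (rule k)
      show "hausdorff_gauge t U \<le> ennreal (?l powr t)"
        unfolding hausdorff_gauge_def dU using ne t by simp
    qed
  qed
  also have "\<dots> = ennreal (real (card F) * ?l powr t)"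
    by (subst ennreal_mult) (auto simp: ennreal_of_nat_eq_real_of_nat)
  also have "\<dots> \<le> ennreal (real (card vert) * c * r ^ k * (1 / (real n powr t) ^ k))"
    using cardF gl by (intro ennreal_leI mult_mono) auto
  finally show ?thesis by (simp add: power_divide)
qed

lemma small_level:
  assumes "0 < \<delta>" shows "\<exists>N. \<forall>k\<ge>N. 1 / real n ^ Suc k \<le> \<delta>"
proof -
  obtain N where N: "(1 / real n) ^ N < \<delta>" using real_arch_pow_inv[OF assms, of "1 / real n"] n2 by auto
  have "1 / real n ^ Suc k \<le> \<delta>" if "N \<le> k" for k
  proof -
    have "(1 / real n) ^ Suc k \<le> (1 / real n) ^ N" using that n2 by (intro power_decreasing) auto
    then show ?thesis using N by (simp add: power_one_over)
  qed
  then show ?thesis by blast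
qed

lemma coded_measure_le:
  assumes t: "0 < t" and r: "0 \<le> r" "r \<le> real n powr t" and c: "0 \<le> c"
    and bd: "\<And>k u. u \<in> vert \<Longrightarrow> ((succ_sum step vert) ^^ k) (\<lambda>_. 1) u \<le> c * r ^ k"
  shows "hausdorff_measure t coded \<le> ennreal (real (card vert) * c)"
proof (rule hausdorff_measure_le)
  fix \<delta> :: real assume "0 < \<delta>"
  then obtain k where k: "1 / real n ^ Suc k \<le> \<delta>" using small_level by blast
  have "(r / real n powr t) ^ k \<le> 1" using r n_pos by (intro power_le_one) auto
  then have "real (card vert) * c * (r / real n powr t) ^ k \<le> real (card vert) * c * 1"
    using c by (intro mult_left_mono) auto
  then have "ennreal (real (card vert) * c * (r / real n powr t) ^ k) \<le> ennreal (real (card vert) * c)"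
    by (intro ennreal_leI) simp
  with coded_premeasure_le[OF t k bd]
  show "hausdorff_premeasure t \<delta> coded \<le> ennreal (real (card vert) * c)" by (rule order_trans)
qed

lemma coded_measure_null:
  assumes t: "0 < t" and r: "0 \<le> r" "r < real n powr t"
    and bd: "\<And>k u. u \<in> vert \<Longrightarrow> ((succ_sum step vert) ^^ k) (\<lambda>_. 1) u \<le> c * r ^ k"
  shows "hausdorff_measure t coded = 0"
proof -
  have "hausdorff_premeasure t \<delta> coded \<le> 0" if \<delta>: "0 < \<delta>" for \<delta>
  proof (rule LIMSEQ_le_const)
    let ?q = "r / real n powr t"
    have "(\<lambda>k. real (card vert) * c * ?q ^ k) \<longlonglongrightarrow> real (card vert) * c * 0"
      using r n_pos by (intro tendsto_mult tendsto_const LIMSEQ_power_zero) auto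
    from tendsto_ennrealI[OF this]
    show "(\<lambda>k. ennreal (real (card vert) * c * ?q ^ k)) \<longlonglongrightarrow> 0" by simp
    show "\<exists>N. \<forall>k\<ge>N. hausdorff_premeasure t \<delta> coded \<le> ennreal (real (card vert) * c * ?q ^ k)"
      using small_level[OF \<delta>] coded_premeasure_le[OF t _ bd] by blast
  qed
  then have "hausdorff_measure t coded \<le> 0" by (rule hausdorff_measure_le)
  then show ?thesis by simp
qed

section \<open>The covering condition\<close>

lemma m_lower_less_upper: "m_lower m < m_upper m"
proof -
  have "(\<Sum>k\<in>UNIV. if m k < 0 then m k else 0) < (\<Sum>k\<in>UNIV. if 0 < m k then m k else 0)"
    using m_ne by (intro sum_strict_mono) (auto simp: not_less order_le_less)
  then show ?thesis by (simp add: m_lower_def m_upper_def sum.inter_filter[symmetric])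
qed

lemma cube_proj_eq:
  "cube_proj n m i = {x. real n * x - real_of_int (prj i) \<in> {real_of_int (m_lower m)..real_of_int (m_upper m)}}"
proof -
  have pr: "real n * (rvec m \<bullet> ((1 / real n) *\<^sub>R (rvec i + y))) = real_of_int (prj i) + rvec m \<bullet> y" for y
    using n_pos by (simp add: inner_add_right inner_rvec_rvec)
  have unit: "0 \<le> y $ k \<and> y $ k \<le> 1" if "y \<in> cbox 0 1" for y :: "real^'l" and k
    using that by (simp add: mem_box_cart)
  show ?thesis
  proof (intro equalityI subsetI)
    fix x assume "x \<in> cube_proj n m i"
    then obtain y :: "real^'l" where y: "y \<in> cbox 0 1" "x = rvec m \<bullet> ((1 / real n) *\<^sub>R (rvec i + y))"
      by (auto simp: cube_proj_def cube_def)
    then have "real n * x - real_of_int (prj i) = rvec m \<bullet> y" using pr[of y] by simp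
    then show "x \<in> {x. real n * x - real_of_int (prj i) \<in> {real_of_int (m_lower m)..real_of_int (m_upper m)}}"
      using inner_unit_bounds[OF unit[OF y(1)]] by simp
  next
    fix x assume "x \<in> {x. real n * x - real_of_int (prj i) \<in> {real_of_int (m_lower m)..real_of_int (m_upper m)}}"
    then have x: "real_of_int (m_lower m) \<le> real n * x - real_of_int (prj i)"
      "real n * x - real_of_int (prj i) \<le> real_of_int (m_upper m)" by auto
    let ?d = "real_of_int (m_upper m) - real_of_int (m_lower m)"
    have d: "0 < ?d" using m_lower_less_upper by simp
    define l where "l = (real n * x - real_of_int (prj i) - real_of_int (m_lower m)) / ?d"
    have l: "0 \<le> l" "l \<le> 1" using x d by (auto simp: l_def)
    \<comment> \<open>The point at parameter \<open>l\<close> on the diagonal from the corner with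
      inner product \<open>m_lower m\<close> to the one with \<open>m_upper m\<close>.\<close>
    define y :: "real^'l" where "y = (\<chi> k. if 0 < m k then l else 1 - l)"
    have y: "y \<in> cbox 0 1" using l by (simp add: y_def mem_box_cart)
    have "rvec m \<bullet> y = (\<Sum>k\<in>UNIV. l * (if 0 < m k then real_of_int (m k) else 0)
        + (1 - l) * (if m k < 0 then real_of_int (m k) else 0))"
      unfolding inner_rvec using m_ne by (intro sum.cong) (auto simp: y_def not_less order_le_less)
    also have "\<dots> = l * real_of_int (m_upper m) + (1 - l) * real_of_int (m_lower m)"
      by (simp add: sum.distrib sum_distrib_left[symmetric] m_lower_def m_upper_def sum.inter_filter[symmetric])
    also have "\<dots> = l * ?d + real_of_int (m_lower m)" by (simp add: algebra_simps)
    also have "l * ?d = real n * x - real_of_int (prj i) - real_of_int (m_lower m)"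
      unfolding l_def using d by simp
    finally have "rvec m \<bullet> y = real n * x - real_of_int (prj i)" by simp
    then have "real n * (rvec m \<bullet> ((1 / real n) *\<^sub>R (rvec i + y))) = real n * x" using pr[of y] by simp
    then have "x = rvec m \<bullet> ((1 / real n) *\<^sub>R (rvec i + y))" using n_pos by (metis mult_cancel_left less_irrefl)
    then show "x \<in> cube_proj n m i" using y unfolding cube_proj_def cube_def by blast
  qed
qed

text \<open>The covering condition offers at every point of the interval a digit vector whose
  renormalisation stays in the interval. Iteration gives a bounded orbit, which comes from a point
  of the product.\<close>

lemma projection_onto:
  assumes cov: "covering_condition n A m"
    and x: "real_of_int (m_lower m) \<le> x" "x \<le> real_of_int (m_upper m)"
  obtains y where "y \<in> KK" "rvec m \<bullet> y = x"
proof -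
  let ?T = "{real_of_int (m_lower m)..real_of_int (m_upper m)}"
  have "\<exists>i\<in>dig. real n * z - real_of_int (prj i) \<in> ?T" if "z \<in> ?T" for z
  proof -
    have "z \<in> (\<Union>i\<in>Pi UNIV A. cube_proj n m i)" using cov that by (simp add: covering_condition_def)
    then show ?thesis unfolding cube_proj_eq dig_def by blast
  qed
  then obtain I where I: "\<And>z. z \<in> ?T \<Longrightarrow> I z \<in> dig" "\<And>z. z \<in> ?T \<Longrightarrow> real n * z - real_of_int (prj (I z)) \<in> ?T"
    by metis
  define X where "X j = ((\<lambda>z. real n * z - real_of_int (prj (I z))) ^^ j) x" for j
  have XT: "X j \<in> ?T" for j
  proof (induction j)
    case 0
    show ?case using x by (simp add: X_def)
  next
    case (Suc j)
    from I(2)[OF this] show ?case by (simp add: X_def)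
  qed
  show ?thesis
  proof (rule point_of_digits[of "\<lambda>j. I (X j)" X])
    show "I (X j) \<in> dig" for j using I(1) XT by blast
    show "X (Suc j) = real n * X j - real_of_int (prj (I (X j)))" for j by (simp add: X_def)
    show "\<bar>X j\<bar> \<le> \<bar>real_of_int (m_lower m)\<bar> + \<bar>real_of_int (m_upper m)\<bar>" for j
      using XT[of j] by auto
    show ?thesis if "y \<in> KK" "rvec m \<bullet> y = X 0" for y
      using \<open>\<And>y. y \<in> KK \<Longrightarrow> rvec m \<bullet> y = x \<Longrightarrow> thesis\<close>[OF that(1)] that(2) by (simp add: X_def)
  qed
qed

text \<open>\<open>lift i\<close> embeds the fibre over the renormalised point into the fibre over
  \<open>x\<close>, so uniqueness survives the shift.\<close>

lemma fibre_shift: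
  assumes "fibre m K x = {lift i y}" "i \<in> dig" "y \<in> KK"
  shows "fibre m K (real n * x - real_of_int (prj i)) = {y}"
proof -
  have eq: "rvec m \<bullet> lift i z = x \<longleftrightarrow> rvec m \<bullet> z = real n * x - real_of_int (prj i)" for z
    using inner_lift[of i z] n_pos
    by (smt (verit) mult_cancel_left)
  have "lift i y \<in> fibre m K x" using assms(1) by simp
  then have "rvec m \<bullet> y = real n * x - real_of_int (prj i)" using eq by (simp add: fibre_eq)
  moreover have "z = y" if "z \<in> fibre m K (real n * x - real_of_int (prj i))" for z
  proof -
    have "lift i z \<in> fibre m K x"
      using that eq lift_KK[OF assms(2)] by (simp add: fibre_eq)
    then show ?thesis using assms(1) lift_inj by auto
  qed
  moreover have "y \<in> fibre m K (real n * x - real_of_int (prj i))"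
    using assms(3) calculation(1) by (simp add: fibre_eq)
  ultimately show ?thesis by blast
qed

text \<open>The predicate \<open>gd\<close> abstracts from the reason why the first digits of a point are unique:
  strong separation, or that no coordinate is a proper \<open>n\<close>-adic fraction.\<close>

lemma coded_of_unique:
  assumes cov: "covering_condition n A m"
    and gd: "\<And>k z z' z'' a b. gd k z \<Longrightarrow> a \<in> A k \<Longrightarrow> b \<in> A k \<Longrightarrow> z' \<in> K k \<Longrightarrow> z'' \<in> K k \<Longrightarrow>
      z = (z' + real_of_int a) / real n \<Longrightarrow> z = (z'' + real_of_int b) / real n \<Longrightarrow> a = b \<and> gd k z'"
    and x: "x \<notin> nadic n" "fibre m K x = {y}" "\<And>k. gd k (y $ k)"
  shows "x \<in> coded"
proof -
  define P where "P x \<longleftrightarrow> x \<notin> nadic n \<and> (\<exists>y. fibre m K x = {y} \<and> (\<forall>k. gd k (y $ k)))" for x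
  define g where "g x = real n * x - real_of_int (prj (code \<lfloor>real n * x\<rfloor>))" for x
  have main: "\<lfloor>real n * x\<rfloor> \<in> vert \<and> P (g x)" if Px: "P x" for x
  proof -
    obtain y where y: "x \<notin> nadic n" "fibre m K x = {y}" "\<And>k. gd k (y $ k)" using Px by (auto simp: P_def)
    then have yK: "y \<in> KK" "rvec m \<bullet> y = x" by (auto simp: fibre_eq)
    obtain i y' where iy: "i \<in> dig" "y' \<in> KK" "y = lift i y'" using KK_lift[OF yK(1)] by blast
    let ?x' = "real n * x - real_of_int (prj i)"
    have nn: "?x' \<notin> nadic n" using nadic_shift y(1) by blast
    have f': "fibre m K ?x' = {y'}" using fibre_shift y(2) iy by simp
    have fl: "\<lfloor>?x'\<rfloor> = \<lfloor>real n * x\<rfloor> - prj i" by simp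
    have "rvec m \<bullet> y' = ?x'" using f' by (auto simp: fibre_eq)
    then have b: "real_of_int (m_lower m) \<le> ?x'" "?x' \<le> real_of_int (m_upper m)"
      using inner_unit_bounds[of y'] KK_unit[OF iy(2)] by auto
    have "?x' \<noteq> real_of_int (m_upper m)" using nn int_nadic by metis
    with b have t: "\<lfloor>real n * x\<rfloor> - prj i \<in> {m_lower m..m_upper m - 1}"
    proof -
      have "m_lower m \<le> \<lfloor>?x'\<rfloor>" unfolding le_floor_iff by (rule b(1))
      moreover have "\<lfloor>?x'\<rfloor> < m_upper m"
        unfolding floor_less_iff using b(2) \<open>?x' \<noteq> real_of_int (m_upper m)\<close> by linarith
      ultimately show ?thesis unfolding fl by auto
    qed
    \<comment> \<open>By the covering condition an admissible \<open>i'\<close> begins some preimage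
      of \<open>x\<close>. That preimage is \<open>y\<close>, and by \<open>gd\<close> the first
      digits of \<open>y\<close> are unique.\<close>
    have uniq: "i' = i" if i': "i' \<in> dig" "\<lfloor>real n * x\<rfloor> - prj i' \<in> {m_lower m..m_upper m - 1}" for i'
    proof -
      let ?z = "real n * x - real_of_int (prj i')"
      have fl': "\<lfloor>?z\<rfloor> = \<lfloor>real n * x\<rfloor> - prj i'" by simp
      have "m_lower m \<le> \<lfloor>?z\<rfloor>" "\<lfloor>?z\<rfloor> < m_upper m" using i'(2) unfolding fl' by auto
      then have "real_of_int (m_lower m) \<le> ?z" "?z \<le> real_of_int (m_upper m)"
        by (simp_all only: le_floor_iff floor_less_iff less_imp_le)
      then obtain y'' where y'': "y'' \<in> KK" "rvec m \<bullet> y'' = ?z" using projection_onto[OF cov] by blast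
      have "real n * (rvec m \<bullet> lift i' y'') = real n * x" using inner_lift[of i' y''] y''(2) by simp
      then have "rvec m \<bullet> lift i' y'' = x" using n_pos by (metis mult_cancel_left less_irrefl)
      then have "lift i' y'' \<in> fibre m K x" using lift_KK[OF i'(1) y''(1)] by (simp add: fibre_eq)
      then have "lift i' y'' = y" using y(2) by simp
      have "i' k = i k" for k
      proof -
        have "y $ k = (y'' $ k + real_of_int (i' k)) / real n" "y $ k = (y' $ k + real_of_int (i k)) / real n"
          using \<open>lift i' y'' = y\<close> iy(3) lift_nth by metis+
        then show ?thesis
          using gd[OF y(3)[of k], of "i' k" "i k" "y'' $ k" "y' $ k"] i'(1) iy(1,2) y''(1)
          by (auto simp: dig_def KK_def)
      qed
      then show ?thesis by (rule ext)
    qed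
    have v: "\<lfloor>real n * x\<rfloor> \<in> vert"
      unfolding vert_def mem_Collect_eq
      by (rule ex1I[of _ i]) (use iy(1) t uniq in blast)+
    have ci: "code \<lfloor>real n * x\<rfloor> = i" using code_eq[OF v iy(1) t] .
    have "gd k (y' $ k)" for k
    proof -
      have "y $ k = (y' $ k + real_of_int (i k)) / real n" unfolding iy(3) by (rule lift_nth)
      then show ?thesis
        using gd[OF y(3)[of k], of "i k" "i k" "y' $ k" "y' $ k"] iy(1,2)
        by (auto simp: dig_def KK_def)
    qed
    then show ?thesis using v nn f' unfolding P_def g_def ci by blast
  qed
  define X where "X j = (g ^^ j) x" for j
  have PX: "P (X j)" for j
  proof (induction j)
    case 0
    show ?case using x unfolding X_def P_def by auto
  next
    case (Suc j)
    then show ?case using main by (simp add: X_def)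
  qed
  define w where "w j = \<lfloor>real n * X j\<rfloor>" for j
  have XS: "X (Suc j) = real n * X j - real_of_int (prj (code (w j)))" for j
    by (simp add: X_def g_def w_def)
  have wv: "w j \<in> vert" for j using main PX by (simp add: w_def)
  have st: "step (w j) (w (Suc j))" for j
  proof -
    have "w (Suc j) div int n = \<lfloor>real n * X (Suc j) / real_of_int (int n)\<rfloor>"
      unfolding w_def by (rule floor_divide_real_eq_div[symmetric]) simp
    also have "\<dots> = \<lfloor>X (Suc j)\<rfloor>" using n_pos by simp
    also have "\<dots> = w j - prj (code (w j))" unfolding XS by (simp add: w_def)
    finally show ?thesis using wv by (simp add: step_def)
  qed
  have "orbit w X"
    unfolding orbit_def
  proof (intro allI conjI st XS)
    show "real_of_int (w j) \<le> real n * X j" "real n * X j \<le> real_of_int (w j) + 1" for j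
      unfolding w_def by linarith+
  qed
  from orbit_coded[OF this] show ?thesis by (simp add: X_def)
qed

text \<open>Two decompositions of one coordinate have digits that differ by at most 1, as the
  remainders lie in the unit interval; strong separation excludes the difference 1.\<close>

lemma U_subset_coded:
  assumes cov: "covering_condition n A m" and sep: "\<And>k. strong_separation (A k)"
  shows "U_set m K 1 \<subseteq> coded \<union> nadic n"
proof
  fix x assume "x \<in> U_set m K 1"
  then obtain y where y: "fibre m K x = {y}"
    unfolding U_set_1_iff by blast
  have "x \<in> coded" if "x \<notin> nadic n"
  proof (rule coded_of_unique[OF cov _ that y, of "\<lambda>_ _. True"])
    fix k z z' z'' a b
    assume ab: "a \<in> A k" "b \<in> A k" "z' \<in> K k" "z'' \<in> K k"
      "z = (z' + real_of_int a) / real n" "z = (z'' + real_of_int b) / real n"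
    have u: "0 \<le> z' \<and> z' \<le> 1" "0 \<le> z'' \<and> z'' \<le> 1"
      using self_similar_subset_unit[OF K_self A_sub n2] ab by fastforce+
    have "z' + real_of_int a = z'' + real_of_int b" using ab n_pos by simp
    then have "\<bar>real_of_int (a - b)\<bar> \<le> 1" using u unfolding of_int_diff by linarith
    then have "\<bar>a - b\<bar> \<le> 1" by linarith
    moreover have "a' - b' \<noteq> 1" if "a' \<in> A k" "b' \<in> A k" for a' b'
    proof
      assume "a' - b' = 1"
      then have "1 \<in> {a - b |a b. a \<in> A k \<and> b \<in> A k}" using that by (metis (mono_tags, lifting) mem_Collect_eq)
      with sep[of k] show False by (simp only: strong_separation_def not_True_eq_False)
    qed
    from this[OF ab(1,2)] this[OF ab(2,1)] have "a - b \<noteq> 1" "b - a \<noteq> 1" by auto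
    ultimately show "a = b \<and> True" by auto
  qed simp
  then show "x \<in> coded \<union> nadic n" by blast
qed

text \<open>\<open>fibre_shift\<close> iterated, with the record that each coordinate is multiplied
  by \<open>n ^ j\<close> modulo integers, whichever digits occurred.\<close>

lemma unique_shift:
  assumes x: "x \<notin> nadic n" "fibre m K x = {y}"
  obtains p :: int and y' where "real n ^ j * x - real_of_int p \<notin> nadic n"
    "fibre m K (real n ^ j * x - real_of_int p) = {y'}"
    "\<And>k. \<exists>q::int. y' $ k = real n ^ j * y $ k - real_of_int q"
proof -
  have "\<exists>(p::int) y'. real n ^ j * x - real_of_int p \<notin> nadic n \<and>
    fibre m K (real n ^ j * x - real_of_int p) = {y'} \<and>
    (\<forall>k. \<exists>q::int. y' $ k = real n ^ j * y $ k - real_of_int q)"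
  proof (induction j)
    case 0
    show ?case using x by (intro exI[of _ 0] exI[of _ y]) (auto intro!: exI[of _ 0])
  next
    case (Suc j)
    then obtain p :: int and y' where p: "real n ^ j * x - real_of_int p \<notin> nadic n"
      "fibre m K (real n ^ j * x - real_of_int p) = {y'}"
      "\<And>k. \<exists>q::int. y' $ k = real n ^ j * y $ k - real_of_int q" by blast
    let ?x = "real n ^ j * x - real_of_int p"
    have "y' \<in> KK" using p(2) by (auto simp: fibre_eq)
    then obtain i z where iz: "i \<in> dig" "z \<in> KK" "y' = lift i z" by (rule KK_lift)
    have eq: "real n * ?x - real_of_int (prj i) = real n ^ Suc j * x - real_of_int (int n * p + prj i)"
      by (simp add: algebra_simps)
    have "real n * ?x - real_of_int (prj i) \<notin> nadic n" using nadic_shift p(1) by blast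
    moreover have "fibre m K (real n * ?x - real_of_int (prj i)) = {z}"
      using fibre_shift p(2) iz by simp
    moreover have "\<exists>q::int. z $ k = real n ^ Suc j * y $ k - real_of_int q" for k
    proof -
      obtain q :: int where q: "y' $ k = real n ^ j * y $ k - real_of_int q" using p(3) by blast
      have "y' $ k = (z $ k + real_of_int (i k)) / real n" unfolding iz(3) by (rule lift_nth)
      then have "z $ k = real n * y' $ k - real_of_int (i k)" using n_pos by simp
      also have "\<dots> = real n ^ Suc j * y $ k - real_of_int (int n * q + i k)"
        unfolding q by (simp add: algebra_simps)
      finally show ?thesis by blast
    qed
    ultimately show ?case unfolding eq by blast
  qed
  then show ?thesis using that by blast
qed

lemma U_subset_shifts:
  assumes cov: "covering_condition n A m" and x: "x \<in> U_set m K 1" "x \<notin> nadic n"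
  shows "\<exists>j. \<exists>p::int. real n ^ j * x - real_of_int p \<in> coded"
proof -
  obtain y where y: "fibre m K x = {y}" using x unfolding U_set_1_iff by blast
  have "\<forall>k. \<exists>j. y $ k \<in> nadic n \<longrightarrow> (\<exists>q::int. y $ k * real n ^ j = real_of_int q)"
    by (auto simp: nadic_def)
  then obtain jj where jj: "\<And>k. y $ k \<in> nadic n \<Longrightarrow> \<exists>q::int. y $ k * real n ^ jj k = real_of_int q" by metis
  \<comment> \<open>One shift serves all coordinates: the n-adic ones become integers, hence 0 or 1,
    and the others never become n-adic.\<close>
  define j where "j = Max (range jj)"
  have jle: "jj k \<le> j" for k unfolding j_def by (rule Max_ge) auto
  obtain p :: int and y' where p: "real n ^ j * x - real_of_int p \<notin> nadic n"
    "fibre m K (real n ^ j * x - real_of_int p) = {y'}"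
    "\<And>k. \<exists>q::int. y' $ k = real n ^ j * y $ k - real_of_int q"
    using unique_shift[OF x(2) y, of j] by blast
  \<comment> \<open>Each alternative fixes the first digit (0, \<open>n - 1\<close>, or the unique
    one off the n-adic points) and holds again for the remainder, as \<open>coded_of_unique\<close>
    requires.\<close>
  let ?gd = "\<lambda>(k::'l) z. z = 0 \<or> z = 1 \<or> z \<notin> nadic n"
  have y'K: "y' \<in> KK" using p(2) by (auto simp: fibre_eq)
  have gdy: "?gd k (y' $ k)" for k
  proof (cases "y $ k \<in> nadic n")
    case True
    obtain q :: int where q: "y $ k * real n ^ jj k = real_of_int q" using jj[OF True] by blast
    have "real n ^ j = real n ^ jj k * real n ^ (j - jj k)" using jle[of k] by (simp add: power_add[symmetric])
    then have "real n ^ j * y $ k = real_of_int q * real n ^ (j - jj k)"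
      using q by (metis mult.assoc mult.commute)
    also have "\<dots> = real_of_int (q * int n ^ (j - jj k))" by simp
    finally obtain r :: int where r: "y' $ k = real_of_int r"
      using p(3)[of k] by (metis of_int_diff)
    then have "0 \<le> r" "r \<le> 1" using KK_unit[OF y'K, of k] by auto
    then have "r = 0 \<or> r = 1" by auto
    then show ?thesis using r by auto
  next
    case False
    have "y' $ k \<notin> nadic n"
    proof
      assume "y' $ k \<in> nadic n"
      then obtain l and r :: int where lr: "y' $ k * real n ^ l = real_of_int r" by (auto simp: nadic_def)
      obtain q :: int where q: "y' $ k = real n ^ j * y $ k - real_of_int q" using p(3) by blast
      have "y $ k * real n ^ (j + l) = real_of_int (r + q * int n ^ l)"
        using lr unfolding q by (simp add: algebra_simps power_add)
      then show False using False unfolding nadic_def by blast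
    qed
    then show ?thesis by simp
  qed
  have "real n ^ j * x - real_of_int p \<in> coded"
  proof (rule coded_of_unique[OF cov _ p(1,2), of ?gd])
    show "?gd k (y' $ k)" for k by (rule gdy)
    fix k z z' z'' a b
    assume g: "?gd k z" and ab: "a \<in> A k" "b \<in> A k" "z' \<in> K k" "z'' \<in> K k"
      "z = (z' + real_of_int a) / real n" "z = (z'' + real_of_int b) / real n"
    have u: "0 \<le> z' \<and> z' \<le> 1" "0 \<le> z'' \<and> z'' \<le> 1"
      using self_similar_subset_unit[OF K_self A_sub n2] ab by fastforce+
    have abn: "0 \<le> a" "a \<le> int n - 1" "0 \<le> b" "b \<le> int n - 1" using A_sub ab(1,2) by fastforce+
    then have abr: "0 \<le> real_of_int a" "real_of_int a \<le> real n - 1"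
      "0 \<le> real_of_int b" "real_of_int b \<le> real n - 1" by linarith+
    have e: "real n * z = z' + real_of_int a" "real n * z = z'' + real_of_int b" using ab n_pos by simp_all
    consider "z = 0" | "z = 1" | "z \<notin> nadic n" using g by blast
    then show "a = b \<and> ?gd k z'"
    proof cases
      case 1
      then have "z' = 0" "real_of_int a = 0" "real_of_int b = 0" using e u abr by auto
      then show ?thesis by simp
    next
      case 2
      then have "z' = 1" "real_of_int a = real n - 1" "real_of_int b = real n - 1" using e u abr by auto
      then show ?thesis by simp
    next
      case 3
      have "real n * z - real_of_int a \<notin> nadic n" "real n * z - real_of_int b \<notin> nadic n"
        using 3 nadic_shift by blast+
      moreover have "real n * z - real_of_int a = z'" "real n * z - real_of_int b = z''" using e by simp_all
      ultimately have nn: "z' \<notin> nadic n" "z'' \<notin> nadic n" by (simp_all only: not_False_eq_True)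
      then have "z' \<noteq> real_of_int 0" "z' \<noteq> real_of_int 1" "z'' \<noteq> real_of_int 0" "z'' \<noteq> real_of_int 1"
        using int_nadic by metis+
      then have "\<bar>real_of_int (a - b)\<bar> < 1" using e u unfolding of_int_diff by auto
      then have "a = b" by linarith
      then show ?thesis using nn by simp
    qed
  qed
  then show ?thesis by blast
qed

lemma U_measure_null:
  assumes cov: "covering_condition n A m" and t: "0 < t" and null: "hausdorff_measure t coded = 0"
  shows "hausdorff_measure t (U_set m K 1) = 0"
proof -
  define S where "S i = (case from_nat i :: nat \<times> int of (j, p) \<Rightarrow>
    (\<lambda>z. (z + real_of_int p) / real n ^ j) ` coded)" for i :: nat
  have "hausdorff_measure t (S i) = 0" for i
  proof -
    obtain j p where jp: "(from_nat i :: nat \<times> int) = (j, p)" by fastforce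
    have "1 \<le> real n ^ j" using n2 by simp
    then have "dist ((z + real_of_int p) / real n ^ j) ((z' + real_of_int p) / real n ^ j) \<le> dist z z'" for z z'
      unfolding dist_real_def diff_divide_distrib[symmetric] abs_divide
      by (simp add: divide_le_eq mult_left_le mult_le_cancel_left1)
    then have "hausdorff_measure t ((\<lambda>z. (z + real_of_int p) / real n ^ j) ` coded) = 0"
      by (rule hausdorff_measure_contraction_null[OF _ _ null]) (use t in simp)
    then show ?thesis by (simp only: S_def jp prod.case)
  qed
  then have N: "hausdorff_measure t (\<Union>i. S i) = 0" by (rule hausdorff_measure_UN_null)
  have "U_set m K 1 \<subseteq> (\<Union>i. S i) \<union> nadic n"
  proof
    fix x assume x: "x \<in> U_set m K 1"
    show "x \<in> (\<Union>i. S i) \<union> nadic n"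
    proof (cases "x \<in> nadic n")
      case False
      obtain j and p :: int where jp: "real n ^ j * x - real_of_int p \<in> coded"
        using U_subset_shifts[OF cov x False] by blast
      have "x = (real n ^ j * x - real_of_int p + real_of_int p) / real n ^ j" using n_pos by simp
      with jp have "x \<in> S (to_nat (j, p))"
        by (simp only: S_def from_nat_to_nat prod.case) (rule image_eqI)
      then show ?thesis by blast
    qed simp
  qed
  then have "hausdorff_measure t (U_set m K 1) \<le> hausdorff_measure t ((\<Union>i. S i) \<union> nadic n)"
    by (rule hausdorff_measure_mono)
  also have "\<dots> \<le> hausdorff_measure t (\<Union>i. S i) + hausdorff_measure t (nadic n)"
    by (rule hausdorff_measure_Un)
  finally show ?thesis using N hausdorff_measure_countable[OF t countable_nadic[OF n2]] by simp
qed

text \<open>In every coordinate take the end of \<open>K k\<close> that maximises the term with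
  \<open>m k\<close>. The projection attains its maximum over the product only there, since no
  \<open>m k\<close> vanishes.\<close>

lemma U_nonempty: "U_set m K 1 \<noteq> {}"
proof -
  have K': "K k \<noteq> {}" "compact (K k)" for k using K_self[of k] by (auto simp: is_self_similar_set_def)
  have "\<exists>c\<in>K k. \<forall>z\<in>K k. real_of_int (m k) * z \<le> real_of_int (m k) * c" for k
  proof (cases "0 < m k")
    case True
    then show ?thesis using compact_attains_sup[OF K'(2,1)[of k]] by (auto intro!: mult_left_mono)
  next
    case False
    then show ?thesis using compact_attains_inf[OF K'(2,1)[of k]] by (auto intro!: mult_left_mono_neg)
  qed
  then obtain c where c: "\<And>k. c k \<in> K k" "\<And>k z. z \<in> K k \<Longrightarrow> real_of_int (m k) * z \<le> real_of_int (m k) * c k"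
    by metis
  define y :: "real^'l" where "y = (\<chi> k. c k)"
  have y: "y \<in> KK" using c(1) by (simp add: KK_def y_def)
  have "z = y" if z: "z \<in> fibre m K (rvec m \<bullet> y)" for z
  proof -
    have zK: "z $ k \<in> K k" for k using z by (auto simp: fibre_eq KK_def)
    have le: "0 \<le> real_of_int (m k) * y $ k - real_of_int (m k) * z $ k" for k
      using c(2)[OF zK] by (simp add: y_def)
    have "(\<Sum>k\<in>UNIV. real_of_int (m k) * y $ k - real_of_int (m k) * z $ k) = 0"
      using z by (simp add: fibre_eq inner_rvec sum_subtractf)
    then have "\<forall>k\<in>UNIV. real_of_int (m k) * y $ k - real_of_int (m k) * z $ k = 0"
      using le by (subst (asm) sum_nonneg_eq_0_iff) auto
    then have "z $ k = y $ k" for k using m_ne[of k] by auto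
    then show ?thesis by (simp add: Finite_Cartesian_Product.vec_eq_iff)
  qed
  then have "fibre m K (rvec m \<bullet> y) = {y}" using y by (auto simp: fibre_eq)
  then show ?thesis using U_set_1_iff by blast
qed

text \<open>Take the last unit interval in the projected cube whose digit vector \<open>c\<close>
  maximises \<open>prj\<close>. Any cube projection containing it has \<open>prj i\<close> at least
  \<open>prj c\<close>, hence the same digits. This makes \<open>spec_rad\<close>
  meaningful.\<close>

lemma vert_nonempty: "vert \<noteq> {}"
proof -
  have "\<exists>c\<in>A k. \<forall>z\<in>A k. m k * z \<le> m k * c" for k
  proof -
    have fin: "finite (A k)" using A_sub finite_subset by blast
    show ?thesis
    proof (cases "0 < m k")
      case True
      then show ?thesis using Max_in[OF fin A_ne] Max_ge[OF fin] by (auto intro!: bexI[of _ "Max (A k)"] mult_left_mono)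
    next
      case False
      then show ?thesis using Min_in[OF fin A_ne] Min_le[OF fin] by (auto intro!: bexI[of _ "Min (A k)"] mult_left_mono_neg)
    qed
  qed
  then obtain c where c: "\<And>k. c k \<in> A k" "\<And>k z. z \<in> A k \<Longrightarrow> m k * z \<le> m k * c k" by metis
  have cd: "c \<in> dig" using c(1) by (simp add: dig_def)
  have "i = c" if i: "i \<in> dig" "prj c + m_upper m - 1 - prj i \<in> {m_lower m..m_upper m - 1}" for i
  proof
    fix k
    have le: "0 \<le> m k * c k - m k * i k" for k using c(2)[of "i k" k] i(1) by (auto simp: dig_def)
    have "(\<Sum>k\<in>UNIV. m k * c k - m k * i k) \<le> 0" using i(2) by (simp add: prj_def sum_subtractf)
    then have "(\<Sum>k\<in>UNIV. m k * c k - m k * i k) = 0" using le by (simp add: sum_nonneg order_antisym)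
    then have "\<forall>k\<in>UNIV. m k * c k - m k * i k = 0"
      using le by (subst (asm) sum_nonneg_eq_0_iff) auto
    then show "i k = c k" using m_ne[of k] by auto
  qed
  then have "prj c + m_upper m - 1 \<in> vert"
    unfolding vert_def using cd m_lower_less_upper by (intro CollectI ex1I[of _ c]) auto
  then show ?thesis by blast
qed

section \<open>The graph of integer intervals\<close>

lemma unit_interval_at_mult:
  "unit_interval_at n u = {x. real_of_int u \<le> real n * x \<and> real n * x \<le> real_of_int u + 1}"
  using n_pos by (auto simp: unit_interval_at_def pos_divide_le_eq pos_le_divide_eq mult.commute)

lemma unit_interval_at_endpoints:
  "real_of_int u / real n \<in> unit_interval_at n u" "(real_of_int u + 1) / real n \<in> unit_interval_at n u"
  using n_pos by (auto simp: unit_interval_at_mult)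

lemma inj_unit_interval_at: "inj (unit_interval_at n)"
proof (rule injI)
  fix u v assume eq: "unit_interval_at n u = unit_interval_at n v"
  have "real_of_int v \<le> real_of_int u"
    using unit_interval_at_endpoints(1)[of u] n_pos unfolding eq by (simp add: unit_interval_at_mult)
  moreover have "real_of_int u \<le> real_of_int v"
    using unit_interval_at_endpoints(1)[of v] n_pos unfolding eq[symmetric] by (simp add: unit_interval_at_mult)
  ultimately show "u = v" by simp
qed

lemma unit_interval_subset_cube_proj:
  "unit_interval_at n u \<subseteq> cube_proj n m i \<longleftrightarrow> u - prj i \<in> {m_lower m..m_upper m - 1}"
proof
  assume sub: "unit_interval_at n u \<subseteq> cube_proj n m i"
  have "real_of_int u / real n \<in> cube_proj n m i" "(real_of_int u + 1) / real n \<in> cube_proj n m i"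
    using sub unit_interval_at_endpoints by blast+
  then have "real_of_int (m_lower m) \<le> real_of_int (u - prj i)"
    "real_of_int (u - prj i + 1) \<le> real_of_int (m_upper m)"
    using n_pos by (auto simp: cube_proj_eq)
  then show "u - prj i \<in> {m_lower m..m_upper m - 1}" unfolding of_int_le_iff by auto
next
  assume "u - prj i \<in> {m_lower m..m_upper m - 1}"
  then have "m_lower m \<le> u - prj i" "u - prj i + 1 \<le> m_upper m" by auto
  then have "real_of_int (m_lower m) \<le> real_of_int (u - prj i)"
    "real_of_int (u - prj i + 1) \<le> real_of_int (m_upper m)" unfolding of_int_le_iff by auto
  then show "unit_interval_at n u \<subseteq> cube_proj n m i"
    by (auto simp: cube_proj_eq unit_interval_at_mult)
qed

text \<open>Makes membership of a vertex in \<open>integer_intervals\<close> automatic.\<close>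

lemma cube_proj_bounds:
  assumes "i \<in> dig"
  shows "cube_proj n m i \<subseteq> {real_of_int (m_lower m)..real_of_int (m_upper m)}"
proof
  fix x assume "x \<in> cube_proj n m i"
  then obtain y :: "real^'l" where y: "y \<in> cbox 0 1" "x = rvec m \<bullet> ((1 / real n) *\<^sub>R (rvec i + y))"
    by (auto simp: cube_proj_def cube_def)
  have "0 \<le> ((1 / real n) *\<^sub>R (rvec i + y)) $ k \<and> ((1 / real n) *\<^sub>R (rvec i + y)) $ k \<le> 1" for k
  proof -
    have "i k \<in> A k" using assms by (auto simp: dig_def)
    then have "0 \<le> i k" "i k \<le> int n - 1" using A_sub by fastforce+
    then have "0 \<le> real_of_int (i k)" "real_of_int (i k) \<le> real n - 1" by linarith+
    moreover have "0 \<le> y $ k" "y $ k \<le> 1" using y(1) by (simp_all add: mem_box_cart)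
    moreover have "((1 / real n) *\<^sub>R (rvec i + y)) $ k = (real_of_int (i k) + y $ k) / real n"
      by (simp add: rvec_def)
    ultimately show ?thesis using n_pos by (simp add: divide_le_eq)
  qed
  from inner_unit_bounds[OF this] show "x \<in> {real_of_int (m_lower m)..real_of_int (m_upper m)}"
    using y(2) by simp
qed

lemma Xi_eq: "Xi n A m = unit_interval_at n ` vert"
proof (intro equalityI subsetI)
  fix I assume I: "I \<in> Xi n A m"
  then obtain u where u: "I = unit_interval_at n u" by (auto simp: Xi_def integer_intervals_def)
  have "\<exists>!i. i \<in> dig \<and> unit_interval_at n u \<subseteq> cube_proj n m i"
    using I unfolding Xi_def u dig_def by simp
  then have "u \<in> vert" unfolding vert_def mem_Collect_eq unit_interval_subset_cube_proj .
  then show "I \<in> unit_interval_at n ` vert" using u by blast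
next
  fix I assume "I \<in> unit_interval_at n ` vert"
  then obtain u where u: "u \<in> vert" "I = unit_interval_at n u" by blast
  have "I \<subseteq> cube_proj n m (code u)"
    unfolding u(2) unit_interval_subset_cube_proj using code_props[OF u(1)] by blast
  then have "I \<in> integer_intervals n m"
    using cube_proj_bounds code_props[OF u(1)] u(2) unfolding integer_intervals_def by blast
  moreover have "\<exists>!i. i \<in> Pi UNIV A \<and> I \<subseteq> cube_proj n m i"
    using u(1) unfolding u(2) vert_def mem_Collect_eq dig_def[symmetric] unit_interval_subset_cube_proj .
  ultimately show "I \<in> Xi n A m" by (simp add: Xi_def)
qed

lemma bij_vert: "bij_betw (unit_interval_at n) vert (Xi n A m)"
  unfolding Xi_eq bij_betw_def using inj_unit_interval_at by (auto intro: inj_on_subset)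

lemma unit_interval_subset_working:
  "unit_interval_at n v \<subseteq> working_interval t \<longleftrightarrow> v div int n = t"
proof
  assume sub: "unit_interval_at n v \<subseteq> working_interval t"
  have "real_of_int v / real n \<in> working_interval t" "(real_of_int v + 1) / real n \<in> working_interval t"
    using sub unit_interval_at_endpoints by blast+
  then have "real_of_int (t * int n) \<le> real_of_int v" "real_of_int (v + 1) \<le> real_of_int (t * int n + int n)"
    using n_pos by (auto simp: working_interval_def pos_le_divide_eq pos_divide_le_eq distrib_right)
  then have "t * int n \<le> v" "v < (t + 1) * int n" unfolding of_int_le_iff by (auto simp: distrib_right)
  then show "v div int n = t"
    by (intro int_div_pos_eq[of _ _ _ "v - t * int n"]) (auto simp: algebra_simps)
next
  assume t: "v div int n = t"
  have "v = t * int n + v mod int n" using t div_mult_mod_eq[of v "int n"] by simp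
  moreover have "0 \<le> v mod int n" "v mod int n < int n" using n_pos by auto
  ultimately have "t * int n \<le> v" "v + 1 \<le> (t + 1) * int n" by (auto simp: distrib_right)
  then have r: "real_of_int (t * int n) \<le> real_of_int v" "real_of_int (v + 1) \<le> real_of_int ((t + 1) * int n)"
    unfolding of_int_le_iff .
  show "unit_interval_at n v \<subseteq> working_interval t"
  proof
    fix x assume "x \<in> unit_interval_at n v"
    then have x: "real_of_int v \<le> real n * x" "real n * x \<le> real_of_int v + 1"
      by (auto simp: unit_interval_at_mult)
    have r': "real n * real_of_int t \<le> real_of_int v" "real_of_int v + 1 \<le> real n * (real_of_int t + 1)"
      using r by (simp_all add: mult.commute)
    from r'(1) x(1) have "real n * real_of_int t \<le> real n * x" by (rule order_trans)
    moreover from x(2) r'(2) have "real n * x \<le> real n * (real_of_int t + 1)" by (rule order_trans)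
    ultimately show "x \<in> working_interval t" using n_pos by (simp add: working_interval_def)
  qed
qed

lemma has_type_iff:
  assumes "u \<in> vert"
  shows "has_type n A m (unit_interval_at n u) t \<longleftrightarrow> t = u - prj (code u)"
proof -
  have r: "real_of_int u' - rvec m \<bullet> rvec i = real_of_int t \<longleftrightarrow> u' - prj i = t" for u' i
    unfolding inner_rvec_rvec of_int_diff[symmetric] of_int_eq_iff ..
  have "(\<exists>u'. unit_interval_at n u = unit_interval_at n u' \<and> (\<exists>i\<in>dig. u' - prj i = t))
      \<longleftrightarrow> (\<exists>i\<in>dig. u - prj i = t)"
    using inj_unit_interval_at by (auto dest: injD)
  then have "has_type n A m (unit_interval_at n u) t \<longleftrightarrow>
      t \<in> {m_lower m..m_upper m - 1} \<and> (\<exists>i\<in>dig. u - prj i = t)"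
    unfolding has_type_def r dig_def[symmetric] by simp
  then show ?thesis using code_props[OF assms] code_eq[OF assms] by blast
qed

lemma interval_step_iff:
  assumes "u \<in> vert" "v \<in> vert"
  shows "interval_step n A m (unit_interval_at n u) (unit_interval_at n v) \<longleftrightarrow> step u v"
  unfolding interval_step_def has_type_iff[OF assms(1)] unit_interval_subset_working step_def
  using assms code_props[OF assms(1)] by blast

section \<open>Strong components and spectral radii in the graph of the theorem\<close>

abbreviation "G \<equiv> Xi_graph n A m"

definition edge :: "real set \<Rightarrow> real set \<Rightarrow> bool" where "edge I I' \<longleftrightarrow> I \<rightarrow>\<^bsub>G\<^esub> I'"

lemma verts_G: "verts G = Xi n A m"
  by (simp add: Xi_graph_def)

lemma edge_iff: "edge I I' \<longleftrightarrow> I \<in> Xi n A m \<and> I' \<in> Xi n A m \<and> interval_step n A m I I'"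
  by (auto simp: edge_def Xi_graph_def arcs_ends_def arc_to_ends_def image_iff)

lemma edge_step: "u \<in> vert \<Longrightarrow> v \<in> vert \<Longrightarrow> step u v \<longleftrightarrow> edge (unit_interval_at n u) (unit_interval_at n v)"
  by (auto simp: edge_iff interval_step_iff Xi_eq)

lemma finite_Xi: "finite (Xi n A m)" and Xi_nonempty: "Xi n A m \<noteq> {}"
  unfolding Xi_eq using finite_vert vert_nonempty by auto

lemma succ_sum_pow_edge:
  "u \<in> vert \<Longrightarrow> ((succ_sum step vert) ^^ k) (\<lambda>u. h (unit_interval_at n u)) u
     = ((succ_sum edge (Xi n A m)) ^^ k) h (unit_interval_at n u)"
  using succ_sum_pow_reindex[of "unit_interval_at n" vert "Xi n A m" step edge u k h] bij_vert edge_step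
  by blast

lemma succ_sum_edge:
  "u \<in> vert \<Longrightarrow> succ_sum step vert (\<lambda>u. h (unit_interval_at n u)) u
     = succ_sum edge (Xi n A m) h (unit_interval_at n u)"
  using succ_sum_pow_edge[of u 1 h] by simp

sublocale graph: finite_relation edge "Xi n A m"
  by unfold_locales (auto simp: edge_iff finite_Xi)

sublocale graph: wf_digraph G
  by unfold_locales (auto simp: Xi_graph_def)

lemma adjacency_matrix_G: "adjacency_matrix G = rel_matrix edge (Xi n A m)"
  by (simp add: adjacency_matrix_def rel_matrix_def edge_def verts_G)

lemma reachable_iff: "u \<in> Xi n A m \<Longrightarrow> u \<rightarrow>\<^sup>*\<^bsub>G\<^esub> v \<longleftrightarrow> edge\<^sup>*\<^sup>* u v"
  by (subst graph.reachable_conv') (auto simp: verts_G edge_def rtranclp_rtrancl_eq)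

lemma sccs_G: "pre_digraph.sccs G = (\<lambda>u. G \<restriction> graph.scc u) ` Xi n A m"
proof -
  have "graph.scc_of u = graph.scc u" if "u \<in> Xi n A m" for u
  proof -
    have "v \<in> Xi n A m" if "edge\<^sup>*\<^sup>* u v" for v
      using that \<open>u \<in> Xi n A m\<close> by induction (auto simp: edge_iff)
    then show ?thesis
      using that reachable_iff graph.reachable_in_verts
      unfolding graph.scc_of_def graph.scc_def verts_G by blast
  qed
  then show ?thesis
    unfolding graph.sccs_conv_sccs_verts graph.sccs_verts_conv_scc_of verts_G
    by (auto simp: image_image)
qed

lemma spectral_radius_scc:
  assumes "u \<in> Xi n A m"
  shows "real_spectral_radius (adjacency_matrix (G \<restriction> graph.scc u)) = rel_radius edge (graph.scc u)"
proof -
  let ?S = "graph.scc u"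
  have S: "from_nat_into ?S i \<in> ?S" for i using graph.scc_self by (intro from_nat_into) auto
  have "x \<rightarrow>\<^bsub>G \<restriction> ?S\<^esub> y \<longleftrightarrow> edge x y" if "x \<in> ?S" "y \<in> ?S" for x y
    using that by (auto simp: edge_def arcs_ends_def arc_to_ends_def induce_subgraph_def image_iff)
  then have "adjacency_matrix (G \<restriction> ?S) = rel_matrix edge ?S"
    unfolding adjacency_matrix_def rel_matrix_def using S by (intro eq_matI) auto
  then show ?thesis by (simp add: rel_radius_def)
qed

text \<open>Comparable components are different exactly if no path leads back. In this form the
  criterion speaks of vertices, as the growth estimates do.\<close>

lemma comparable_sccs_iff:
  "(\<exists>H\<in>pre_digraph.sccs G. \<exists>H'\<in>pre_digraph.sccs G. H \<noteq> H' \<and>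
      real_spectral_radius (adjacency_matrix H) = rel_radius edge (Xi n A m) \<and>
      real_spectral_radius (adjacency_matrix H') = rel_radius edge (Xi n A m) \<and> scc_prec G H H')
   \<longleftrightarrow> (\<exists>u\<in>graph.critical. \<exists>v\<in>graph.critical. edge\<^sup>*\<^sup>* u v \<and> \<not> edge\<^sup>*\<^sup>* v u)"
  (is "?L \<longleftrightarrow> ?R")
proof
  assume ?L
  then obtain a b where ab: "a \<in> Xi n A m" "b \<in> Xi n A m"
    "G \<restriction> graph.scc a \<noteq> G \<restriction> graph.scc b"
    "rel_radius edge (graph.scc a) = rel_radius edge (Xi n A m)"
    "rel_radius edge (graph.scc b) = rel_radius edge (Xi n A m)"
    "scc_prec G (G \<restriction> graph.scc a) (G \<restriction> graph.scc b)"
    unfolding sccs_G by (auto simp: spectral_radius_scc)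
  then obtain u v where uv: "u \<in> graph.scc a" "v \<in> graph.scc b" "u \<rightarrow>\<^sup>*\<^bsub>G\<^esub> v"
    by (auto simp: scc_prec_def)
  have crit: "a \<in> graph.critical" "b \<in> graph.critical" using ab by (auto simp: graph.critical_def)
  have u: "u \<in> graph.critical" and v: "v \<in> graph.critical"
    using graph.critical_scc crit uv by blast+
  then have uX: "u \<in> Xi n A m" by (simp add: graph.critical_def)
  have E: "edge\<^sup>*\<^sup>* u v" using uv(3) reachable_iff[OF uX] by simp
  have "\<not> edge\<^sup>*\<^sup>* v u"
  proof
    assume "edge\<^sup>*\<^sup>* v u"
    then have "v \<in> graph.scc u" using E by (simp add: graph.scc_def)
    then have "graph.scc a = graph.scc b" using graph.scc_eq uv by metis
    with ab(3) show False by simp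
  qed
  with u v E show ?R by blast
next
  assume ?R
  then obtain u v where uv: "u \<in> graph.critical" "v \<in> graph.critical" "edge\<^sup>*\<^sup>* u v" "\<not> edge\<^sup>*\<^sup>* v u"
    by blast
  then have X: "u \<in> Xi n A m" "v \<in> Xi n A m" by (auto simp: graph.critical_def)
  have "graph.scc u \<noteq> graph.scc v" using uv(4) graph.scc_self[of u] graph.scc_self[of v] by (auto simp: graph.scc_def)
  then have "G \<restriction> graph.scc u \<noteq> G \<restriction> graph.scc v" by (metis induce_subgraph_verts)
  moreover have "scc_prec G (G \<restriction> graph.scc u) (G \<restriction> graph.scc v)"
    unfolding scc_prec_def
    using graph.scc_self[of u] graph.scc_self[of v] uv(3) reachable_iff[OF X(1)] by auto
  ultimately show ?L
    unfolding sccs_G using X uv(1,2)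
    by (intro bexI[of _ "G \<restriction> graph.scc u"] bexI[of _ "G \<restriction> graph.scc v"])
      (auto simp: spectral_radius_scc graph.critical_def)
qed

text \<open>A positive entry of a matrix power has a positive summand, hence comes from a path.
  Since every path can then be reversed, the case of infinite measure is excluded.\<close>

lemma irreducible_reachable:
  assumes irr: "irreducible_nonneg_mat (adjacency_matrix G)" and X: "I \<in> Xi n A m" "I' \<in> Xi n A m"
  shows "edge\<^sup>*\<^sup>* I I'"
proof -
  let ?M = "rel_matrix edge (Xi n A m)" and ?N = "card (Xi n A m)" and ?b = "from_nat_into (Xi n A m)"
  have M: "?M \<in> carrier_mat ?N ?N" by (simp add: rel_matrix_def)
  have path: "edge\<^sup>*\<^sup>* (?b i) (?b j)" if "i < ?N" "j < ?N" "(?M ^\<^sub>m k) $$ (i, j) > 0" for i j k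
    using that
  proof (induction k arbitrary: j)
    case 0
    then show ?case using M by (auto simp: one_mat_def split: if_splits)
  next
    case (Suc k)
    have Mk: "?M ^\<^sub>m k \<in> carrier_mat ?N ?N" using M by simp
    have "(?M ^\<^sub>m Suc k) $$ (i, j) = (\<Sum>l<?N. (?M ^\<^sub>m k) $$ (i, l) * ?M $$ (l, j))"
      using Suc.prems carrier_matD[OF Mk] carrier_matD[OF M]
      by (simp add: scalar_prod_def atLeast0LessThan del: pow_mat_dim)
    with Suc.prems(3) obtain l where l: "l < ?N" "(?M ^\<^sub>m k) $$ (i, l) * ?M $$ (l, j) > 0"
      using sum_nonpos[of "{..<?N}" "\<lambda>l. (?M ^\<^sub>m k) $$ (i, l) * ?M $$ (l, j)"] by (force simp: not_less)
    have "edge (?b l) (?b j)" "(?M ^\<^sub>m k) $$ (i, l) > 0"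
      using l Suc.prems(2) by (auto simp: rel_matrix_def split: if_splits)
    then show ?case using Suc.IH[OF Suc.prems(1) l(1)] by (meson rtranclp.rtrancl_into_rtrancl)
  qed
  have b: "bij_betw ?b {..<?N} (Xi n A m)" using finite_Xi by (simp add: bij_betw_from_nat_into_finite)
  have ex: "\<exists>i<?N. J = ?b i" if "J \<in> Xi n A m" for J
  proof -
    have "J \<in> ?b ` {..<?N}" unfolding bij_betw_imp_surj_on[OF b] by (rule that)
    then show ?thesis by blast
  qed
  obtain i j where ij: "i < ?N" "I = ?b i" "j < ?N" "I' = ?b j"
    using ex[OF X(1)] ex[OF X(2)] by blast
  obtain k where "(?M ^\<^sub>m k) $$ (i, j) > 0"
    using irr ij(1,3) M unfolding irreducible_nonneg_mat_def adjacency_matrix_G by auto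
  then show ?thesis using path ij by blast
qed

section \<open>Measure and dimension of the set of points with one preimage\<close>

abbreviation "spec_rad \<equiv> rel_radius edge (Xi n A m)"

text \<open>A subsolution taken as the same mass function at every level is bounded at all levels,
  so \<open>L = 0\<close> suffices.\<close>

lemma U_measure_pos:
  assumes s: "0 < s" "spec_rad = real n powr s"
  shows "0 < hausdorff_measure s (U_set m K 1)"
proof -
  obtain h where h: "\<And>u. 0 \<le> h u" "\<exists>u\<in>Xi n A m. 0 < h u"
    "\<And>u. u \<in> Xi n A m \<Longrightarrow> spec_rad * h u \<le> succ_sum edge (Xi n A m) h u"
    using rel_radius_subsolution[OF finite_Xi Xi_nonempty, of edge] by blast
  obtain u0 where u0: "u0 \<in> vert" "0 < h (unit_interval_at n u0)" using h(2) unfolding Xi_eq by blast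
  define B where "B = 1 + (\<Sum>u\<in>vert. h (unit_interval_at n u))"
  have S0: "0 \<le> (\<Sum>u\<in>vert. h (unit_interval_at n u))" using h(1) by (intro sum_nonneg) auto
  then have B: "0 < B" by (simp add: B_def)
  have "ennreal (h (unit_interval_at n u0) / (4 * B * (real n powr s)\<^sup>2)) \<le> hausdorff_measure s coded"
  proof (rule coded_measure_ge[where \<nu> = "\<lambda>_ u. h (unit_interval_at n u)" and L = 0, OF s(1) u0(1) h(1) _ B])
    show "real n powr s * h (unit_interval_at n u) \<le> succ_sum step vert (\<lambda>u. h (unit_interval_at n u)) u"
      if "u \<in> vert" for u
    proof -
      have "unit_interval_at n u \<in> Xi n A m" unfolding Xi_eq using that by blast
      from h(3)[OF this] show ?thesis unfolding succ_sum_edge[OF that] s(2)[symmetric] .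
    qed
    show "h (unit_interval_at n u) \<le> B" if "u \<in> vert" for u
      using member_le_sum[OF that, of "\<lambda>u. h (unit_interval_at n u)"] h(1) finite_vert by (simp add: B_def)
  qed
  also have "\<dots> \<le> hausdorff_measure s (U_set m K 1)" by (rule coded_measure_le_U[OF s(1)])
  finally have "ennreal (h (unit_interval_at n u0) / (4 * B * (real n powr s)\<^sup>2)) \<le> hausdorff_measure s (U_set m K 1)" .
  moreover have "0 < ennreal (h (unit_interval_at n u0) / (4 * B * (real n powr s)\<^sup>2))"
    using u0(2) B n_pos by simp
  ultimately show ?thesis by (rule less_le_trans[rotated])
qed

text \<open>The mass function is \<open>g\<close> from level \<open>L\<close> on, so its bound
  \<open>B\<close> on deep cylinders does not depend on \<open>L\<close>, while at the root it can
  be made to exceed any multiple of \<open>B\<close>.\<close>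

lemma U_measure_infinite:
  assumes s: "0 < s" "spec_rad = real n powr s"
    and uv: "u \<in> graph.critical" "v \<in> graph.critical" "edge\<^sup>*\<^sup>* u v" "\<not> edge\<^sup>*\<^sup>* v u"
  shows "hausdorff_measure s (U_set m K 1) = \<infinity>"
proof (rule ccontr)
  let ?T = "succ_sum edge (Xi n A m)"
  let ?I = "unit_interval_at n"
  assume "hausdorff_measure s (U_set m K 1) \<noteq> \<infinity>"
  then obtain y where y: "0 \<le> y" "hausdorff_measure s (U_set m K 1) = ennreal y"
    by (cases "hausdorff_measure s (U_set m K 1)") auto
  have r: "0 < spec_rad" using n_pos by (simp add: s(2))
  obtain g where g: "\<And>w. 0 \<le> g w" "\<And>w. w \<in> Xi n A m \<Longrightarrow> spec_rad * g w \<le> ?T g w"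
    "\<And>b. \<exists>k. \<exists>w\<in>Xi n A m. b * spec_rad ^ k < (?T ^^ k) g w"
    using graph.subsolution_unbounded[OF r uv] by blast
  define B where "B = 1 + (\<Sum>u\<in>vert. g (?I u))"
  have "0 \<le> (\<Sum>u\<in>vert. g (?I u))" using g(1) by (intro sum_nonneg) auto
  then have B: "0 < B" by (simp add: B_def)
  define c where "c = 4 * B * (real n powr s)\<^sup>2"
  have c: "0 < c" using B n_pos by (simp add: c_def)
  obtain L w where Lw: "w \<in> Xi n A m" "(y * c) * spec_rad ^ L < (?T ^^ L) g w" using g(3) by blast
  obtain u0 where u0: "u0 \<in> vert" "w = ?I u0" using Lw(1) unfolding Xi_eq by blast
  \<comment> \<open>Before level \<open>L\<close> the mass inequality is an equality; from
    \<open>L\<close> on, where truncated subtraction gives exponent 0, it is the subsolution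
    property of \<open>g\<close>.\<close>
  define \<mu> where "\<mu> k I = (?T ^^ (L - k)) g I / spec_rad ^ (L - k)" for k I
  define \<nu> where "\<nu> k u = \<mu> k (?I u)" for k u
  have nn: "0 \<le> (?T ^^ k) g I" for k I
    by (induction k arbitrary: I) (auto simp: g(1) intro!: succ_sum_nonneg)
  have sub: "spec_rad * \<mu> k I \<le> ?T (\<mu> (Suc k)) I" if "I \<in> Xi n A m" for k I
  proof (cases "k < L")
    case True
    then have Lk: "L - k = Suc (L - Suc k)" by simp
    have "?T (\<mu> (Suc k)) I = ?T (\<lambda>I. (1 / spec_rad ^ (L - Suc k)) * (?T ^^ (L - Suc k)) g I) I"
      by (simp add: \<mu>_def[abs_def])
    also have "\<dots> = spec_rad * \<mu> k I"
      unfolding succ_sum_scale \<mu>_def Lk using r by simp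
    finally show ?thesis by simp
  next
    case False
    then have "\<mu> k = g" "\<mu> (Suc k) = g" by (auto simp: \<mu>_def)
    then show ?thesis using g(2)[OF that] by simp
  qed
  have "ennreal (\<nu> 0 u0 / (4 * B * (real n powr s)\<^sup>2)) \<le> hausdorff_measure s coded"
  proof (rule coded_measure_ge[where \<nu> = \<nu> and L = L, OF s(1) u0(1) _ _ B])
    show "0 \<le> \<nu> k u" for k u using nn r by (simp add: \<nu>_def \<mu>_def)
    show "real n powr s * \<nu> k u \<le> succ_sum step vert (\<nu> (Suc k)) u" if "u \<in> vert" for k u
    proof -
      have "?I u \<in> Xi n A m" unfolding Xi_eq using that by blast
      from sub[OF this, of k] show ?thesis unfolding \<nu>_def[abs_def] succ_sum_edge[OF that] s(2)[symmetric] .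
    qed
    show "\<nu> k u \<le> B" if "L \<le> k" "u \<in> vert" for k u
      using member_le_sum[OF that(2), of "\<lambda>u. g (?I u)"] that(1) g(1) finite_vert
      by (simp add: B_def \<nu>_def \<mu>_def)
  qed
  also have "\<dots> \<le> ennreal y" using coded_measure_le_U[OF s(1)] y(2) by simp
  finally have "\<nu> 0 u0 / c \<le> y" using y(1) by (simp add: c_def)
  then have "\<nu> 0 u0 \<le> y * c" using c by (simp add: pos_divide_le_eq)
  moreover have "y * c < \<nu> 0 u0"
    using Lw(2) r unfolding \<nu>_def \<mu>_def u0(2)[symmetric] by (simp add: pos_less_divide_eq)
  ultimately show False by simp
qed

lemma U_measure_finite:
  assumes s: "0 < s" "spec_rad = real n powr s"
    and cov: "covering_condition n A m" and sep: "\<And>k. strong_separation (A k)"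
    and chain: "\<And>u v. u \<in> graph.critical \<Longrightarrow> v \<in> graph.critical \<Longrightarrow> edge\<^sup>*\<^sup>* u v \<Longrightarrow> edge\<^sup>*\<^sup>* v u"
  shows "hausdorff_measure s (U_set m K 1) < \<infinity>"
proof -
  have r: "0 < spec_rad" using n_pos by (simp add: s(2))
  obtain c where c: "\<And>k u. u \<in> Xi n A m \<Longrightarrow>
      ((succ_sum edge (Xi n A m)) ^^ k) (\<lambda>_. 1) u \<le> c * spec_rad ^ k"
    using graph.path_count_bound[OF r chain] by blast
  have bd: "((succ_sum step vert) ^^ k) (\<lambda>_. 1) u \<le> c * spec_rad ^ k" if "u \<in> vert" for k u
    using c[of "unit_interval_at n u" k] succ_sum_pow_edge[OF that, of k "\<lambda>_. 1"] that
    unfolding Xi_eq by simp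
  have c0: "0 \<le> c" using vert_nonempty bd[of _ 0] by force
  have "hausdorff_measure s (U_set m K 1) \<le> hausdorff_measure s (coded \<union> nadic n)"
    by (rule hausdorff_measure_mono[OF U_subset_coded[OF cov sep]])
  also have "\<dots> \<le> hausdorff_measure s coded + hausdorff_measure s (nadic n)" by (rule hausdorff_measure_Un)
  also have "\<dots> = hausdorff_measure s coded"
    using hausdorff_measure_countable[OF s(1) countable_nadic[OF n2]] by simp
  also have "\<dots> \<le> ennreal (real (card vert) * c)"
    by (rule coded_measure_le[OF s(1) _ _ c0 bd]) (use s(2) r in auto)
  also have "\<dots> < \<infinity>" by simp
  finally show ?thesis .
qed

text \<open>Any \<open>t\<close> above \<open>s\<close> leaves room for a rate \<open>r\<close>
  between the radius and \<open>n powr t\<close>, and the sums over level covers then tend to 0. The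
  inequality for \<open>spec_rad\<close> admits radius 0 with \<open>s = 0\<close>.\<close>

lemma U_dim_le:
  assumes s: "0 \<le> s" "spec_rad \<le> real n powr s" and cov: "covering_condition n A m"
  shows "hausdorff_dim (U_set m K 1) \<le> ereal s"
proof (rule hausdorff_dim_le[OF s(1)])
  fix t assume t: "s < t"
  have "real n powr s < real n powr t" using n2 t by (intro powr_less_mono) auto
  with s(2) have "spec_rad < real n powr t" by simp
  then obtain r where r: "spec_rad < r" "r < real n powr t" using dense by blast
  obtain c where c: "\<And>k u. u \<in> Xi n A m \<Longrightarrow>
      ((succ_sum edge (Xi n A m)) ^^ k) (\<lambda>_. 1) u \<le> c * r ^ k"
    using rel_matrix_pow_bound[OF finite_Xi Xi_nonempty r(1)] by blast
  have bd: "((succ_sum step vert) ^^ k) (\<lambda>_. 1) u \<le> c * r ^ k" if "u \<in> vert" for k u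
    using c[of "unit_interval_at n u" k] succ_sum_pow_edge[OF that, of k "\<lambda>_. 1"] that
    unfolding Xi_eq by simp
  have "hausdorff_measure t coded = 0"
    using rel_radius_nonneg[OF finite_Xi Xi_nonempty, of edge] r s(1) t
    by (intro coded_measure_null[of t r c] bd) auto
  then show "hausdorff_measure t (U_set m K 1) = 0"
    using U_measure_null[OF cov, of t] s(1) t by simp
qed

end

theorem theorem1:
  fixes n :: nat
    and A :: "'l::finite \<Rightarrow> int set"
    and K :: "'l \<Rightarrow> real set"
    and m :: "'l \<Rightarrow> int"
    and G :: "(real set, real set \<times> real set) pre_digraph"
    and M :: "real mat"
    and \<rho> :: "(real set, real set \<times> real set) pre_digraph \<Rightarrow> real"
    and U\<^sub>1 :: "real set"
    and s :: real
  assumes n: "n \<ge> 2"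
    and A: "\<And>k. A k \<subseteq> {0..int n - 1}" "\<And>k. A k \<noteq> {}"
    and K: "\<And>k. is_self_similar_set n (A k) (K k)"
    and m: "(\<Prod>k\<in>UNIV. m k) \<noteq> 0"
    and U\<^sub>1: "U\<^sub>1 = U_set m K 1"
    and G: "G = Xi_graph n A m"
    and M: "M = adjacency_matrix G"
    and \<rho>: "\<And>H. \<rho> H = real_spectral_radius (adjacency_matrix H)"
    and s: "s = (if real_spectral_radius M = 0 then 0
                 else ln (real_spectral_radius M) / ln (real n))"
  shows "(ereal s \<le> hausdorff_dim U\<^sub>1 \<and> hausdorff_measure s U\<^sub>1 > 0) \<and>
         (covering_condition n A m \<longrightarrow> hausdorff_dim U\<^sub>1 = ereal s) \<and>
         (covering_condition n A m \<and> (\<forall>k. strong_separation (A k)) \<and> s > 0 \<longrightarrow>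
           (hausdorff_measure s U\<^sub>1 = \<infinity> \<longleftrightarrow>
             (\<exists>H\<in>pre_digraph.sccs G. \<exists>H'\<in>pre_digraph.sccs G. H \<noteq> H' \<and>
                \<rho> H = real_spectral_radius M \<and> \<rho> H' = real_spectral_radius M \<and>
                scc_prec G H H')) \<and>
           (irreducible_nonneg_mat M \<longrightarrow>
              0 < hausdorff_measure s U\<^sub>1 \<and> hausdorff_measure s U\<^sub>1 < \<infinity>))"
proof -
  interpret digit_system n A K m
  proof
    show "m k \<noteq> 0" for k using m by (simp add: prod_zero_iff)
  qed (use n A K in auto)
  have R: "real_spectral_radius M = spec_rad"
    unfolding M G adjacency_matrix_G by (simp add: rel_radius_def)
  have r0: "0 \<le> spec_rad" by (rule rel_radius_nonneg[OF finite_Xi Xi_nonempty])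
  have r1: "1 \<le> spec_rad" if "spec_rad \<noteq> 0"
    using rel_radius_ge_1[OF finite_Xi Xi_nonempty, of edge] r0 that by simp
  have s0: "0 \<le> s" unfolding s R using r1 n by auto
  have pw: "spec_rad = real n powr s" if "spec_rad \<noteq> 0"
    unfolding s R using that r1[OF that] n by (simp add: powr_def)
  have pw_le: "spec_rad \<le> real n powr s" using pw by (cases "spec_rad = 0") auto
  have pws: "spec_rad = real n powr s" if "0 < s" using that pw s R by (cases "spec_rad = 0") auto
  have pos: "0 < hausdorff_measure s U\<^sub>1"
  proof (cases "s = 0")
    \<comment> \<open>The measure counts points here, so \<open>U_nonempty\<close> decides, whether
      the radius is 0 or 1.\<close>
    case True
    have "0 < hausdorff_measure 0 (U_set m K 1)"
      using hausdorff_measure_0_pos[OF U_nonempty] by (rule less_le_trans[rotated]) simp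
    then show ?thesis by (simp only: True U\<^sub>1)
  next
    case False
    then show ?thesis unfolding U\<^sub>1 using U_measure_pos pws s0 by simp
  qed
  have ge: "ereal s \<le> hausdorff_dim U\<^sub>1" by (rule hausdorff_dim_ge[OF pos])
  have le: "hausdorff_dim U\<^sub>1 = ereal s" if "covering_condition n A m"
    using ge U_dim_le[OF s0 pw_le that] unfolding U\<^sub>1 by (rule antisym[rotated])
  have pair: "(\<exists>H\<in>pre_digraph.sccs G. \<exists>H'\<in>pre_digraph.sccs G. H \<noteq> H' \<and>
                \<rho> H = real_spectral_radius M \<and> \<rho> H' = real_spectral_radius M \<and> scc_prec G H H')
      \<longleftrightarrow> (\<exists>u\<in>graph.critical. \<exists>v\<in>graph.critical. edge\<^sup>*\<^sup>* u v \<and> \<not> edge\<^sup>*\<^sup>* v u)"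
    unfolding \<rho> R G by (rule comparable_sccs_iff)
  have part3: "(hausdorff_measure s U\<^sub>1 = \<infinity> \<longleftrightarrow>
             (\<exists>H\<in>pre_digraph.sccs G. \<exists>H'\<in>pre_digraph.sccs G. H \<noteq> H' \<and>
                \<rho> H = real_spectral_radius M \<and> \<rho> H' = real_spectral_radius M \<and>
                scc_prec G H H')) \<and>
           (irreducible_nonneg_mat M \<longrightarrow>
              0 < hausdorff_measure s U\<^sub>1 \<and> hausdorff_measure s U\<^sub>1 < \<infinity>)"
    if cov: "covering_condition n A m" and sep: "\<And>k. strong_separation (A k)" and sp: "s > 0"
  proof -
    have inf: "hausdorff_measure s U\<^sub>1 = \<infinity>"
      if "\<exists>u\<in>graph.critical. \<exists>v\<in>graph.critical. edge\<^sup>*\<^sup>* u v \<and> \<not> edge\<^sup>*\<^sup>* v u"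
      using that U_measure_infinite[OF sp pws[OF sp]] unfolding U\<^sub>1 by blast
    have fin: "hausdorff_measure s U\<^sub>1 < \<infinity>"
      if "\<not> (\<exists>u\<in>graph.critical. \<exists>v\<in>graph.critical. edge\<^sup>*\<^sup>* u v \<and> \<not> edge\<^sup>*\<^sup>* v u)"
      unfolding U\<^sub>1 by (rule U_measure_finite[OF sp pws[OF sp] cov sep]) (use that in blast)
    have irr: "\<not> (\<exists>u\<in>graph.critical. \<exists>v\<in>graph.critical. edge\<^sup>*\<^sup>* u v \<and> \<not> edge\<^sup>*\<^sup>* v u)"
      if "irreducible_nonneg_mat M"
      using irreducible_reachable that unfolding M G graph.critical_def by blast
    show ?thesis
      unfolding pair using inf fin irr pos by (metis less_irrefl)
  qed
  show ?thesis using pos ge le part3 by blast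
qed

end
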